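(* Let $\mathcal{A}$ be an arrangement of hyperplanes in $\mathbb{K}^\ell$. If $\mathcal{A}\in\mathcal{AF}$ (i.e. $\mathcal{A}$ is additionally free), then $\mathcal{A}$ is free. In particular, Terao's conjecture is true in the class of additionally free arrangements: if $\mathcal{A}\in\mathcal{AF}$ and $\mathcal{C}$ is an arrangement in $\mathbb{K}^\ell$ with $L(\mathcal{C})\cong L(\mathcal{A})$ as posets, then $\mathcal{C}$ is free.
   Context: Let $\mathbb{K}$ be a field, $V=\mathbb{K}^\ell$, $S=\mathrm{Sym}(V^* )=\mathbb{K}[x_1,\ldots,x_\ell]$ with its standard grading, and $\mathrm{Der}\,S=\bigoplus_{i=1}^\ell S\,\partial_{x_i}$. An arrangement (of hyperplanes) in $V$ is a finite set of linear hyperplanes of $V$; for $H\in\mathcal{A}$ fix a linear form $\alpha_H\in V^*$ with kernel $H$. Freeness: $D(\mathcal{A}):=\{\theta\in\mathrm{Der}\,S\mid\theta(\alpha_H)\in S\alpha_H\ \text{for all }H\in\mathcal{A}\}$. A nonzero $\theta\in\mathrm{Der}\,S$ is homogeneous of degree $d$ if $\theta(\alpha)\in S_d$ for all $\alpha\in V^*$. $\mathcal{A}$ is free if $D(\mathcal{A})$ has a homogeneous $S$-basis $\theta_1,\dots,\theta_\ell$. Combinatorics: $L(\mathcal{A}):=\{\bigcap_{H\in\mathcal{B}}H\mid\mathcal{B}\subset\mathcal{A}\}$ (with $V\in L(\mathcal{A})$ as the empty intersection), partially ordered by (reverse) inclusion. The Möbius function $\mu:L(\mathcal{A})\to\mathbb{Z}$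 is defined by $\mu(V)=1$ and $\mu(X)=-\sum_{Y\in L(\mathcal{A}),\,X\subsetneq Y\subset V}\mu(Y)$ for $X\ne V$; the characteristic polynomial is $\chi(\mathcal{A};t)=\sum_{X\in L(\mathcal{A})}\mu(X)t^{\dim X}$. For $X\in L(\mathcal{A})$, the localization is $\mathcal{A}_X:=\{H\in\mathcal{A}\mid X\subset H\}$ (an arrangement in $V$). For $H\in\mathcal{A}$, the restriction $\mathcal{A}^H:=\{L\cap H\mid L\in\mathcal{A}\setminus\{H\}\}$ is an arrangement in $H\cong\mathbb{K}^{\ell-1}$. For $X\in L(\mathcal{A}^H)$ (a subspace of $H$, hence also an element of $L(\mathcal{A})$), $\mathcal{A}_X^H:=(\mathcal{A}_X)^H=(\mathcal{A}^H)_X$. For $H\in\mathcal{A}$: $\mathcal{A}$ is divisional along $H$ if $\chi(\mathcal{A}_X^H;t)$ divides $\chi(\mathcal{A}_X;t)$ for all $X\in L(\mathcal{A}^H)$. Additionally free arrangements: $\mathcal{AF}$ is the set of arrangements $\mathcal{A}$ for which there is a filtration $\emptyset=\mathcal{A}_0\subset\mathcal{A}_1\subset\cdots\subset\mathcal{A}_n=\mathcal{A}$ such that, for $i=1,\ldots,n$, $\mathcal{A}_i\setminus\mathcal{A}_{i-1}=\{H_i\}$ consists of a single hyperplane and $\mathcal{A}_i$ is divisional along $H_i$. Terao's conjecture asks whether freeness of $\mathcal{A}$ depends only on $L(\mathcal{A})$. *)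

theory Defs
  imports
    "HOL-Analysis.Cartesian_Space"
    "HOL-Library.Poly_Mapping"
    "HOL-Computational_Algebra.Polynomial"
begin

text \<open>
  The vector space is \<open>'k ^ 'n\<close> over the field \<open>'k\<close>, so \<open>l = CARD('n)\<close> and the coordinates
  are indexed by the finite type \<open>'n\<close>.
  A linear form is given by its coefficient vector \<open>a :: 'k ^ 'n\<close>.
\<close>

type_synonym ('k, 'n) mpoly = "('n \<Rightarrow>\<^sub>0 nat) \<Rightarrow>\<^sub>0 'k"

text \<open>The element \<open>\<Sum>i. a $ i * x_i\<close> of the symmetric algebra of the dual space.\<close>

definition linear_form :: "'k::field ^ 'n::finite \<Rightarrow> ('k, 'n) mpoly" where
  "linear_form a = (\<Sum>i\<in>UNIV. Poly_Mapping.single (Poly_Mapping.single i 1) (a $ i))"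

definition form_kernel :: "'k::field ^ 'n::finite \<Rightarrow> ('k ^ 'n) set" where
  "form_kernel a = {v. (\<Sum>i\<in>UNIV. a $ i * v $ i) = 0}"

definition homogeneous_part :: "nat \<Rightarrow> ('k::field, 'n::finite) mpoly set" where
  "homogeneous_part d =
     {p. \<forall>m\<in>Poly_Mapping.keys p. (\<Sum>i\<in>UNIV. Poly_Mapping.lookup m i) = d}"

text \<open>
  Subtraction of exponents truncates at \<open>0\<close>; this only affects terms whose coefficient is \<open>0\<close>.
\<close>

definition partial_deriv :: "'n::finite \<Rightarrow> ('k::field, 'n) mpoly \<Rightarrow> ('k, 'n) mpoly" where
  "partial_deriv i p =
     (\<Sum>m\<in>Poly_Mapping.keys p.
        Poly_Mapping.single (m - Poly_Mapping.single i 1)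
          (of_nat (Poly_Mapping.lookup m i) * Poly_Mapping.lookup p m))"

text \<open>
  The free module of derivations with basis the partial derivatives is represented by its
  coefficient vectors: \<open>\<theta>\<close> stands for \<open>\<Sum>i. \<theta> $ i * \<partial>_i\<close>, and \<open>*s\<close> is the module structure.
\<close>

type_synonym ('k, 'n) derivation = "('k, 'n) mpoly ^ 'n"

definition der_apply ::
  "('k::field, 'n::finite) derivation \<Rightarrow> ('k, 'n) mpoly \<Rightarrow> ('k, 'n) mpoly" where
  "der_apply \<theta> p = (\<Sum>i\<in>UNIV. \<theta> $ i * partial_deriv i p)"

definition homogeneous_der :: "nat \<Rightarrow> ('k::field, 'n::finite) derivation \<Rightarrow> bool" where
  "homogeneous_der d \<theta> \<longleftrightarrow>
     \<theta> \<noteq> 0 \<and> (\<forall>a. der_apply \<theta> (linear_form a) \<in> homogeneous_part d)"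

lemma module_derivation:
  "module ((*s) :: ('k::field, 'n::finite) mpoly \<Rightarrow> ('k, 'n) derivation \<Rightarrow> _)"
  by unfold_locales (auto simp: vec_eq_iff algebra_simps)

definition arrangement :: "('k::field ^ 'n::finite) set set \<Rightarrow> bool" where
  "arrangement \<A> \<longleftrightarrow>
     finite \<A> \<and> (\<forall>H\<in>\<A>. vec.subspace H \<and> vec.dim H + 1 = CARD('n))"

definition defining_form :: "('k::field ^ 'n::finite) set \<Rightarrow> ('k, 'n) mpoly" where
  "defining_form H = linear_form (SOME a. form_kernel a = H)"

definition log_derivations ::
  "('k::field ^ 'n::finite) set set \<Rightarrow> ('k, 'n) derivation set" where
  "log_derivations \<A> =
     {\<theta>. \<forall>H\<in>\<A>. defining_form H dvd der_apply \<theta> (defining_form H)}"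

definition free_arrangement :: "('k::field ^ 'n::finite) set set \<Rightarrow> bool" where
  "free_arrangement \<A> \<longleftrightarrow>
     (\<exists>\<theta> :: 'n \<Rightarrow> ('k, 'n) derivation.
        (\<forall>i. \<exists>d. homogeneous_der d (\<theta> i)) \<and>
        inj \<theta> \<and> \<not> module.dependent (*s) (range \<theta>) \<and>
        module.span (*s) (range \<theta>) = log_derivations \<A>)"

text \<open>
  Restrictions are arrangements in a subspace, so the intersection lattice, the Moebius
  function and the characteristic polynomial take the ambient space \<open>W\<close> as an argument.
  The empty intersection gives \<open>W\<close> itself.
\<close>

definition flats :: "('k::field ^ 'n::finite) set \<Rightarrow> ('k ^ 'n) set set \<Rightarrow> ('k ^ 'n) set set" where
  "flats W \<A> = {W \<inter> \<Inter>\<B> | \<B>. \<B> \<subseteq> \<A>}"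

text \<open>
  The value \<open>0\<close> for infinitely many flats only serves termination: with a finite set of
  hyperplanes this case does not occur.
\<close>

function moebius ::
  "('k::field ^ 'n::finite) set \<Rightarrow> ('k ^ 'n) set set \<Rightarrow> ('k ^ 'n) set \<Rightarrow> int" where
  "moebius W \<A> X =
     (if infinite (flats W \<A>) then 0
      else if X = W then 1
      else - (\<Sum>Y\<in>{Y \<in> flats W \<A>. X \<subset> Y}. moebius W \<A> Y))"
  by auto
termination
proof (relation "measure (\<lambda>(W, \<A>, X). card {Y \<in> flats W \<A>. X \<subset> Y})")
  fix W X Y :: "('k::field ^ 'n::finite) set" and \<A>
  assume "\<not> infinite (flats W \<A>)" and "Y \<in> {Y \<in> flats W \<A>. X \<subset> Y}"
  then have "card {Z \<in> flats W \<A>. Y \<subset> Z} < card {Z \<in> flats W \<A>. X \<subset> Z}"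
    by (intro psubset_card_mono) auto
  then show "((W, \<A>, Y), (W, \<A>, X)) \<in> measure (\<lambda>(W, \<A>, X). card {Y \<in> flats W \<A>. X \<subset> Y})"
    by simp
qed simp

declare moebius.simps [simp del]

definition characteristic_poly :: "('k::field ^ 'n::finite) set \<Rightarrow> ('k ^ 'n) set set \<Rightarrow> int poly" where
  "characteristic_poly W \<A> = (\<Sum>X\<in>flats W \<A>. monom (moebius W \<A> X) (vec.dim X))"

definition localization ::
  "('k::field ^ 'n::finite) set set \<Rightarrow> ('k ^ 'n) set \<Rightarrow> ('k ^ 'n) set set" where
  "localization \<A> X = {H \<in> \<A>. X \<subseteq> H}"

definition restriction ::
  "('k::field ^ 'n::finite) set set \<Rightarrow> ('k ^ 'n) set \<Rightarrow> ('k ^ 'n) set set" where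
  "restriction \<A> H = (\<lambda>L. L \<inter> H) ` (\<A> - {H})"

definition divisional_along ::
  "('k::field ^ 'n::finite) set set \<Rightarrow> ('k ^ 'n) set \<Rightarrow> bool" where
  "divisional_along \<A> H \<longleftrightarrow>
     (\<forall>X\<in>flats H (restriction \<A> H).
        characteristic_poly H (restriction (localization \<A> X) H) dvd characteristic_poly UNIV (localization \<A> X))"

definition additionally_free :: "('k::field ^ 'n::finite) set set set" where
  "additionally_free =
     {\<A>. arrangement \<A> \<and>
       (\<exists>(n :: nat) (F :: nat \<Rightarrow> ('k ^ 'n) set set). F 0 = {} \<and> F n = \<A> \<and>
          (\<forall>i\<in>{1..n}. F (i - 1) \<subseteq> F i \<and>
             (\<exists>H. F i - F (i - 1) = {H} \<and> divisional_along (F i) H)))}"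

definition poset_isomorphic :: "'a set set \<Rightarrow> 'b set set \<Rightarrow> bool" where
  "poset_isomorphic P Q \<longleftrightarrow>
     (\<exists>f. bij_betw f P Q \<and> (\<forall>X\<in>P. \<forall>Y\<in>P. X \<subseteq> Y \<longleftrightarrow> f X \<subseteq> f Y))"

end

theory Submission
  imports Defs
begin

text \<open>
  The filtration is climbed one hyperplane at a time. Let \<open>\<A>' = \<A> - {H}\<close> have a homogeneous basis
  \<open>\<theta>\<^sub>1, \<dots>, \<theta>\<^sub>l\<close> of logarithmic derivations of degrees \<open>d\<^sub>i\<close>, suppose that the characteristic polynomial of
  \<open>\<A>'\<close> is \<open>\<Prod>(t - d\<^sub>i)\<close>, and let \<open>\<A>\<close> be divisional along \<open>H\<close>. Both properties pass to \<open>\<A>\<close>. Carrying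
  the factorisation along in the induction replaces Terao's factorisation theorem for arbitrary free
  arrangements.

  Write \<open>\<alpha>\<close> for the form of \<open>H\<close>. There is a product \<open>B\<close> of linear forms, of degree
  \<open>e = |\<A>'| - |\<A>\<^sup>H|\<close>, that divides \<open>\<theta>(\<alpha>)\<close> modulo \<open>\<alpha>\<close> for all \<open>\<theta>\<close> in \<open>D(\<A>')\<close> (\<open>terao_poly_dvd\<close>). If
  some \<open>\<theta>\<close> satisfies \<open>\<theta>(\<alpha>) = B\<close> modulo \<open>\<alpha>\<close>, then some basis element of degree \<open>e\<close> does so up to a
  constant, and an explicit change of basis makes \<open>\<A>\<close> free. The quotient of \<open>\<chi>(\<A>')\<close> by \<open>\<chi>(\<A>\<^sup>H)\<close> is
  \<open>t - e\<close>, and deletion-restriction yields the factorisation of \<open>\<chi>(\<A>)\<close> (\<open>addition_step\<close>).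

  It remains to show that \<open>B\<close> is attained (\<open>attains_terao_poly_step\<close>). Let \<open>J\<close> be the ideal of all \<open>p\<close> with
  \<open>p B = \<theta>(\<alpha>)\<close> modulo \<open>\<alpha>\<close> for some \<open>\<theta>\<close> in \<open>D(\<A>')\<close>; it is generated by \<open>\<alpha>\<close> and the quotients
  \<open>g\<^sub>i = \<theta>\<^sub>i(\<alpha>) / B\<close>. Let \<open>T\<close> be the intersection of all hyperplanes and \<open>c\<close> its dimension. By induction on
  the number of hyperplanes, the polynomial of every localization at a flat \<open>X \<noteq> T\<close> inside \<open>H\<close> is attained, so that
  \<open>J\<close> contains the product of the forms of all hyperplanes that do not contain \<open>X\<close>. Hence \<open>J\<close> and \<open>c\<close>
  further linear forms together generate an ideal that contains a power of every variable
  (\<open>power_in_span\<close>).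

  Suppose now that \<open>B\<close> is not attained. Then \<open>g\<^sub>i = 0\<close> whenever \<open>d\<^sub>i \<le> e\<close>, and such \<open>\<theta>\<^sub>i\<close> lie in \<open>D(\<A>)\<close>.
  There are at least \<open>c + 2\<close> such indices: one index has \<open>d\<^sub>i = e\<close>, and the remaining exponents are the roots of
  \<open>\<chi>(\<A>\<^sup>H)\<close>, which is divisible by \<open>t\<^sup>c\<close> and, if \<open>e > 0\<close>, vanishes at \<open>1\<close>; if \<open>e = 0\<close>, there would be
  \<open>c + 1\<close> independent constant derivations along the \<open>c\<close>-dimensional space \<open>T\<close>. Thus at most
  \<open>1 + c + (l - c - 2) = l - 1\<close> homogeneous polynomials of positive degree generate an ideal that
  contains a power of each of the \<open>l\<close> variables. This is impossible by a count of monomials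
  (\<open>card_generators_ge\<close>).

  For the second claim, Whitney's formula expresses characteristic polynomials by the dimensions of intersections of
  sets of hyperplanes. An isomorphism of intersection lattices preserves these dimensions, so it
  transports the filtration, and the first claim applies to \<open>\<C>\<close>.
\<close>

section \<open>Polynomials and their homogeneous components\<close>

definition monomial_degree :: "('n::finite \<Rightarrow>\<^sub>0 nat) \<Rightarrow> nat" where
  "monomial_degree m = (\<Sum>i\<in>UNIV. Poly_Mapping.lookup m i)"

lemma monomial_degree_add: "monomial_degree (m + m') = monomial_degree m + monomial_degree m'"
  by (simp add: monomial_degree_def lookup_add sum.distrib)

lemma monomial_degree_single [simp]: "monomial_degree (Poly_Mapping.single i k) = k"
  by (simp add: monomial_degree_def lookup_single when_def)

lemma homogeneous_part_iff:
  "p \<in> homogeneous_part d \<longleftrightarrow> (\<forall>m\<in>Poly_Mapping.keys p. monomial_degree m = d)"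
  by (simp add: homogeneous_part_def monomial_degree_def)

lemma homogeneous_add:
  "p \<in> homogeneous_part d \<Longrightarrow> q \<in> homogeneous_part d \<Longrightarrow> p + q \<in> homogeneous_part d"
  using Poly_Mapping.keys_add[of p q] by (auto simp: homogeneous_part_iff)

lemma homogeneous_diff:
  fixes p q :: "('k::field, 'n::finite) mpoly"
  shows "p \<in> homogeneous_part d \<Longrightarrow> q \<in> homogeneous_part d \<Longrightarrow> p - q \<in> homogeneous_part d"
  by (auto simp: homogeneous_part_iff in_keys_iff lookup_minus)

lemma homogeneous_0 [simp]: "0 \<in> homogeneous_part d"
  by (simp add: homogeneous_part_iff)

lemma homogeneous_sum:
  "(\<And>i. i \<in> I \<Longrightarrow> f i \<in> homogeneous_part d) \<Longrightarrow> (\<Sum>i\<in>I. f i) \<in> homogeneous_part d"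
  by (induction I rule: infinite_finite_induct) (auto intro: homogeneous_add)

lemma homogeneous_mult:
  fixes p q :: "('k::field, 'n::finite) mpoly"
  shows "p \<in> homogeneous_part d \<Longrightarrow> q \<in> homogeneous_part e \<Longrightarrow> p * q \<in> homogeneous_part (d + e)"
  using Poly_Mapping.keys_mult[of p q] by (fastforce simp: homogeneous_part_iff monomial_degree_add)

lemma homogeneous_single [simp]: "Poly_Mapping.single m c \<in> homogeneous_part d \<longleftrightarrow>
    c = 0 \<or> monomial_degree m = d"
  by (auto simp: homogeneous_part_iff)

lemma homogeneous_linear_form [simp]: "linear_form a \<in> homogeneous_part (Suc 0)"
  unfolding linear_form_def by (auto intro!: homogeneous_sum)

lemma homogeneous_prod:
  fixes f :: "_ \<Rightarrow> ('k::field, 'n::finite) mpoly"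
  shows "(\<And>i. i \<in> I \<Longrightarrow> f i \<in> homogeneous_part (Suc 0)) \<Longrightarrow> (\<Prod>i\<in>I. f i) \<in> homogeneous_part (card I)"
proof (induction I rule: infinite_finite_induct)
  case (insert x F)
  then show ?case using homogeneous_mult[of "f x" "Suc 0" "prod f F" "card F"] by simp
qed (auto simp: homogeneous_part_iff monomial_degree_def)

lemma sum_monomials: "(\<Sum>m\<in>Poly_Mapping.keys p. Poly_Mapping.single m (Poly_Mapping.lookup p m)) = p"
  by (rule poly_mapping_eqI)
    (auto simp: lookup_sum lookup_single when_def in_keys_iff)

lemma mpoly_induct [case_names zero add]:
  fixes p :: "('k::field, 'n::finite) mpoly"
  assumes "P 0" "\<And>m c q. P q \<Longrightarrow> P (Poly_Mapping.single m c + q)"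
  shows "P p"
proof -
  have "finite M \<Longrightarrow> P (\<Sum>m\<in>M. Poly_Mapping.single m (Poly_Mapping.lookup p m))" for M
    by (induction M rule: finite_induct) (auto intro: assms)
  from this[of "Poly_Mapping.keys p"] show ?thesis by (simp add: sum_monomials)
qed

lift_definition homogeneous_component :: "nat \<Rightarrow> ('k::field, 'n::finite) mpoly \<Rightarrow> ('k, 'n) mpoly" is
  "\<lambda>d p m. if monomial_degree m = d then p m else 0"
  by (rule finite_subset) auto

lemma lookup_homogeneous_component: "Poly_Mapping.lookup (homogeneous_component d p) m =
    (if monomial_degree m = d then Poly_Mapping.lookup p m else 0)"
  by transfer simp

lemma homogeneous_homogeneous_component [simp]: "homogeneous_component d p \<in> homogeneous_part d"
  by (auto simp: homogeneous_part_iff in_keys_iff lookup_homogeneous_component split: if_splits)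

lemma homogeneous_component_homogeneous: "p \<in> homogeneous_part d \<Longrightarrow> homogeneous_component d p = p"
  by (rule poly_mapping_eqI) (auto simp: lookup_homogeneous_component homogeneous_part_iff in_keys_iff)

lemma homogeneous_component_add: "homogeneous_component d (p + q) =
    homogeneous_component d p + homogeneous_component d q"
  by (rule poly_mapping_eqI) (auto simp: lookup_homogeneous_component lookup_add)

lemma homogeneous_component_0 [simp]: "homogeneous_component d 0 = 0"
  by (rule poly_mapping_eqI) (auto simp: lookup_homogeneous_component)

lemma homogeneous_component_sum: "homogeneous_component d (\<Sum>i\<in>I. f i) =
    (\<Sum>i\<in>I. homogeneous_component d (f i))"
  by (induction I rule: infinite_finite_induct) (auto simp: homogeneous_component_add)

lemma homogeneous_component_single: "homogeneous_component d (Poly_Mapping.single m c) =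
    (if monomial_degree m = d then Poly_Mapping.single m c else 0)"
  by (rule poly_mapping_eqI) (auto simp: lookup_homogeneous_component lookup_single when_def)

lemma homogeneous_component_single_mult:
  "homogeneous_component d (Poly_Mapping.single m c * p) =
     (if monomial_degree m \<le> d then Poly_Mapping.single m c * homogeneous_component (d - monomial_degree m) p else 0)"
proof (induction p rule: mpoly_induct)
  case (add m' c' q)
  then show ?case
    by (auto simp: distrib_left homogeneous_component_add mult_single homogeneous_component_single monomial_degree_add)
qed auto

lemma homogeneous_component_mult_homogeneous:
  assumes "g \<in> homogeneous_part s"
  shows "homogeneous_component d (g * p) =
      (if s \<le> d then g * homogeneous_component (d - s) p else 0)"
proof -
  have "homogeneous_component d (g * p) =
      (\<Sum>m\<in>Poly_Mapping.keys g. homogeneous_component d (Poly_Mapping.single m (Poly_Mapping.lookup g m) * p))"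
    by (subst (1) sum_monomials[of g, symmetric]) (simp add: sum_distrib_right homogeneous_component_sum)
  also have "\<dots> = (\<Sum>m\<in>Poly_Mapping.keys g. if s \<le>
      d then Poly_Mapping.single m (Poly_Mapping.lookup g m) * homogeneous_component (d - s) p else 0)"
    using assms
      by (intro sum.cong) (auto simp: homogeneous_component_single_mult homogeneous_part_iff)
  also have "\<dots> = (if s \<le> d then g * homogeneous_component (d - s) p else 0)"
    by (auto simp: sum_distrib_right[symmetric] sum_monomials)
  finally show ?thesis .
qed

text \<open>
  An injection of the variables into the natural numbers embeds the monomials into linearly ordered
  ones, and the product of the two leading terms with respect to the induced order cannot cancel.
\<close>

lemma mpoly_no_zero_divisors:
  fixes p q :: "('k::field, 'n::finite) mpoly"
  assumes "p \<noteq> 0" "q \<noteq> 0"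
  shows "p * q \<noteq> 0"
proof -
  obtain \<phi> :: "'n \<Rightarrow> nat" where \<phi>: "inj \<phi>"
    using finite_imp_inj_to_nat_seg[of "UNIV :: 'n set"] by auto
  define h :: "('n \<Rightarrow>\<^sub>0 nat) \<Rightarrow> (nat \<Rightarrow>\<^sub>0 nat)" where
    "h m = (\<Sum>i\<in>UNIV. Poly_Mapping.single (\<phi> i) (Poly_Mapping.lookup m i))" for m
  have h_add: "h (m + m') = h m + h m'" for m m'
    by (simp add: h_def lookup_add single_add sum.distrib)
  have "Poly_Mapping.lookup (h m) (\<phi> i) = Poly_Mapping.lookup m i" for m i
    using \<phi> by (simp add: h_def lookup_sum lookup_single when_def inj_eq)
  then have h_inj: "h m = h m' \<Longrightarrow> m = m'" for m m'
    by (metis poly_mapping_eqI)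
  have max: "\<exists>m\<in>Poly_Mapping.keys p. \<forall>m'\<in>Poly_Mapping.keys p. h m' \<le> h m"
    if "p \<noteq> 0" for p :: "('k, 'n) mpoly"
  proof -
    have "Max (h ` Poly_Mapping.keys p) \<in> h ` Poly_Mapping.keys p"
      using that by (intro Max_in) auto
    then obtain m where m: "m \<in> Poly_Mapping.keys p" "h m = Max (h ` Poly_Mapping.keys p)" by auto
    then show ?thesis by (intro bexI[of _ m]) auto
  qed
  obtain m1 where m1: "m1 \<in> Poly_Mapping.keys p" "\<And>m. m \<in> Poly_Mapping.keys p \<Longrightarrow> h m \<le> h m1"
    using max[OF assms(1)] by auto
  obtain m2 where m2: "m2 \<in> Poly_Mapping.keys q" "\<And>m. m \<in> Poly_Mapping.keys q \<Longrightarrow> h m \<le> h m2"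
    using max[OF assms(2)] by auto
  have uniq: "m + m' = m1 + m2 \<longleftrightarrow> m = m1 \<and> m' = m2"
    if "m \<in> Poly_Mapping.keys p" "m' \<in> Poly_Mapping.keys q" for m m'
  proof
    assume eq: "m + m' = m1 + m2"
    then have eqh: "h m + h m' = h m1 + h m2" by (metis h_add)
    have "h m = h m1"
    proof (rule ccontr)
      assume "h m \<noteq> h m1"
      then have "h m < h m1" using m1(2)[OF that(1)] by simp
      then have "h m + h m' < h m1 + h m2" using m2(2)[OF that(2)]
        by (rule add_less_le_mono)
      then show False using eqh by simp
    qed
    then have "m = m1" using h_inj by blast
    then show "m = m1 \<and> m' = m2" using eq by simp
  qed simp
  have "p * q = (\<Sum>m\<in>Poly_Mapping.keys p. \<Sum>m'\<in>Poly_Mapping.keys q.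
      Poly_Mapping.single (m + m') (Poly_Mapping.lookup p m * Poly_Mapping.lookup q m'))"
    by (subst (1) sum_monomials[of p, symmetric], subst (1) sum_monomials[of q, symmetric])
      (simp add: sum_distrib_left sum_distrib_right mult_single sum.swap[of _ "Poly_Mapping.keys p"])
  then have "Poly_Mapping.lookup (p * q) (m1 + m2) =
      (\<Sum>m\<in>Poly_Mapping.keys p. \<Sum>m'\<in>Poly_Mapping.keys q.
      (if m = m1 \<and> m' = m2 then Poly_Mapping.lookup p m * Poly_Mapping.lookup q m' else 0))"
    by (simp add: lookup_sum lookup_single when_def uniq cong: sum.cong if_cong)
  also have "\<dots> = (\<Sum>m\<in>Poly_Mapping.keys p. if m = m1 then \<Sum>m'\<in>Poly_Mapping.keys q. 
      (if m' = m2 then Poly_Mapping.lookup p m * Poly_Mapping.lookup q m' else 0) else 0)"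
    by (intro sum.cong refl) auto
  also have "\<dots> = Poly_Mapping.lookup p m1 * Poly_Mapping.lookup q m2"
    using m1(1) m2(1) by simp
  also have "\<dots> \<noteq> 0" using m1(1) m2(1) by (simp add: in_keys_iff)
  finally show ?thesis by force
qed

lemma mpoly_mult_eq_0 [simp]: "(p::('k::field, 'n::finite) mpoly) * q = 0 \<longleftrightarrow> p = 0 \<or> q = 0"
  using mpoly_no_zero_divisors[of p q] by auto

lemma mpoly_mult_left_cancel:
  fixes p q r :: "('k::field, 'n::finite) mpoly"
  assumes "p \<noteq> 0"
  shows "p * q = p * r \<longleftrightarrow> q = r"
proof -
  have "p * q = p * r \<longleftrightarrow> p * (q - r) = 0" by (simp add: algebra_simps)
  then show ?thesis using assms by (simp add: mpoly_no_zero_divisors)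
qed

lemma mpoly_prod_eq_0: 
  fixes f :: "_ \<Rightarrow> ('k::field, 'n::finite) mpoly"
  shows "finite I \<Longrightarrow> (\<Prod>i\<in>I. f i) = 0 \<longleftrightarrow> (\<exists>i\<in>I. f i = 0)"
  by (induction I rule: finite_induct) auto

section \<open>Linear forms, derivations and substitutions\<close>

abbreviation const :: "'k \<Rightarrow> ('k::field, 'n::finite) mpoly" where
  "const c \<equiv> Poly_Mapping.single 0 c"

abbreviation var :: "'n \<Rightarrow> ('k::field, 'n::finite) mpoly" where
  "var i \<equiv> Poly_Mapping.single (Poly_Mapping.single i 1) 1"

lemma lookup_linear_form: "Poly_Mapping.lookup (linear_form a) (Poly_Mapping.single i 1) = a $ i"
proof -
  have "Poly_Mapping.single j 1 = Poly_Mapping.single i (1::nat) \<longleftrightarrow> j = i" for j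
    by (metis lookup_single_eq lookup_single_not_eq zero_neq_one)
  then show ?thesis by (simp add: linear_form_def lookup_sum lookup_single when_def)
qed

lemma linear_form_eq_0 [simp]: "linear_form a = 0 \<longleftrightarrow> a = 0"
proof
  assume "linear_form a = 0"
  then show "a = 0" using lookup_linear_form[of a] by (simp add: vec_eq_iff)
qed (simp add: linear_form_def)

lemma linear_form_add: "linear_form (a + b) = linear_form a + linear_form b"
  by (simp add: linear_form_def single_add sum.distrib)

lemma linear_form_scale: "linear_form (c *s a) = const c * linear_form a"
  by (simp add: linear_form_def mult_single sum_distrib_left)

lemma linear_form_alt: "linear_form a = (\<Sum>i\<in>UNIV. const (a $ i) * var i)"
  by (simp add: linear_form_def mult_single)

lemma linear_form_axis: "linear_form (axis (i::'a::finite) (1::'b::field)) = var i"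
proof -
  have "(\<Sum>j\<in>UNIV. Poly_Mapping.single (Poly_Mapping.single j 1) (axis i 1 $ j)) =
    (\<Sum>j\<in>UNIV. if j = i then var i else (0 :: ('b, 'a) mpoly))"
    by (intro sum.cong) (auto simp: axis_def)
  then show ?thesis by (simp add: linear_form_def)
qed

lemma keys_linear_form: "Poly_Mapping.keys (linear_form a) =
    (\<lambda>i. Poly_Mapping.single i 1) ` {i. a $ i \<noteq> 0}"
proof -
  have "Poly_Mapping.keys (linear_form a) \<subseteq> (\<lambda>i. Poly_Mapping.single i 1) ` UNIV"
    unfolding linear_form_def by (rule order_trans[OF keys_sum]) auto
  moreover have "Poly_Mapping.single i 1 \<in> Poly_Mapping.keys (linear_form a) \<longleftrightarrow> a $ i \<noteq> 0" for i
    by (simp add: in_keys_iff lookup_linear_form[simplified])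
  ultimately show ?thesis by blast
qed

lemma partial_deriv_linear_form: "partial_deriv i (linear_form a) = const (a $ i)"
proof -
  have inj: "inj_on (\<lambda>i. Poly_Mapping.single i (1::nat)) A" for A
    by (rule inj_onI) (metis lookup_single_eq lookup_single_not_eq zero_neq_one)
  have "partial_deriv i (linear_form a) = (\<Sum>j\<in>{j. a $ j \<noteq> 0}. if j = i then const (a $ i) else 0)"
    unfolding partial_deriv_def keys_linear_form
    by (subst sum.reindex[OF inj], unfold o_def, intro sum.cong refl) (auto simp: lookup_linear_form[simplified] lookup_single when_def)
  then show ?thesis by (simp add: sum.delta)
qed

lemma der_apply_linear_form: "der_apply \<theta> (linear_form a) = (\<Sum>i\<in>UNIV. const (a $ i) * \<theta> $ i)"
  by (simp add: der_apply_def partial_deriv_linear_form mult.commute)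

lemma der_apply_add: "der_apply (\<theta> + \<eta>) p = der_apply \<theta> p + der_apply \<eta> p"
  by (simp add: der_apply_def distrib_right sum.distrib)

lemma der_apply_diff: "der_apply (\<theta> - \<eta>) p = der_apply \<theta> p - der_apply \<eta> p"
  by (simp add: der_apply_def left_diff_distrib sum_subtractf)

lemma der_apply_scale: "der_apply (f *s \<theta>) p = f * der_apply \<theta> p"
  by (simp add: der_apply_def sum_distrib_left mult.assoc)

lemma der_apply_0 [simp]: "der_apply 0 p = 0"
  by (simp add: der_apply_def)

lemma der_apply_sum: "der_apply (\<Sum>i\<in>I. \<theta> i) p = (\<Sum>i\<in>I. der_apply (\<theta> i) p)"
  by (induction I rule: infinite_finite_induct) (auto simp: der_apply_add)

lemma der_apply_linear_form_add:
  "der_apply \<theta> (linear_form (a + b)) = der_apply \<theta> (linear_form a) + der_apply \<theta> (linear_form b)"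
  by (simp add: der_apply_linear_form single_add distrib_right sum.distrib)

lemma der_apply_linear_form_scale:
  "der_apply \<theta> (linear_form (c *s a)) = const c * der_apply \<theta> (linear_form a)"
  by (simp add: der_apply_linear_form sum_distrib_left mult.assoc[symmetric] mult_single)

lemma der_apply_axis: "der_apply \<theta> (linear_form (axis i 1)) = \<theta> $ i"
proof -
  have "(\<Sum>j\<in>UNIV. const (axis i 1 $ j) * \<theta> $ j) = (\<Sum>j\<in>UNIV. if j = i then \<theta> $ i else 0)"
    by (intro sum.cong) (auto simp: axis_def)
  then show ?thesis by (simp add: der_apply_linear_form)
qed

lemma homogeneous_der_iff: "homogeneous_der d \<theta> \<longleftrightarrow> \<theta> \<noteq> 0 \<and> (\<forall>i. \<theta> $ i \<in> homogeneous_part d)"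
proof -
  have "(\<forall>a. der_apply \<theta> (linear_form a) \<in> homogeneous_part d) \<longleftrightarrow>
      (\<forall>i. \<theta> $ i \<in> homogeneous_part d)" (is "?L = ?R")
  proof
    assume ?L then show ?R using der_apply_axis[of \<theta>] by metis
  next
    assume r: ?R
    have "const c * \<theta> $ i \<in> homogeneous_part d" for c i
      using homogeneous_mult[of "const c" 0 "\<theta> $ i" d] r by (simp add: monomial_degree_def)
    then show ?L by (auto simp: der_apply_linear_form intro: homogeneous_sum)
  qed
  then show ?thesis by (simp add: homogeneous_der_def)
qed

definition substitute :: "('n \<Rightarrow> ('k, 'n) mpoly) \<Rightarrow> ('k::field, 'n::finite) mpoly \<Rightarrow> ('k, 'n) mpoly" where
  "substitute \<sigma> p =
      (\<Sum>m\<in>Poly_Mapping.keys p. const (Poly_Mapping.lookup p m) * (\<Prod>i\<in>UNIV. \<sigma> i ^ Poly_Mapping.lookup m i))"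

lemma substitute_superset:
  assumes "finite M" "Poly_Mapping.keys p \<subseteq> M"
  shows "substitute \<sigma> p =
      (\<Sum>m\<in>M. const (Poly_Mapping.lookup p m) * (\<Prod>i\<in>UNIV. \<sigma> i ^ Poly_Mapping.lookup m i))"
  unfolding substitute_def by (rule sum.mono_neutral_left) (use assms in \<open>auto simp: in_keys_iff\<close>)

lemma substitute_add: "substitute \<sigma> (p + q) = substitute \<sigma> p + substitute \<sigma> q"
proof -
  have "Poly_Mapping.keys (p + q) \<subseteq> Poly_Mapping.keys p \<union> Poly_Mapping.keys q"
    by (rule Poly_Mapping.keys_add)
  then show ?thesis
    by (subst (1 2 3) substitute_superset[of "Poly_Mapping.keys p \<union> Poly_Mapping.keys q"])
      (auto simp: lookup_add single_add distrib_right sum.distrib)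
qed

lemma substitute_0 [simp]: "substitute \<sigma> 0 = 0" by (simp add: substitute_def)

lemma substitute_single: "substitute \<sigma> (Poly_Mapping.single m c) =
    const c * (\<Prod>i\<in>UNIV. \<sigma> i ^ Poly_Mapping.lookup m i)"
  by (cases "c = 0") (auto simp: substitute_def)

lemma substitute_const [simp]: "substitute \<sigma> (const c) = const c"
  by (simp add: substitute_single)

lemma substitute_1 [simp]: "substitute \<sigma> 1 = 1"
  using substitute_const[of \<sigma> 1] by simp

lemma const_mult: "const (c * c') = const c * const c'"
  by (simp add: mult_single)

lemma substitute_single_mult: "substitute \<sigma> (Poly_Mapping.single m c * q) =
    substitute \<sigma> (Poly_Mapping.single m c) * substitute \<sigma> q"
proof (induction q rule: mpoly_induct)
  case (add m' c' q)
  have "substitute \<sigma> (Poly_Mapping.single m c * Poly_Mapping.single m' c') =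
      const (c * c') * (\<Prod>i\<in>UNIV. \<sigma> i ^ Poly_Mapping.lookup m i * \<sigma> i ^ Poly_Mapping.lookup m' i)"
    by (simp add: mult_single substitute_single lookup_add power_add)
  also have "\<dots> = substitute \<sigma> (Poly_Mapping.single m c) * substitute \<sigma> (Poly_Mapping.single m' c')"
    unfolding prod.distrib substitute_single const_mult by (simp only: ac_simps)
  finally have "substitute \<sigma> (Poly_Mapping.single m c * Poly_Mapping.single m' c') =
      substitute \<sigma> (Poly_Mapping.single m c) * substitute \<sigma> (Poly_Mapping.single m' c')" .
  then show ?case by (simp add: distrib_left substitute_add add)
qed simp

lemma substitute_mult: "substitute \<sigma> (p * q) = substitute \<sigma> p * substitute \<sigma> q"
  by (induction p rule: mpoly_induct) (auto simp: distrib_right substitute_add substitute_single_mult)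

lemma substitute_sum: "substitute \<sigma> (\<Sum>i\<in>I. f i) = (\<Sum>i\<in>I. substitute \<sigma> (f i))"
  by (induction I rule: infinite_finite_induct) (auto simp: substitute_add)

lemma substitute_prod: "substitute \<sigma> (\<Prod>i\<in>I. f i) = (\<Prod>i\<in>I. substitute \<sigma> (f i))"
  by (induction I rule: infinite_finite_induct) (auto simp: substitute_mult)

lemma substitute_diff: "substitute \<sigma> (p - q) = substitute \<sigma> p - substitute \<sigma> q"
  using substitute_add[of \<sigma> "p - q" q] by (simp add: algebra_simps)

lemma substitute_var: "substitute \<sigma> (var i) = \<sigma> i"
proof -
  have "(\<Prod>j\<in>UNIV. \<sigma> j ^ Poly_Mapping.lookup (Poly_Mapping.single i 1) j) = (\<Prod>j\<in>UNIV. if j =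
      i then \<sigma> i else 1)"
    by (intro prod.cong) (auto simp: lookup_single when_def)
  then show ?thesis by (simp add: substitute_single)
qed

lemma substitute_homogeneous:
  assumes "\<And>i. \<sigma> i \<in> homogeneous_part (Suc 0)" "p \<in> homogeneous_part d"
  shows "substitute \<sigma> p \<in> homogeneous_part d"
proof -
  have pw: "\<sigma> i ^ k \<in> homogeneous_part k" for i k
    using homogeneous_prod[of "{..<k}" "\<lambda>_. \<sigma> i"] assms(1) by simp
  have "(\<Prod>i\<in>I. \<sigma> i ^ Poly_Mapping.lookup m i) \<in>
      homogeneous_part (\<Sum>i\<in>I. Poly_Mapping.lookup m i)" for I m
  proof (induction I rule: infinite_finite_induct)
    case (insert x F)
    then show ?case using homogeneous_mult[OF pw[of x "Poly_Mapping.lookup m x"] insert.IH] by simp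
  qed (auto simp: homogeneous_part_iff monomial_degree_def)
  then have *: "(\<Prod>i\<in>UNIV. \<sigma> i ^ Poly_Mapping.lookup m i) \<in>
      homogeneous_part (monomial_degree m)" for m
    by (simp add: monomial_degree_def)
  have "const c * (\<Prod>i\<in>UNIV. \<sigma> i ^ Poly_Mapping.lookup m i) \<in>
      homogeneous_part (monomial_degree m)" for c m
    using homogeneous_mult[of "const c" 0, OF _ *[of m]] by (simp add: monomial_degree_def)
  then show ?thesis using assms(2) unfolding substitute_def homogeneous_part_iff[of p]
    by (intro homogeneous_sum) auto
qed

text \<open>
  Two ring homomorphisms that agree modulo \<open>q\<close> on the variables agree modulo \<open>q\<close> everywhere; here
  one of them is the identity.
\<close>

lemma substitute_congruent:
  assumes "\<And>i. (q :: ('k::field, 'n::finite) mpoly) dvd var i - \<sigma> i"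
  shows "q dvd p - substitute \<sigma> p"
proof -
  have mult: "q dvd a * b - a' * b'"
    if "q dvd a - a'" "q dvd b - b'" for a b a' b' :: "('k, 'n) mpoly"
  proof -
    have "a * b - a' * b' = a * (b - b') + (a - a') * b'" by (simp add: algebra_simps)
    then show ?thesis using that by (metis dvd_add dvd_mult dvd_mult2)
  qed
  have pw: "q dvd a ^ k - a' ^ k" if "q dvd a - a'" for a a' :: "('k, 'n) mpoly" and k
    by (induction k) (auto intro: mult that)
  have pr: "q dvd (\<Prod>i\<in>I. var i ^ e i) - (\<Prod>i\<in>I. \<sigma> i ^ e i)" for I e
    by (induction I rule: infinite_finite_induct) (auto intro!: mult pw assms[simplified])
  have id: "substitute var p = p" for p :: "('k, 'n) mpoly"
  proof -
    have "var i ^ k = Poly_Mapping.single (Poly_Mapping.single i k) (1::'k)" for i :: 'n and k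
      by (induction k) (auto simp: mult_single single_add[symmetric])
    moreover have "(\<Prod>i\<in>I. Poly_Mapping.single (f i) (1::'k)) =
        Poly_Mapping.single (\<Sum>i\<in>I. f i) 1" for I :: "'n set" and f :: "'n \<Rightarrow> 'n \<Rightarrow>\<^sub>0 nat"
      by (induction I rule: infinite_finite_induct) (auto simp: mult_single)
    moreover have "(\<Sum>i\<in>UNIV. Poly_Mapping.single i (Poly_Mapping.lookup m i)) =
        m" for m :: "'n \<Rightarrow>\<^sub>0 nat"
      by (rule poly_mapping_eqI) (simp add: lookup_sum lookup_single when_def)
    ultimately have "substitute var p =
        (\<Sum>m\<in>Poly_Mapping.keys p. Poly_Mapping.single m (Poly_Mapping.lookup p m))"
      unfolding substitute_def by (simp add: mult_single)
    then show ?thesis by (simp add: sum_monomials)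
  qed
  have "q dvd substitute var p - substitute \<sigma> p"
    unfolding substitute_def sum_subtractf[symmetric] right_diff_distrib[symmetric]
    by (intro dvd_sum dvd_mult pr)
  then show ?thesis by (simp only: id)
qed

section \<open>Annihilators and hyperplanes\<close>

definition dot :: "'k::field ^ 'n::finite \<Rightarrow> 'k ^ 'n \<Rightarrow> 'k" where
  "dot a v = (\<Sum>i\<in>UNIV. a $ i * v $ i)"

lemma dot_add_left: "dot (a + b) v = dot a v + dot b v"
  and dot_add_right: "dot a (v + w) = dot a v + dot a w"
  and dot_scale_left: "dot (c *s a) v = c * dot a v"
  and dot_scale_right: "dot a (c *s v) = c * dot a v"
  and dot_0_left [simp]: "dot 0 v = 0"
  and dot_0_right [simp]: "dot a 0 = 0"
  by (auto simp: dot_def algebra_simps sum.distrib sum_distrib_left)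

lemma dot_commute: "dot a v = dot v a"
  by (simp add: dot_def mult.commute)

lemma form_kernel_iff [simp]: "v \<in> form_kernel a \<longleftrightarrow> dot a v = 0"
  by (simp add: form_kernel_def dot_def)

lemma subspace_form_kernel: "vec.subspace (form_kernel a)"
  by (auto simp: vec.subspace_def dot_add_right dot_scale_right)

text \<open>
  A linear functional that vanishes on \<open>U\<close> and equals \<open>1\<close> at \<open>a\<close> is represented by a vector.
\<close>

lemma separating_vector:
  fixes U :: "('k::field ^ 'n::finite) set"
  assumes "vec.subspace U" "a \<notin> U"
  obtains v where "\<And>u. u \<in> U \<Longrightarrow> dot v u = 0" "dot v a = 1"
proof -
  obtain B where B: "B \<subseteq> U" "vec.independent B" "vec.span B = U"
    using vec.basis_exists[of U] vec.span_subspace[OF _ _ assms(1)] by metis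
  have "vec.independent (insert a B)"
    using B assms(2) by (simp add: vec.independent_insert)
  define i where "i = (undefined :: 'n)"
  obtain f
    where f: "Vector_Spaces.linear (*s) (*s) f" "\<And>x. x \<in> insert a B \<Longrightarrow>
        f x = (if x = a then axis i 1 else (0 :: 'k ^ 'n))"
    using vec.linear_independent_extend[OF \<open>vec.independent (insert a B)\<close>, of "\<lambda>x. if x =
        a then axis i 1 else 0"] by blast
  have "f u = 0" if "u \<in> U" for u
  proof -
    interpret f: Vector_Spaces.linear "(*s)" "(*s)" f by fact
    have "vec.span B \<subseteq> {x. f x = 0}"
      by (rule vec.span_minimal) (use f(2) assms(2) B in \<open>auto simp: f.subspace_kernel\<close>)
    then show ?thesis using that B by auto
  qed
  moreover have "dot (matrix f $ i) x = f x $ i" for x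
  proof -
    have "f x = matrix f *v x" using matrix_works[OF f(1)] by simp
    then show ?thesis by (simp add: matrix_vector_mult_def dot_def)
  qed
  ultimately show ?thesis using that[of "matrix f $ i"] f(2)[of a] by simp
qed

lemma double_annihilator:
  assumes "\<And>v. (\<And>g. g \<in> G \<Longrightarrow> dot g v = 0) \<Longrightarrow> dot a v = 0"
  shows "a \<in> vec.span G"
proof (rule ccontr)
  assume "a \<notin> vec.span G"
  then obtain v where v: "\<And>u. u \<in> vec.span G \<Longrightarrow> dot v u = 0" "dot v a = 1"
    using separating_vector[OF vec.subspace_span] by blast
  have "dot a v = 0" by (rule assms) (metis v(1) dot_commute vec.span_base)
  then show False using v(2) by (simp add: dot_commute)
qed

definition hyperplane :: "('k::field ^ 'n::finite) set \<Rightarrow> bool" where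
  "hyperplane H \<longleftrightarrow> vec.subspace H \<and> vec.dim H + 1 = CARD('n)"

lemma arrangement_iff: "arrangement \<A> \<longleftrightarrow> finite \<A> \<and> (\<forall>H\<in>\<A>. hyperplane H)"
  by (simp add: arrangement_def hyperplane_def)

definition normal :: "('k::field ^ 'n::finite) set \<Rightarrow> 'k ^ 'n" where
  "normal H = (SOME a. form_kernel a = H)"

lemma defining_form_normal: "defining_form H = linear_form (normal H)"
  by (simp add: defining_form_def normal_def)

lemma hyperplane_neq_UNIV: "hyperplane (H :: ('k::field ^ 'n::finite) set) \<Longrightarrow> H \<noteq> UNIV"
  using vec_dim_card[where 'a='k and 'n='n] by (auto simp: hyperplane_def)

lemma hyperplane_subset_eq:
  assumes "hyperplane H" "hyperplane L" "H \<subseteq> L"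
  shows "H = L"
  using assms vec.subspace_dim_equal[of H L] by (auto simp: hyperplane_def)

text \<open>
  A strictly larger subspace has full dimension.
\<close>

lemma hyperplane_maximal:
  fixes H :: "('k::field ^ 'n::finite) set"
  assumes "hyperplane H" "vec.subspace U" "H \<subseteq> U" "U \<noteq> UNIV"
  shows "H = U"
proof (rule vec.subspace_dim_equal)
  have "vec.dim U \<noteq> CARD('n)"
    using assms vec.subspace_dim_equal[of U UNIV] vec_dim_card[where 'a='k and 'n='n] by auto
  moreover have "vec.dim U \<le> CARD('n)" by (rule dim_subset_UNIV_cart_gen)
  ultimately show "vec.dim U \<le> vec.dim H" using assms(1) by (simp add: hyperplane_def)
qed (use assms in \<open>auto simp: hyperplane_def\<close>)

lemma form_kernel_normal:
  assumes "hyperplane H"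
  shows "form_kernel (normal H) = H"
proof -
  have "\<exists>a. form_kernel a = H"
  proof -
    obtain x where "x \<notin> H" using hyperplane_neq_UNIV[OF assms] by auto
    then obtain v where v: "\<And>u. u \<in> H \<Longrightarrow> dot v u = 0" "dot v x = 1"
      using separating_vector assms unfolding hyperplane_def by blast
    have "H = form_kernel v"
      by (rule hyperplane_maximal[OF assms subspace_form_kernel])
         (use v in \<open>auto simp: set_eq_iff intro!: exI[of _ x]\<close>)
    then show ?thesis by blast
  qed
  then show ?thesis unfolding normal_def by (rule someI_ex)
qed

lemma dot_normal_iff: "hyperplane H \<Longrightarrow> dot (normal H) v = 0 \<longleftrightarrow> v \<in> H"
  using form_kernel_normal[of H] form_kernel_iff[of v "normal H"] by simp

lemma normal_neq_0: "hyperplane H \<Longrightarrow> normal H \<noteq> 0"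
  by (metis UNIV_eq_I dot_0_left dot_normal_iff hyperplane_neq_UNIV)

lemma dim_Int_hyperplane:
  fixes Y :: "('k::field ^ 'n::finite) set"
  assumes "vec.subspace Y" "hyperplane L" "\<not> Y \<subseteq> L"
  shows "vec.dim (Y \<inter> L) + 1 = vec.dim Y"
proof -
  let ?S = "{x + y |x y. x \<in> Y \<and> y \<in> L}"
  have L: "vec.subspace L" using assms(2) by (simp add: hyperplane_def)
  have sub: "vec.subspace ?S" by (rule vec.subspace_sums[OF assms(1) L])
  have "L \<subseteq> ?S" using vec.subspace_0[OF assms(1)] by force
  moreover have "Y \<subseteq> ?S" using vec.subspace_0[OF L] by force
  moreover have "?S \<noteq> L" using \<open>Y \<subseteq> ?S\<close> assms(3) by (rule_tac notI) simp
  ultimately have "?S = UNIV" using hyperplane_maximal[OF assms(2) sub] by metis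
  then have "vec.dim ?S = CARD('n)" by (metis vec_dim_card)
  then show ?thesis
    using vec.dim_sums_Int[OF assms(1) L] assms(2) by (simp add: hyperplane_def)
qed

text \<open>
  The forms are the dual basis of a basis of \<open>T\<close>. They make the defining forms of a nonessential
  arrangement with centre \<open>T\<close> span all linear forms.
\<close>

lemma complementary_forms:
  fixes T :: "('k::field ^ 'n::finite) set"
  assumes "vec.subspace T"
  obtains W where "finite W" "card W \<le> vec.dim T" "\<And>v. v \<in> T \<Longrightarrow> (\<And>w. w \<in> W \<Longrightarrow> dot w v = 0) \<Longrightarrow> v = 0"
proof -
  obtain B where B: "B \<subseteq> T" "vec.independent B" "T \<subseteq> vec.span B" "card B = vec.dim T"
    using vec.basis_exists[of T] by metis
  have finB: "finite B" using B(2) by (rule vec.finiteI_independent)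
  have "\<exists>w. (\<forall>u\<in>vec.span (B - {b}). dot w u = 0) \<and> dot w b = 1" if "b \<in> B" for b
    using B(2) that separating_vector[OF vec.subspace_span, of b "B - {b}"]
      unfolding vec.dependent_def by metis
  then obtain w where w: "\<And>b u. b \<in> B \<Longrightarrow> u \<in> vec.span (B - {b}) \<Longrightarrow> dot (w b) u = 0"
      "\<And>b. b \<in> B \<Longrightarrow> dot (w b) b = 1" by metis
  show ?thesis
  proof (rule that[of "w ` B"])
    show "finite (w ` B)" using finB by simp
    show "card (w ` B) \<le> vec.dim T" using card_image_le[OF finB, of w] B(4) by simp
    fix v assume v: "v \<in> T" "\<And>x. x \<in> w ` B \<Longrightarrow> dot x v = 0"
    from v(1) B(3) have "v \<in> vec.span B" by auto
    then obtain c where c: "v = (\<Sum>b\<in>B. c b *s b)" using vec.span_finite[OF finB] by auto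
    have "c b = 0" if "b \<in> B" for b
    proof -
      have "v = c b *s b + (\<Sum>b'\<in>B - {b}. c b' *s b')"
        unfolding c using sum.remove[OF finB that] .
      moreover have "(\<Sum>b'\<in>B - {b}. c b' *s b') \<in> vec.span (B - {b})"
        by (intro vec.span_sum vec.span_scale vec.span_base) auto
      ultimately have "dot (w b) v = c b"
        using w[OF that] by (simp add: dot_add_right dot_scale_right)
      then show ?thesis using v(2) that by auto
    qed
    then show "v = 0" unfolding c by simp
  qed
qed

section \<open>A lower bound for the number of generators\<close>

text \<open>
  Polynomials as a module over themselves, so that \<open>ideal.span\<close> is the generated ideal. The
  simplification rule that reassociates scalar multiples is removed because it works against
  \<open>mult.assoc\<close>.
\<close>

interpretation ideal: module "(*) :: ('k::field, 'n::finite) mpoly \<Rightarrow> ('k, 'n) mpoly \<Rightarrow> ('k, 'n) mpoly"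
  by unfold_locales (auto simp: algebra_simps)

declare ideal.scale_scale [simp del]

interpretation mpoly_vs: vector_space "\<lambda>c (p :: ('k::field, 'n::finite) mpoly). const c * p"
  proof unfold_locales
  fix c d :: 'k and p :: "('k, 'n) mpoly"
  show "const c * (const d * p) = const (c * d) * p"
    unfolding const_mult by (rule mult.assoc[symmetric])
qed (simp_all add: algebra_simps single_add)

lemma independent_monomials:
  fixes M :: "('n::finite \<Rightarrow>\<^sub>0 nat) set"
  shows "mpoly_vs.independent ((\<lambda>m. Poly_Mapping.single m (1::'k::field)) ` M)"
  unfolding mpoly_vs.dependent_explicit
proof
  let ?s = "\<lambda>m :: 'n \<Rightarrow>\<^sub>0 nat. Poly_Mapping.single m (1::'k)"
  assume "\<exists>t u. finite t \<and> t \<subseteq> ?s ` M \<and> (\<Sum>v\<in>t. const (u v) * v) = 0 \<and> (\<exists>v\<in>t. u v \<noteq> 0)"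
  then obtain t u m where t: "finite t" "t \<subseteq> ?s ` M" "(\<Sum>v\<in>t. const (u v) * v) = 0"
    and m: "?s m \<in> t" "u (?s m) \<noteq> 0"
    by blast
  have inj: "?s m = ?s m' \<Longrightarrow> m = m'" for m m' :: "'n \<Rightarrow>\<^sub>0 nat"
    by (metis lookup_single_eq lookup_single_not_eq zero_neq_one)
  have "0 = Poly_Mapping.lookup (\<Sum>v\<in>t. const (u v) * v) m" using t(3) by simp
  also have "\<dots> = (\<Sum>v\<in>t. if v = ?s m then u (?s m) else 0)"
    unfolding lookup_sum
  proof (rule sum.cong)
    fix v assume "v \<in> t"
    then obtain m' where "v = ?s m'" using t(2) by auto
    then show "Poly_Mapping.lookup (const (u v) * v) m = (if v = ?s m then u (?s m) else 0)"
      using inj[of m' m] by (auto simp: mult_single lookup_single when_def)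
  qed simp
  also have "\<dots> = u (?s m)" using m(1) t(1) by simp
  finally show False using m(2) by simp
qed

definition exponent_box :: "nat \<Rightarrow> ('n::finite \<Rightarrow>\<^sub>0 nat) set" where
  "exponent_box N = {m. \<forall>i. Poly_Mapping.lookup m i < N}"

lemma finite_exponent_box: "finite (exponent_box N :: ('n::finite \<Rightarrow>\<^sub>0 nat) set)"
  and card_exponent_box: "card (exponent_box N :: ('n::finite \<Rightarrow>\<^sub>0 nat) set) = N ^ CARD('n)"
proof -
  have "bij_betw Poly_Mapping.lookup (exponent_box N :: ('n \<Rightarrow>\<^sub>0 nat) set) (UNIV \<rightarrow>\<^sub>E {..<N})"
    by (rule bij_betw_byWitness[where f' = Abs_poly_mapping]) (auto simp: exponent_box_def PiE_def Pi_def lookup_inverse)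
  moreover have "finite ((UNIV :: 'n set) \<rightarrow>\<^sub>E {..<N})" by (simp add: finite_PiE)
  ultimately show "finite (exponent_box N :: ('n::finite \<Rightarrow>\<^sub>0 nat) set)" 
    and "card (exponent_box N :: ('n::finite \<Rightarrow>\<^sub>0 nat) set) = N ^ CARD('n)"
    using bij_betw_finite bij_betw_same_card card_PiE[of "UNIV :: 'n set" "\<lambda>_. {..<N}"]
      by fastforce+
qed

lemma homogeneous_in_span:
  assumes "\<And>m. monomial_degree m = d \<Longrightarrow>
      Poly_Mapping.single m 1 \<in> mpoly_vs.span T" "p \<in> homogeneous_part d"
  shows "p \<in> mpoly_vs.span T"
proof -
  have "p = (\<Sum>m\<in>Poly_Mapping.keys p. const (Poly_Mapping.lookup p m) * Poly_Mapping.single m 1)"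
    by (simp add: mult_single sum_monomials)
  also have "\<dots> \<in> mpoly_vs.span T"
    using assms
      by (intro mpoly_vs.span_sum mpoly_vs.span_scale assms(1)) (auto simp: homogeneous_part_iff)
  finally show ?thesis .
qed

text \<open>
  The special case of Krull's height theorem that the proof needs. If \<open>G\<close> generates all high powers of the
  variables, then every polynomial is a combination of products of elements of \<open>G\<close> with
  coefficients from the span of finitely many monomials. The polynomials of degree at most \<open>n D\<close> then
  lie in a space whose dimension grows with \<open>D\<close> like a power with exponent \<open>card G\<close>, while the
  monomials with all exponents at most \<open>D\<close> already number \<open>(D + 1)\<^sup>n\<close>.
\<close>

lemma card_generators_ge:
  fixes G :: "('k::field, 'n::finite) mpoly set"
  assumes fin: "finite G"
    and hom: "\<And>g. g \<in> G \<Longrightarrow> g \<in> homogeneous_part (s g)" "\<And>g. g \<in> G \<Longrightarrow> s g > 0"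
    and pow: "\<And>i. var i ^ N \<in> ideal.span G"
  shows "CARD('n) \<le> card G"
proof -
  \<comment> \<open>Spanning set: a monomial with small exponents times a monomial in the generators.\<close>
  define T
    where "T D = (\<lambda>(e, a). Poly_Mapping.single e (1::'k) *
        (\<Prod>g\<in>G. g ^ a g)) ` (exponent_box N \<times> (G \<rightarrow>\<^sub>E {..D}))" for D :: nat
  have finT: "finite (T D)" for D
    unfolding T_def using fin
      by (intro finite_imageI finite_cartesian_product finite_exponent_box finite_PiE) auto
  have cardT: "card (T D) \<le> N ^ CARD('n) * (D + 1) ^ card G" for D
  proof -
    have "card (T D) \<le>
        card (exponent_box N \<times> (G \<rightarrow>\<^sub>E {..D}) :: (('n \<Rightarrow>\<^sub>0 nat) \<times> (('k, 'n) mpoly \<Rightarrow> nat)) set)"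
      unfolding T_def using fin
        by (intro card_image_le finite_cartesian_product finite_exponent_box finite_PiE) auto
    also have "\<dots> = N ^ CARD('n) * (D + 1) ^ card G"
      using fin by (simp add: card_cartesian_product card_exponent_box card_PiE)
    finally show ?thesis .
  qed
  have mono: "T D \<subseteq> T D'" if "D \<le> D'" for D D'
  proof -
    have "(G \<rightarrow>\<^sub>E {..D}) \<subseteq> (G \<rightarrow>\<^sub>E {..D'})" using that by (intro PiE_mono) auto
    then show ?thesis unfolding T_def by (intro image_mono) auto
  qed
  have mult: "g * p \<in> mpoly_vs.span (T (Suc D))" if "g \<in> G" "p \<in> mpoly_vs.span (T D)" for g p D
  proof -
    have "g * t \<in> T (Suc D)" if t: "t \<in> T D" for t
    proof -
      obtain e a
        where ea: "t = Poly_Mapping.single e 1 * (\<Prod>g\<in>G. g ^ a g)" "e \<in> exponent_box N" "a \<in>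
            G \<rightarrow>\<^sub>E {..D}"
        using t by (auto simp: T_def)
      let ?a = "a(g := Suc (a g))"
      have "(\<Prod>h\<in>G. h ^ ?a h) = g ^ Suc (a g) * (\<Prod>h\<in>G - {g}. h ^ a h)"
        using prod.remove[OF fin \<open>g \<in> G\<close>, of "\<lambda>h. h ^ ?a h"] by simp
      also have "\<dots> = g * (\<Prod>h\<in>G. h ^ a h)"
        unfolding prod.remove[OF fin \<open>g \<in> G\<close>, of "\<lambda>h. h ^ a h"] power_Suc by (rule mult.assoc)
      finally have "g * t = Poly_Mapping.single e 1 * (\<Prod>h\<in>G. h ^ ?a h)"
        unfolding ea(1) by (simp only: ac_simps)
      moreover have "?a \<in> G \<rightarrow>\<^sub>E {..Suc D}"
        using ea(3) \<open>g \<in> G\<close> by (fastforce simp: PiE_iff extensional_def)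
      ultimately show ?thesis unfolding T_def using ea(2)
        by (auto intro!: image_eqI[where x = "(e, ?a)"])
    qed
    moreover have "mpoly_vs.subspace {p. g * p \<in> mpoly_vs.span (T (Suc D))}"
      by (auto simp: mpoly_vs.subspace_def distrib_left mpoly_vs.span_add mpoly_vs.span_zero mult.left_commute[of g]
          intro: mpoly_vs.span_scale)
    ultimately have "mpoly_vs.span (T D) \<subseteq> {p. g * p \<in> mpoly_vs.span (T (Suc D))}"
      by (intro mpoly_vs.span_minimal) (auto intro: mpoly_vs.span_base)
    then show ?thesis using that(2) by auto
  qed
  have key: "Poly_Mapping.single m (1::'k) \<in>
      mpoly_vs.span (T (monomial_degree m))" for m :: "'n \<Rightarrow>\<^sub>0 nat"
  proof (induction "monomial_degree m" arbitrary: m rule: less_induct)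
    case less
    have IH: "p \<in> mpoly_vs.span (T d)" if "d < monomial_degree m" "p \<in> homogeneous_part d" for p d
    proof (rule homogeneous_in_span[OF _ that(2)])
      fix m' :: "'n \<Rightarrow>\<^sub>0 nat" assume "monomial_degree m' = d"
      then show "Poly_Mapping.single m' 1 \<in> mpoly_vs.span (T d)" using less[of m'] that(1) by simp
    qed
    show ?case
    proof (cases "m \<in> exponent_box N")
      case True
      have "Poly_Mapping.single m 1 \<in> T (monomial_degree m)"
        unfolding T_def using True by (auto intro!: image_eqI[where x = "(m, \<lambda>g\<in>G. 0)"])
      then show ?thesis by (rule mpoly_vs.span_base)
    next
      case False
      then obtain i where i: "Poly_Mapping.lookup m i \<ge> N" by (auto simp: exponent_box_def not_less)
      define m' where "m' = m - Poly_Mapping.single i N"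
      have m: "m = m' + Poly_Mapping.single i N"
        unfolding m'_def
          by (rule poly_mapping_eqI) (use i in \<open>auto simp: lookup_add lookup_minus lookup_single when_def\<close>)
      have vp: "var i ^ k = Poly_Mapping.single (Poly_Mapping.single i k) (1::'k)" for k
        by (induction k) (auto simp: mult_single single_add[symmetric])
      obtain u where u: "var i ^ N = (\<Sum>g\<in>G. u g * g)"
        using pow[of i] ideal.span_finite[OF fin] by auto
      have "Poly_Mapping.single m (1::'k) = Poly_Mapping.single m' 1 * var i ^ N"
        unfolding vp mult_single m by simp
      also have "\<dots> = (\<Sum>g\<in>G. g * (Poly_Mapping.single m' 1 * u g))"
        unfolding u by (simp add: sum_distrib_left ac_simps)
      finally have "homogeneous_component (monomial_degree m) (Poly_Mapping.single m 1) =
          homogeneous_component (monomial_degree m) (\<Sum>g\<in>G. g * (Poly_Mapping.single m' 1 * u g))"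
        by simp
      then have eq: "Poly_Mapping.single m 1 =
          (\<Sum>g\<in>G. homogeneous_component (monomial_degree m) (g * (Poly_Mapping.single m' 1 * u g)))"
        by (simp add: homogeneous_component_sum homogeneous_component_single)
      have "homogeneous_component (monomial_degree m) (g * q) \<in>
          mpoly_vs.span (T (monomial_degree m))" if g: "g \<in> G" for g q
      proof (cases "s g \<le> monomial_degree m")
        case True
        then have lt: "monomial_degree m - s g < monomial_degree m" using hom(2)[OF g] by simp
        have "g * homogeneous_component (monomial_degree m - s g) q \<in>
            mpoly_vs.span (T (Suc (monomial_degree m - s g)))"
          using mult[OF g IH[OF lt homogeneous_homogeneous_component]] .
        also have "\<dots> \<subseteq> mpoly_vs.span (T (monomial_degree m))" using lt
          by (intro mpoly_vs.span_mono mono) simp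
        finally show ?thesis using True
          by (simp add: homogeneous_component_mult_homogeneous[OF hom(1)[OF g]])
      next
        case False
        then show ?thesis
          by (simp add: homogeneous_component_mult_homogeneous[OF hom(1)[OF g]] mpoly_vs.span_zero)
      qed
      then show ?thesis by (subst eq) (intro mpoly_vs.span_sum)
    qed
  qed
  let ?n = "CARD('n)" and ?r = "card G"
  have bound: "(D + 1) ^ ?n \<le> N ^ ?n * (?n * D + 1) ^ ?r" for D
  proof -
    let ?M = "(\<lambda>m. Poly_Mapping.single m (1::'k)) ` (exponent_box (Suc D) :: ('n \<Rightarrow>\<^sub>0 nat) set)"
    have "?M \<subseteq> mpoly_vs.span (T (?n * D))"
    proof safe
      fix m :: "'n \<Rightarrow>\<^sub>0 nat" assume "m \<in> exponent_box (Suc D)"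
      then have "monomial_degree m \<le> ?n * D"
        unfolding monomial_degree_def using sum_bounded_above[of UNIV "Poly_Mapping.lookup m" D]
          by (simp add: exponent_box_def less_Suc_eq_le)
      then have "mpoly_vs.span (T (monomial_degree m)) \<subseteq> mpoly_vs.span (T (?n * D))"
        by (intro mpoly_vs.span_mono mono)
      then show "Poly_Mapping.single m 1 \<in> mpoly_vs.span (T (?n * D))" using key[of m] by blast
    qed
    then have "card ?M \<le> card (T (?n * D))"
      using mpoly_vs.independent_span_bound[OF finT independent_monomials] by blast
    also have "card ?M = (D + 1) ^ ?n"
    proof -
      have "inj_on (\<lambda>m. Poly_Mapping.single m (1::'k)) (exponent_box (Suc D) :: ('n \<Rightarrow>\<^sub>0 nat) set)"
        by (rule inj_onI) (metis lookup_single_eq lookup_single_not_eq zero_neq_one)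
      then show ?thesis by (simp add: card_image card_exponent_box)
    qed
    finally show ?thesis using cardT[of "?n * D"] by simp
  qed
  show ?thesis
  proof (rule ccontr)
    assume "\<not> ?n \<le> ?r"
    then have lt: "Suc ?r \<le> ?n" by simp
    \<comment> \<open>From this size on, the bound for \<open>r < n\<close> is violated.\<close>
    define D where "D = N ^ ?n * ?n ^ ?r"
    have "(D + 1) ^ Suc ?r \<le> (D + 1) ^ ?n" using lt by (intro power_increasing) auto
    also have "\<dots> \<le> N ^ ?n * (?n * D + 1) ^ ?r" by (rule bound)
    also have "\<dots> \<le> N ^ ?n * (?n * (D + 1)) ^ ?r"
      using zero_less_card_finite[where 'a='n]
        by (intro mult_left_mono power_mono) (simp_all add: Suc_leI)
    also have "\<dots> = N ^ ?n * ?n ^ ?r * (D + 1) ^ ?r" by (simp only: power_mult_distrib mult.assoc)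
    also have "\<dots> = D * (D + 1) ^ ?r" by (simp only: D_def)
    finally have "(D + 1) * (D + 1) ^ ?r \<le> D * (D + 1) ^ ?r" by simp
    then show False by simp
  qed
qed

section \<open>Characteristic polynomials and Whitney's formula\<close>

lemma sum_alternating_Pow:
  assumes "finite I" "I \<noteq> {}"
  shows "(\<Sum>C\<in>Pow I. (- 1) ^ card C) = (0 :: int)"
proof -
  obtain i where i: "i \<in> I" using assms(2) by auto
  define J where "J = I - {i}"
  have I: "I = insert i J" "i \<notin> J" "finite J" using i assms(1) by (auto simp: J_def)
  have "(\<Sum>C\<in>Pow I. (- 1) ^ card C) =
      (\<Sum>C\<in>Pow J. (- 1) ^ card C) + (\<Sum>C\<in>insert i ` Pow J. (- 1 :: int) ^ card C)"
    unfolding I(1) Pow_insert by (rule sum.union_disjoint) (use I in auto)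
  also have "(\<Sum>C\<in>insert i ` Pow J. (- 1 :: int) ^ card C) = (\<Sum>C\<in>Pow J. (- 1) ^ card (insert i C))"
    by (rule sum.reindex_cong[of "insert i"]) (use I in \<open>auto simp: inj_on_def\<close>)
  also have "\<dots> = (\<Sum>C\<in>Pow J. - ((- 1) ^ card C))"
  proof (rule sum.cong)
    fix C assume "C \<in> Pow J"
    then have "finite C" "i \<notin> C" using I finite_subset by auto
    then show "(- 1) ^ card (insert i C) = - ((- 1 :: int) ^ card C)" by simp
  qed simp
  finally show ?thesis by (simp add: sum_negf)
qed

lemma flats_image: "flats W (L ` I) = (\<lambda>C. W \<inter> \<Inter> (L ` C)) ` Pow I"
  unfolding flats_def by (auto simp: subset_image_iff)

lemma finite_flats: "finite \<A> \<Longrightarrow> finite (flats W \<A>)"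
  using flats_image[of W id \<A>] by simp

text \<open>
  Both sides satisfy the recursion of the Moebius function: the sets of hyperplanes whose
  intersection contains \<open>X\<close> are the subsets of the nonempty set of hyperplanes containing \<open>X\<close>, and their signs
  cancel. The hyperplanes form an indexed family, so that the formula also applies to a restriction,
  where several indices can give the same subspace.
\<close>

lemma moebius_Whitney:
  fixes L :: "'i \<Rightarrow> ('k::field ^ 'n::finite) set"
  assumes fin: "finite I" and proper: "\<And>i. i \<in> I \<Longrightarrow> \<not> W \<subseteq> L i"
    and X: "X \<in> flats W (L ` I)"
  shows "moebius W (L ` I) X = (\<Sum>C | C \<in> Pow I \<and> W \<inter> \<Inter> (L ` C) = X. (- 1) ^ card C)"
proof -
  let ?F = "flats W (L ` I)" and ?g = "\<lambda>C. W \<inter> \<Inter> (L ` C)"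
  let ?N = "\<lambda>X. \<Sum>C | C \<in> Pow I \<and> ?g C = X. (- 1 :: int) ^ card C"
  have finF: "finite ?F" using fin by (intro finite_flats) simp
  show ?thesis using X
  proof (induction "card {Y \<in> ?F. X \<subset> Y}" arbitrary: X rule: less_induct)
    case less
    show ?case
    proof (cases "X = W")
      case True
      have "{C. C \<in> Pow I \<and> ?g C = W} = {{}}" using proper by blast
      then show ?thesis using True finF by (simp add: moebius.simps)
    next
      case False
      obtain C0 where C0: "C0 \<subseteq> I" "X = ?g C0" using less.prems by (auto simp: flats_image)
      let ?J = "{i \<in> I. X \<subseteq> L i}"
      have "C0 \<noteq> {}" using C0 False by auto
      then have J: "finite ?J" "?J \<noteq> {}" using fin C0 by auto
      have XW: "X \<subseteq> W" using C0 by auto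
      have "0 = (\<Sum>C\<in>Pow ?J. (- 1 :: int) ^ card C)" using sum_alternating_Pow[OF J] by simp
      also have "\<dots> = (\<Sum>Y\<in>?g ` Pow ?J. \<Sum>C | C \<in> Pow ?J \<and> ?g C = Y. (- 1) ^ card C)"
        using J(1) by (intro sum.image_gen) simp
      also have "\<dots> = (\<Sum>Y\<in>{Y \<in> ?F. X \<subseteq> Y}. ?N Y)"
      proof (rule sum.cong)
        have 1: "C \<in> Pow ?J" if "C \<subseteq> I" "X \<subseteq> ?g C" for C using that by auto
        have 2: "X \<subseteq> ?g C" if "C \<in> Pow ?J" for C using that XW by auto
        show "?g ` Pow ?J = {Y \<in> ?F. X \<subseteq> Y}"
        proof (intro equalityI subsetI)
          fix Y assume "Y \<in> ?g ` Pow ?J"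
          then obtain C where C: "C \<in> Pow ?J" "Y = ?g C" by (rule_tac imageE)
          then have "C \<in> Pow I" by auto
          then show "Y \<in> {Y \<in> ?F. X \<subseteq> Y}" unfolding flats_image using 2[OF C(1)] C(2) by simp
        next
          fix Y assume Y: "Y \<in> {Y \<in> ?F. X \<subseteq> Y}"
          then obtain C where C: "C \<in> Pow I" "Y = ?g C" unfolding flats_image by auto
          then have "C \<in> Pow ?J" using 1[of C] Y by simp
          then show "Y \<in> ?g ` Pow ?J" using C(2) by (rule_tac image_eqI)
        qed
        fix Y assume "Y \<in> {Y \<in> ?F. X \<subseteq> Y}"
        then have "{C. C \<in> Pow ?J \<and> ?g C = Y} = {C. C \<in> Pow I \<and> ?g C = Y}" by auto
        then show "(\<Sum>C | C \<in> Pow ?J \<and> ?g C = Y. (- 1 :: int) ^ card C) = ?N Y" by (rule arg_cong)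
      qed
      also have "{Y \<in> ?F. X \<subseteq> Y} = insert X {Y \<in> ?F. X \<subset> Y}" using less.prems by auto
      also have "(\<Sum>Y\<in>insert X {Y \<in> ?F. X \<subset> Y}. ?N Y) = ?N X + (\<Sum>Y\<in>{Y \<in> ?F. X \<subset> Y}. ?N Y)"
        using finF by (intro sum.insert) auto
      also have "(\<Sum>Y\<in>{Y \<in> ?F. X \<subset> Y}. ?N Y) = (\<Sum>Y\<in>{Y \<in> ?F. X \<subset> Y}. moebius W (L ` I) Y)"
      proof (rule sum.cong)
        fix Y assume Y: "Y \<in> {Y \<in> ?F. X \<subset> Y}"
        then have "card {Z \<in> ?F. Y \<subset> Z} < card {Z \<in> ?F. X \<subset> Z}"
          using finF by (intro psubset_card_mono) auto
        then show "?N Y = moebius W (L ` I) Y" using less.hyps[of Y] Y by simp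
      qed simp
      finally have "?N X = - (\<Sum>Y\<in>{Y \<in> ?F. X \<subset> Y}. moebius W (L ` I) Y)" by simp
      then show ?thesis using finF False by (simp add: moebius.simps[of W _ X])
    qed
  qed
qed

lemma sum_monom: "(\<Sum>i\<in>I. monom (f i) d) = monom (\<Sum>i\<in>I. f i) d"
  by (induction I rule: infinite_finite_induct) (auto simp: add_monom)

lemma characteristic_poly_Whitney:
  fixes L :: "'i \<Rightarrow> ('k::field ^ 'n::finite) set"
  assumes fin: "finite I" and proper: "\<And>i. i \<in> I \<Longrightarrow> \<not> W \<subseteq> L i"
  shows "characteristic_poly W (L ` I) =
      (\<Sum>C\<in>Pow I. monom ((- 1) ^ card C) (vec.dim (W \<inter> \<Inter> (L ` C))))"
proof -
  let ?g = "\<lambda>C. W \<inter> \<Inter> (L ` C)"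
  have "(\<Sum>C\<in>Pow I. monom ((- 1 :: int) ^ card C) (vec.dim (?g C))) =
      (\<Sum>X\<in>?g ` Pow I. \<Sum>C | C \<in> Pow I \<and> ?g C = X. monom ((- 1) ^ card C) (vec.dim (?g C)))"
    using fin by (intro sum.image_gen) simp
  also have "\<dots> = (\<Sum>X\<in>flats W (L ` I). monom (moebius W (L ` I) X) (vec.dim X))"
  proof (rule sum.cong)
    fix X assume X: "X \<in> flats W (L ` I)"
    have "(\<Sum>C | C \<in> Pow I \<and> ?g C = X. monom ((- 1 :: int) ^ card C) (vec.dim (?g C))) =
       (\<Sum>C | C \<in> Pow I \<and> ?g C = X. monom ((- 1) ^ card C) (vec.dim X))" by (rule sum.cong) auto
    then show "(\<Sum>C | C \<in> Pow I \<and>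
        ?g C = X. monom ((- 1 :: int) ^ card C) (vec.dim (?g C))) = monom (moebius W (L ` I) X) (vec.dim X)"
      using moebius_Whitney[OF assms X] by (simp add: sum_monom)
  qed (simp add: flats_image)
  finally show ?thesis by (simp add: characteristic_poly_def)
qed

lemma arrangement_finite: "arrangement \<A> \<Longrightarrow> finite \<A>"
  and arrangement_hyperplane: "arrangement \<A> \<Longrightarrow> H \<in> \<A> \<Longrightarrow> hyperplane H"
  and arrangement_subset: "arrangement \<A> \<Longrightarrow> \<B> \<subseteq> \<A> \<Longrightarrow> arrangement \<B>"
  by (auto simp: arrangement_iff finite_subset)

lemma hyperplane_subspace: "hyperplane H \<Longrightarrow> vec.subspace H"
  by (simp add: hyperplane_def)

lemma hyperplane_not_UNIV_subset: "hyperplane H \<Longrightarrow> \<not> UNIV \<subseteq> H"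
  using hyperplane_neq_UNIV by blast

lemma characteristic_poly_UNIV:
  assumes "finite I" "\<And>i. i \<in> I \<Longrightarrow> hyperplane (L i)"
  shows "characteristic_poly UNIV (L ` I) =
      (\<Sum>C\<in>Pow I. monom ((- 1) ^ card C) (vec.dim (\<Inter> (L ` C))))"
proof -
  have "\<not> UNIV \<subseteq> L i" if "i \<in> I" for i using assms(2)[OF that] by (rule hyperplane_not_UNIV_subset)
  from characteristic_poly_Whitney[OF assms(1) this] show ?thesis by simp
qed

lemma characteristic_poly_restriction:
  assumes "finite I" "\<And>i. i \<in> I \<Longrightarrow> hyperplane (L i)" "inj_on L I" "k \<in> I"
  shows "characteristic_poly (L k) (restriction (L ` I) (L k)) =
    (\<Sum>C\<in>Pow (I - {k}). monom ((- 1) ^ card C) (vec.dim (\<Inter> (L ` insert k C))))"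
proof -
  have "restriction (L ` I) (L k) = (\<lambda>i. L i \<inter> L k) ` (I - {k})"
    using assms(3,4) by (auto simp: restriction_def inj_on_def)
  moreover have "L k \<inter> (\<Inter>i\<in>C. L i \<inter> L k) = \<Inter> (L ` insert k C)" for C by auto
  moreover have "\<not> L k \<subseteq> L i \<inter> L k" if "i \<in> I - {k}" for i
    using that hyperplane_subset_eq[of "L k" "L i"] assms by (auto simp: inj_on_def)
  ultimately show ?thesis
    using characteristic_poly_Whitney[of "I - {k}" "L k" "\<lambda>i. L i \<inter> L k"] assms(1) by simp
qed

text \<open>
  In Whitney's formula the subsets without \<open>H\<close> belong to the deletion, and those with \<open>H\<close> to the
  restriction, indexed by the remaining hyperplanes.
\<close>

theorem deletion_restriction:
  assumes "arrangement \<A>" "H \<in> \<A>"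
  shows "characteristic_poly UNIV \<A> =
      characteristic_poly UNIV (\<A> - {H}) - characteristic_poly H (restriction \<A> H)"
proof -
  let ?A = "\<A> - {H}"
  let ?f = "\<lambda>C. monom ((- 1 :: int) ^ card C) (vec.dim (\<Inter> C))"
  have fin: "finite \<A>" using assms(1) by (rule arrangement_finite)
  have A: "\<A> = insert H ?A" using assms(2) by auto
  have "characteristic_poly UNIV \<A> = (\<Sum>C\<in>Pow \<A>. ?f C)"
    using characteristic_poly_UNIV[of \<A> "\<lambda>x. x"] fin arrangement_hyperplane[OF assms(1)] by simp
  also have "Pow \<A> = Pow ?A \<union> insert H ` Pow ?A" by (subst A) (rule Pow_insert)
  also have "(\<Sum>C\<in>Pow ?A \<union> insert H ` Pow ?A. ?f C) =
      (\<Sum>C\<in>Pow ?A. ?f C) + (\<Sum>C\<in>insert H ` Pow ?A. ?f C)"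
    by (rule sum.union_disjoint) (use fin in auto)
  also have "(\<Sum>C\<in>insert H ` Pow ?A. ?f C) = (\<Sum>C\<in>Pow ?A. ?f (insert H C))"
    by (rule sum.reindex_cong[of "insert H"]) (auto simp: inj_on_def)
  also have "\<dots> = (\<Sum>C\<in>Pow ?A. - monom ((- 1) ^ card C) (vec.dim (\<Inter> (insert H C))))"
  proof (rule sum.cong)
    fix C assume "C \<in> Pow ?A"
    then have "finite C" "H \<notin> C" using fin finite_subset by auto
    then show "?f (insert H C) = - monom ((- 1) ^ card C) (vec.dim (\<Inter> (insert H C)))"
      by (simp add: minus_monom)
  qed simp
  also have "\<dots> = - characteristic_poly H (restriction \<A> H)"
    using characteristic_poly_restriction[of \<A> "\<lambda>x. x" H] fin arrangement_hyperplane[OF assms(1)] assms(2)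
    by (simp add: sum_negf)
  also have "(\<Sum>C\<in>Pow ?A. ?f C) = characteristic_poly UNIV ?A"
    using characteristic_poly_UNIV[of ?A "\<lambda>x. x"] fin arrangement_hyperplane[OF assms(1)] by simp
  finally show ?thesis by simp
qed

lemma coeff_characteristic_poly:
  assumes "finite \<A>"
  shows "coeff (characteristic_poly W \<A>) d = (\<Sum>X | X \<in> flats W \<A> \<and> vec.dim X = d. moebius W \<A> X)"
proof -
  have "coeff (characteristic_poly W \<A>) d = (\<Sum>X\<in>flats W \<A>. if vec.dim X =
      d then moebius W \<A> X else 0)"
    by (simp add: characteristic_poly_def coeff_sum)
  also have "\<dots> = (\<Sum>X | X \<in> flats W \<A> \<and> vec.dim X = d. moebius W \<A> X)"
    using finite_flats[OF assms] by (simp add: sum.inter_filter)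
  finally show ?thesis .
qed

lemma subspace_flat:
  "vec.subspace W \<Longrightarrow> (\<And>L. L \<in> \<A> \<Longrightarrow> vec.subspace L) \<Longrightarrow> X \<in> flats W \<A> \<Longrightarrow> vec.subspace X"
  by (auto simp: flats_def intro!: vec.subspace_inter vec.subspace_Inter)

lemma ambient_flat: "W \<in> flats W \<A>"
  unfolding flats_def by (auto intro!: exI[of _ "{}"])

lemma coeff_characteristic_poly_top:
  assumes "vec.subspace W" "finite \<A>" "\<And>L. L \<in> \<A> \<Longrightarrow> vec.subspace L"
  shows "coeff (characteristic_poly W \<A>) (vec.dim W) = 1"
    and "degree (characteristic_poly W \<A>) = vec.dim W"
    and "lead_coeff (characteristic_poly W \<A>) = 1"
proof -
  have XW: "X \<subseteq> W" if "X \<in> flats W \<A>" for X using that by (auto simp: flats_def)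
  have "X = W" if "X \<in> flats W \<A>" "vec.dim X = vec.dim W" for X
    using vec.subspace_dim_equal[OF subspace_flat[OF assms(1,3) that(1)] assms(1) XW[OF that(1)]] that(2) by simp
  then have "{X. X \<in> flats W \<A> \<and> vec.dim X = vec.dim W} = {W}"
    using ambient_flat[of W \<A>] by blast
  then show top: "coeff (characteristic_poly W \<A>) (vec.dim W) = 1"
    using assms(2) by (simp add: coeff_characteristic_poly moebius.simps finite_flats)
  have "vec.dim X \<le> vec.dim W" if "X \<in> flats W \<A>" for X
    using that by (intro vec.dim_subset) (auto simp: flats_def)
  then have "{X. X \<in> flats W \<A> \<and> vec.dim X = d} = {}" if "vec.dim W < d" for d
    using that leD by blast
  then have "\<forall>d>vec.dim W. coeff (characteristic_poly W \<A>) d = 0"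
    unfolding coeff_characteristic_poly[OF assms(2)] by (metis sum.empty)
  then have "degree (characteristic_poly W \<A>) \<le> vec.dim W" by (rule degree_le)
  moreover have "vec.dim W \<le> degree (characteristic_poly W \<A>)" using top by (intro le_degree) simp
  ultimately show "degree (characteristic_poly W \<A>) = vec.dim W" by simp
  then show "lead_coeff (characteristic_poly W \<A>) = 1" using top by simp
qed

lemma coeff_characteristic_poly_second:
  assumes "vec.subspace W" "finite \<A>"
    "\<And>L. L \<in> \<A> \<Longrightarrow> vec.subspace L \<and> L \<subseteq> W \<and> vec.dim L + 1 = vec.dim W"
    and pos: "vec.dim W > 0"
  shows "coeff (characteristic_poly W \<A>) (vec.dim W - 1) = - int (card \<A>)"
proof -
  have sub: "vec.subspace X" if "X \<in> flats W \<A>" for X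
    using subspace_flat[OF assms(1) _ that] assms(3) by blast
  have XW: "X \<subseteq> W" if "X \<in> flats W \<A>" for X using that by (auto simp: flats_def)
  have mem: "L \<in> flats W \<A>" if "L \<in> \<A>" for L
    using assms(3)[OF that] that by (auto simp: flats_def intro!: exI[of _ "{L}"])
  have "{X. X \<in> flats W \<A> \<and> vec.dim X = vec.dim W - 1} = \<A>"
  proof (intro equalityI subsetI)
    fix X assume X: "X \<in> {X. X \<in> flats W \<A> \<and> vec.dim X = vec.dim W - 1}"
    then obtain \<B> where B: "\<B> \<subseteq> \<A>" "X = W \<inter> \<Inter> \<B>" by (auto simp: flats_def)
    have "\<B> \<noteq> {}" using B X pos by auto
    then obtain L where L: "L \<in> \<B>" by auto
    have L': "vec.subspace L" "L \<subseteq> W" "vec.dim L + 1 = vec.dim W" using L B assms(3)[of L] by blast+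
    have "X = L"
    proof (rule vec.subspace_dim_equal)
      show "vec.subspace X" using X sub by blast
      show "vec.dim L \<le> vec.dim X" using X L'(3) by simp
    qed (use L L' B in auto)
    then show "X \<in> \<A>" using L B by auto
  next
    fix X assume "X \<in> \<A>"
    then show "X \<in> {X. X \<in> flats W \<A> \<and> vec.dim X = vec.dim W - 1}"
      using mem[of X] assms(3)[of X] by auto
  qed
  moreover have "moebius W \<A> L = - 1" if L: "L \<in> \<A>" for L
  proof -
    have "{Y \<in> flats W \<A>. L \<subset> Y} = {W}"
    proof (intro equalityI subsetI)
      fix Y assume Y: "Y \<in> {Y \<in> flats W \<A>. L \<subset> Y}"
      then have "\<not> vec.dim Y \<le> vec.dim L"
        using vec.subspace_dim_equal[of L Y] sub[of Y] assms(3)[OF L] by blast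
      then have "vec.dim W \<le> vec.dim Y" using assms(3)[OF L] by linarith
      then have "Y = W" using Y sub[of Y] XW[of Y] vec.subspace_dim_equal[OF _ assms(1)] by blast
      then show "Y \<in> {W}" by simp
    next
      fix Y assume "Y \<in> {W}"
      then show "Y \<in> {Y \<in> flats W \<A>. L \<subset> Y}" using assms(3)[OF L] ambient_flat[of W \<A>] by auto
    qed
    moreover have "L \<noteq> W" using assms(3)[OF L] by auto
    ultimately show ?thesis using assms(2)
      by (simp add: moebius.simps[of W \<A> L] moebius.simps[of W \<A> W] finite_flats)
  qed
  ultimately show ?thesis using assms(2) by (simp add: coeff_characteristic_poly)
qed

text \<open>
  At \<open>1\<close> Whitney's formula becomes the alternating sum over all subsets.
\<close>

lemma characteristic_poly_root_1:
  assumes "finite I" "I \<noteq> {}" "\<And>i. i \<in> I \<Longrightarrow> \<not> W \<subseteq> L i"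
  shows "poly (characteristic_poly W (L ` I)) 1 = 0"
proof -
  have "poly (characteristic_poly W (L ` I)) 1 = (\<Sum>C\<in>Pow I. (- 1) ^ card C)"
    by (subst characteristic_poly_Whitney) (use assms in \<open>auto simp: poly_sum poly_monom\<close>)
  then show ?thesis using sum_alternating_Pow[OF assms(1,2)] by simp
qed

lemma monom_dvd_characteristic_poly:
  assumes "\<And>X. X \<in> flats W \<A> \<Longrightarrow> c \<le> vec.dim X"
  shows "monom 1 c dvd characteristic_poly W \<A>"
  unfolding characteristic_poly_def
proof (rule dvd_sum)
  fix X assume "X \<in> flats W \<A>"
  then have "monom (moebius W \<A> X) (vec.dim X) = monom 1 c * monom (moebius W \<A> X) (vec.dim X - c)"
    using assms by (simp add: mult_monom)
  then show "monom 1 c dvd monom (moebius W \<A> X) (vec.dim X)" by simp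
qed

section \<open>Arrangements built by additions\<close>

text \<open>
  The filtrations of additionally free arrangements as an inductive predicate, which supplies the induction
  principle for localizations and for the transport along lattice isomorphisms.
\<close>

inductive addable :: "('k::field ^ 'n::finite) set set \<Rightarrow> bool" where
  empty: "addable {}"
| insert: "addable \<A> \<Longrightarrow> hyperplane H \<Longrightarrow> H \<notin> \<A> \<Longrightarrow> divisional_along (insert H \<A>) H \<Longrightarrow>
    addable (insert H \<A>)"

lemma addable_arrangement: "addable \<A> \<Longrightarrow> arrangement \<A>"
  by (induction rule: addable.induct) (auto simp: arrangement_iff)

lemma additionally_free_addable:
  assumes "\<A> \<in> additionally_free"
  shows "addable \<A>"
proof -
  obtain n :: nat and F where A: "arrangement \<A>" "F 0 = {}" "F n = \<A>"
    and F': "\<forall>i\<in>{1..n}. F (i - 1) \<subseteq> F i \<and> (\<exists>H. F i - F (i - 1) = {H} \<and> divisional_along (F i) H)"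
    using assms unfolding additionally_free_def mem_Collect_eq by metis
  note F = F'[rule_format]
  have sub: "F i \<subseteq> \<A>" if "i \<le> n" for i
    using that
  proof (induction rule: inc_induct)
    case base
    then show ?case using A by simp
  next
    case (step m)
    then show ?case using F[of "Suc m"] by auto
  qed
  have "i \<le> n \<Longrightarrow> addable (F i)" for i
  proof (induction i)
    case 0
    then show ?case using A by (simp add: addable.empty)
  next
    case (Suc i)
    then obtain H
      where H: "F i \<subseteq> F (Suc i)" "F (Suc i) - F i = {H}" "divisional_along (F (Suc i)) H"
      using F[of "Suc i"] by auto
    then have eq: "F (Suc i) = insert H (F i)" "H \<notin> F i" by auto
    moreover have "hyperplane H"
      using sub[OF Suc.prems] arrangement_hyperplane[OF A(1)] eq by auto
    ultimately show ?case using addable.insert[of "F i" H] Suc H by simp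
  qed
  then show ?thesis using A by auto
qed

lemma localization_subset: "localization \<A> X \<subseteq> \<A>"
  by (auto simp: localization_def)

text \<open>
  The conditions for the localization are among those for \<open>\<A>\<close>, since localizing at a flat that
  contains \<open>X\<close> does not see the first localization.
\<close>

lemma divisional_along_localization:
  assumes "divisional_along \<A> H" "X \<subseteq> H"
  shows "divisional_along (localization \<A> X) H"
  unfolding divisional_along_def
proof
  fix Y assume "Y \<in> flats H (restriction (localization \<A> X) H)"
  then obtain \<B> where B: "\<B> \<subseteq> restriction (localization \<A> X) H" "Y = H \<inter> \<Inter> \<B>"
    by (auto simp: flats_def)
  have "restriction (localization \<A> X) H \<subseteq> restriction \<A> H"
    by (auto simp: restriction_def localization_def)
  then have Y: "Y \<in> flats H (restriction \<A> H)" using B by (auto simp: flats_def)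
  have "X \<subseteq> L" if "L \<in> \<B>" for L
    using B(1) that assms(2) by (auto simp: restriction_def localization_def)
  then have "X \<subseteq> Y" using B(2) assms(2) by auto
  then have "localization (localization \<A> X) Y = localization \<A> Y" by (auto simp: localization_def)
  then show "characteristic_poly H (restriction (localization (localization \<A> X) Y) H) dvd
      characteristic_poly UNIV (localization (localization \<A> X) Y)"
    using assms(1) Y by (simp add: divisional_along_def)
qed

lemma addable_localization: "addable \<A> \<Longrightarrow> addable (localization \<A> X)"
proof (induction rule: addable.induct)
  case empty
  then show ?case by (simp add: localization_def addable.empty)
next
  case (insert \<A> H)
  show ?case
  proof (cases "X \<subseteq> H")
    case True
    then have eq: "localization (insert H \<A>) X = insert H (localization \<A> X)"
      by (auto simp: localization_def)
    show ?thesis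
      unfolding eq
      by (rule addable.insert) (use insert divisional_along_localization[OF insert.hyps(4) True] eq in \<open>auto simp: localization_def\<close>)
  next
    case False
    then have "localization (insert H \<A>) X = localization \<A> X" by (auto simp: localization_def)
    then show ?thesis using insert by simp
  qed
qed

section \<open>Invariance under isomorphisms of the intersection lattice\<close>

lemma flats_restriction:
  assumes "X \<in> flats K (restriction \<C> K)"
  obtains D where "D \<subseteq> \<C> - {K}" "X = \<Inter> (insert K D)"
proof -
  have "restriction \<C> K = (\<lambda>L. L \<inter> K) ` (\<C> - {K})" by (simp add: restriction_def)
  then obtain D where D: "D \<subseteq> \<C> - {K}" "X = K \<inter> \<Inter> ((\<lambda>L. L \<inter> K) ` D)"
    using assms by (auto simp: flats_image)
  have "K \<inter> \<Inter> ((\<lambda>L. L \<inter> K) ` D) = \<Inter> (insert K D)" by auto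
  then show ?thesis using that[of D] D by simp
qed

lemma flats_restrictionI:
  assumes "D \<subseteq> \<C> - {K}"
  shows "\<Inter> (insert K D) \<in> flats K (restriction \<C> K)"
proof -
  have "\<Inter> (insert K D) = K \<inter> \<Inter> ((\<lambda>L. L \<inter> K) ` D)" by auto
  then show ?thesis using assms by (auto simp: restriction_def flats_image)
qed

text \<open>
  Whitney's formula turns a bijection of hyperplanes that preserves the dimensions of all
  intersections into equalities of characteristic polynomials. It also matches the localizations,
  because \<open>X \<subseteq> L\<close> holds if and only if intersecting with \<open>L\<close> does not lower the dimension of \<open>X\<close>.
\<close>

lemma divisional_along_transport:
  assumes C: "arrangement \<C>" and A: "arrangement (\<phi> ` \<C>)" and inj: "inj_on \<phi> \<C>"
    and dim: "\<And>B. B \<subseteq> \<C> \<Longrightarrow> vec.dim (\<Inter> B) = vec.dim (\<Inter> (\<phi> ` B))"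
    and K: "K \<in> \<C>" and div: "divisional_along (\<phi> ` \<C>) (\<phi> K)"
  shows "divisional_along \<C> K"
  unfolding divisional_along_def
proof
  fix X assume "X \<in> flats K (restriction \<C> K)"
  then obtain D where D: "D \<subseteq> \<C> - {K}" "X = \<Inter> (insert K D)" by (rule flats_restriction)
  let ?E = "insert K D"
  have E: "?E \<subseteq> \<C>" using D K by auto
  define X' where "X' = \<Inter> (\<phi> ` ?E)"
  have X': "X' \<in> flats (\<phi> K) (restriction (\<phi> ` \<C>) (\<phi> K))"
  proof -
    have "\<phi> ` D \<subseteq> \<phi> ` \<C> - {\<phi> K}" using D(1) inj K by (auto simp: inj_on_def)
    then show ?thesis using flats_restrictionI[of "\<phi> ` D" "\<phi> ` \<C>" "\<phi> K"] by (simp add: X'_def)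
  qed
  have subI: "vec.subspace (\<Inter> B)" if "B \<subseteq> \<C>" for B
    using that arrangement_hyperplane[OF C] hyperplane_subspace by (intro vec.subspace_Inter) blast
  have subI': "vec.subspace (\<Inter> (\<phi> ` B))" if "B \<subseteq> \<C>" for B
    using that arrangement_hyperplane[OF A] hyperplane_subspace by (intro vec.subspace_Inter) blast
  have le: "X \<subseteq> L \<longleftrightarrow> X' \<subseteq> \<phi> L" if L: "L \<in> \<C>" for L
  proof -
    have EL: "insert L ?E \<subseteq> \<C>" using E L by auto
    have "X \<subseteq> L \<longleftrightarrow> \<Inter> (insert L ?E) = X" unfolding D(2) by auto
    also have "\<dots> \<longleftrightarrow> vec.dim (\<Inter> (insert L ?E)) = vec.dim X"
      using vec.subspace_dim_equal[OF subI[OF EL] subI[OF E]] unfolding D(2)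
        by (metis Inter_anti_mono order_refl subset_insertI)
    also have "\<dots> \<longleftrightarrow> vec.dim (\<Inter> (\<phi> ` insert L ?E)) = vec.dim X'"
      using dim[OF EL] dim[OF E] by (simp add: D(2) X'_def)
    also have "\<dots> \<longleftrightarrow> \<Inter> (\<phi> ` insert L ?E) = X'"
      using vec.subspace_dim_equal[OF subI'[OF EL] subI'[OF E]] unfolding X'_def
      by (metis Inter_anti_mono image_mono order_refl subset_insertI)
    also have "\<dots> \<longleftrightarrow> X' \<subseteq> \<phi> L" unfolding X'_def by auto
    finally show ?thesis .
  qed
  define I where "I = localization \<C> X"
  have IC: "I \<subseteq> \<C>" by (simp add: I_def localization_subset)
  have I': "localization (\<phi> ` \<C>) X' = \<phi> ` I" using le by (auto simp: I_def localization_def)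
  have KI: "K \<in> I" using K D by (auto simp: I_def localization_def)
  have finI: "finite I" using IC arrangement_finite[OF C] by (rule finite_subset)
  have hyp: "hyperplane i" "hyperplane (\<phi> i)" if "i \<in> I" for i
    using that IC arrangement_hyperplane[OF C] arrangement_hyperplane[OF A] by auto
  have injI: "inj_on \<phi> I" using inj IC by (rule inj_on_subset)
  have "characteristic_poly UNIV I = characteristic_poly UNIV (\<phi> ` I)"
  proof -
    have "(\<Sum>B\<in>Pow I. monom ((- 1 :: int) ^ card B) (vec.dim (\<Inter> B))) =
        (\<Sum>B\<in>Pow I. monom ((- 1) ^ card B) (vec.dim (\<Inter> (\<phi> ` B))))"
    proof (rule sum.cong)
      fix B assume "B \<in> Pow I"
      then have "vec.dim (\<Inter> B) = vec.dim (\<Inter> (\<phi> ` B))" using IC by (intro dim) auto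
      then show "monom ((- 1 :: int) ^ card B) (vec.dim (\<Inter> B)) =
          monom ((- 1) ^ card B) (vec.dim (\<Inter> (\<phi> ` B)))"
        by simp
    qed simp
    then show ?thesis
      using characteristic_poly_UNIV[OF finI, of "\<lambda>x. x"] characteristic_poly_UNIV[OF finI, of \<phi>] hyp by simp
  qed
  moreover have "characteristic_poly K (restriction I K) =
      characteristic_poly (\<phi> K) (restriction (\<phi> ` I) (\<phi> K))"
  proof -
    have "(\<Sum>B\<in>Pow (I - {K}). monom ((- 1 :: int) ^ card B) (vec.dim (\<Inter> (insert K B)))) =
        (\<Sum>B\<in>Pow (I - {K}). monom ((- 1) ^ card B) (vec.dim (\<Inter> (\<phi> ` insert K B))))"
    proof (rule sum.cong)
      fix B assume "B \<in> Pow (I - {K})"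
      then have "vec.dim (\<Inter> (insert K B)) = vec.dim (\<Inter> (\<phi> ` insert K B))" using IC K
        by (intro dim) auto
      then show "monom ((- 1 :: int) ^ card B) (vec.dim (\<Inter> (insert K B))) =
          monom ((- 1) ^ card B) (vec.dim (\<Inter> (\<phi> ` insert K B)))" by simp
    qed simp
    then show ?thesis
      using characteristic_poly_restriction[OF finI, of "\<lambda>x. x" K] characteristic_poly_restriction[OF finI _ injI KI] hyp KI
      by simp
  qed
  ultimately show "characteristic_poly K (restriction (localization \<C> X) K) dvd
      characteristic_poly UNIV (localization \<C> X)"
    using div[unfolded divisional_along_def, rule_format, OF X'] unfolding I' I_def[symmetric]
      by metis
qed

lemma addable_transport:
  assumes "addable \<A>" "arrangement \<C>" "inj_on \<phi> \<C>" "\<phi> ` \<C> = \<A>"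
    "\<And>B. B \<subseteq> \<C> \<Longrightarrow> vec.dim (\<Inter> B) = vec.dim (\<Inter> (\<phi> ` B))"
  shows "addable \<C>"
  using assms
proof (induction arbitrary: \<C> rule: addable.induct)
  case empty
  then show ?case by (simp add: addable.empty)
next
  case (insert \<A> H)
  then have "H \<in> \<phi> ` \<C>" by simp
  then obtain K where K: "K \<in> \<C>" "\<phi> K = H" by auto
  have im: "\<phi> ` (\<C> - {K}) = \<A>"
  proof -
    have "\<phi> ` (\<C> - {K}) = \<phi> ` \<C> - {H}"
      using inj_on_image_set_diff[OF insert.prems(2), of \<C> "{K}"] K by auto
    then show ?thesis using insert.prems(3) insert.hyps(3) by simp
  qed
  have "addable (\<C> - {K})"
  proof (rule insert.IH[OF _ _ im])
    show "arrangement (\<C> - {K})" using insert.prems(1) by (rule arrangement_subset) auto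
    show "inj_on \<phi> (\<C> - {K})" using insert.prems(2) by (rule inj_on_diff)
    show "vec.dim (\<Inter> B) = vec.dim (\<Inter> (\<phi> ` B))" if "B \<subseteq> \<C> - {K}" for B
      using that by (intro insert.prems(4)) auto
  qed
  moreover have "divisional_along \<C> K"
    by (rule divisional_along_transport[of \<C> \<phi>])
       (use insert.prems insert.hyps K addable.insert[OF insert.hyps] addable_arrangement in auto)
  moreover have "insert K (\<C> - {K}) = \<C>" using K by auto
  ultimately show ?case
    using addable.insert[of "\<C> - {K}" K] arrangement_hyperplane[OF insert.prems(1) K(1)] by simp
qed

lemma flats_UNIV: "flats UNIV \<A> = Inter ` Pow \<A>"
  by (auto simp: flats_def)

lemma subspace_flat_UNIV: "arrangement \<A> \<Longrightarrow> X \<in> flats UNIV \<A> \<Longrightarrow> vec.subspace X"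
  using subspace_flat[of UNIV \<A> X] arrangement_hyperplane hyperplane_subspace
    by (metis vec.subspace_UNIV)

text \<open>
  The larger flat is cut down
    by a single hyperplane through \<open>X\<close>, so the lattice determines dimensions.
\<close>

lemma cover_dim:
  assumes A: "arrangement \<A>" and X: "X \<in> flats UNIV \<A>" and Y: "Y \<in> flats UNIV \<A>" and XY: "X \<subset> Y"
    and cover: "\<And>Z. Z \<in> flats UNIV \<A> \<Longrightarrow> X \<subset> Z \<Longrightarrow> \<not> Z \<subset> Y"
  shows "vec.dim X + 1 = vec.dim Y"
proof -
  obtain B where B: "B \<subseteq> \<A>" "X = \<Inter> B" using X by (auto simp: flats_UNIV)
  obtain D where D: "D \<subseteq> \<A>" "Y = \<Inter> D" using Y by (auto simp: flats_UNIV)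
  obtain L where L: "L \<in> B" "\<not> Y \<subseteq> L" using B XY by blast
  have "Y \<inter> L = \<Inter> (insert L D)" using D by auto
  moreover have "insert L D \<in> Pow \<A>" using D B L by auto
  ultimately have "Y \<inter> L \<in> flats UNIV \<A>" unfolding flats_UNIV by (rule image_eqI)
  moreover have "X \<subseteq> Y \<inter> L" "Y \<inter> L \<subset> Y" using B L XY by auto
  ultimately have "X = Y \<inter> L" using cover by blast
  then show ?thesis
    using dim_Int_hyperplane[OF subspace_flat_UNIV[OF A Y] _ L(2)] arrangement_hyperplane[OF A] B L
      by blast
qed

lemma hyperplane_flat_iff:
  assumes "arrangement \<A>" "X \<in> flats UNIV \<A>"
  shows "X \<in> \<A> \<longleftrightarrow> hyperplane X"
proof
  assume X: "hyperplane X"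
  obtain B where B: "B \<subseteq> \<A>" "X = \<Inter> B" using assms(2) by (auto simp: flats_UNIV)
  have "B \<noteq> {}" using hyperplane_neq_UNIV[OF X] B by auto
  then obtain L where L: "L \<in> B" by auto
  then have "X = L" using hyperplane_subset_eq[OF X] arrangement_hyperplane[OF assms(1)] B by blast
  then show "X \<in> \<A>" using L B by auto
qed (use assms arrangement_hyperplane in blast)

text \<open>
  Downward induction from the whole space, which is the greatest flat of both lattices; covering
  pairs correspond to each other and differ in dimension by one.
\<close>

lemma poset_isomorphic_dim:
  fixes \<A> \<C> :: "('k::field ^ 'n::finite) set set"
  assumes A: "arrangement \<A>" and C: "arrangement \<C>"
    and f: "bij_betw f (flats UNIV \<C>) (flats UNIV \<A>)"
    and le: "\<And>X Y. X \<in> flats UNIV \<C> \<Longrightarrow> Y \<in> flats UNIV \<C> \<Longrightarrow> X \<subseteq> Y \<longleftrightarrow> f X \<subseteq> f Y"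
    and X: "X \<in> flats UNIV \<C>"
  shows "vec.dim (f X) = vec.dim X"
  using X
proof (induction "CARD('n) - vec.dim X" arbitrary: X rule: less_induct)
  case less
  let ?C = "flats UNIV \<C>" and ?A = "flats UNIV \<A>"
  have lt: "Z \<subset> Z' \<longleftrightarrow> f Z \<subset> f Z'" if "Z \<in> ?C" "Z' \<in> ?C" for Z Z'
    using le[OF that] le[OF that(2,1)] by blast
  have im: "f Z \<in> ?A" if "Z \<in> ?C" for Z using f that by (auto simp: bij_betw_def)
  have surj: "\<exists>Z'\<in>?C. Z = f Z'" if "Z \<in> ?A" for Z using f that by (auto simp: bij_betw_def)
  have U: "UNIV \<in> ?C" "UNIV \<in> ?A" by (rule ambient_flat)+
  show ?case
  proof (cases "X = UNIV")
    case True
    obtain Z where "Z \<in> ?C" "UNIV = f Z" using surj[OF U(2)] by auto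
    then have "f UNIV = UNIV" using le[of Z UNIV] U by auto
    then show ?thesis using True by simp
  next
    case False
    let ?S = "{Y \<in> ?C. X \<subset> Y}"
    have "finite ?S" using finite_flats[OF arrangement_finite[OF C]] by simp
    moreover have "UNIV \<in> ?S" using U False by auto
    moreover from this have "?S \<noteq> {}" by blast
    ultimately have "\<exists>Y\<in>?S. \<forall>Z\<in>?S. Z \<subseteq> Y \<longrightarrow> Y = Z" by (intro finite_has_minimal)
    then obtain Y where Y: "Y \<in> ?S" and min: "\<forall>Z\<in>?S. Z \<subseteq> Y \<longrightarrow> Y = Z" by (rule bexE)
    have Y2: "\<not> Z \<subset> Y" if "Z \<in> ?S" for Z using min that by blast
    have d1: "vec.dim X + 1 = vec.dim Y"
      using Y Y2 by (intro cover_dim[OF C less.prems]) auto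
    have "vec.dim (f X) + 1 = vec.dim (f Y)"
    proof (rule cover_dim[OF A])
      show "f X \<in> ?A" "f Y \<in> ?A" using im less.prems Y by auto
      show "f X \<subset> f Y" using lt[OF less.prems, of Y] Y by blast
      fix Z assume "Z \<in> ?A" "f X \<subset> Z"
      then obtain Z' where Z': "Z' \<in> ?C" "Z = f Z'" using surj by blast
      then have "Z' \<in> ?S" using lt[OF less.prems Z'(1)] \<open>f X \<subset> Z\<close> Z' by blast
      then have "\<not> Z' \<subset> Y" by (rule Y2)
      then show "\<not> Z \<subset> f Y" using lt[OF Z'(1), of Y] Y Z'(2) by blast
    qed
    moreover have "vec.dim Y \<le> CARD('n)" by (rule dim_subset_UNIV_cart_gen)
    then have "vec.dim (f Y) = vec.dim Y" using d1 Y by (intro less.hyps) auto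
    ultimately show ?thesis using d1 by simp
  qed
qed

text \<open>
  The isomorphism matches the hyperplanes, which are the flats of codimension one, and it commutes
  with intersections, which are the meets of the lattices.
\<close>

lemma addable_poset_isomorphic:
  fixes \<A> \<C> :: "('k::field ^ 'n::finite) set set"
  assumes "addable \<A>" "arrangement \<C>" "poset_isomorphic (flats UNIV \<C>) (flats UNIV \<A>)"
  shows "addable \<C>"
proof -
  let ?C = "flats UNIV \<C>" and ?A = "flats UNIV \<A>"
  obtain f where f: "bij_betw f ?C ?A" and le': "\<forall>X\<in>?C. \<forall>Y\<in>?C. X \<subseteq> Y \<longleftrightarrow> f X \<subseteq> f Y"
    using assms(3) unfolding poset_isomorphic_def by (elim exE conjE)
  note le = le'[rule_format]
  have A: "arrangement \<A>" using assms(1) by (rule addable_arrangement)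
  note C = assms(2)
  have dim: "vec.dim (f X) = vec.dim X" if "X \<in> ?C" for X
    by (rule poset_isomorphic_dim[OF A C f le that])
  have im: "f Z \<in> ?A" if "Z \<in> ?C" for Z using f that by (auto simp: bij_betw_def)
  have surj: "\<exists>Z'\<in>?C. Z = f Z'" if "Z \<in> ?A" for Z using f that by (auto simp: bij_betw_def)
  have mem: "L \<in> ?C" if "L \<in> \<C>" for L using that
    by (auto simp: flats_UNIV intro!: image_eqI[of _ _ "{L}"])
  have memA: "L \<in> ?A" if "L \<in> \<A>" for L using that
    by (auto simp: flats_UNIV intro!: image_eqI[of _ _ "{L}"])
  have iff: "f X \<in> \<A> \<longleftrightarrow> X \<in> \<C>" if "X \<in> ?C" for X
    using hyperplane_flat_iff[OF A im[OF that]] hyperplane_flat_iff[OF C that] dim[OF that]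
      subspace_flat_UNIV[OF A im[OF that]] subspace_flat_UNIV[OF C that]
        by (simp add: hyperplane_def)
  show ?thesis
  proof (rule addable_transport[OF assms(1) C])
    show "inj_on f \<C>" using f mem by (auto simp: bij_betw_def inj_on_def)
    show "f ` \<C> = \<A>" using iff mem surj memA by blast
    fix B assume B: "B \<subseteq> \<C>"
    have BC: "\<Inter> B \<in> ?C" using B by (auto simp: flats_UNIV)
    have fB: "f ` B \<subseteq> \<A>" using B iff mem by blast
    then have "\<Inter> (f ` B) \<in> ?A" by (auto simp: flats_UNIV)
    then obtain Z where Z: "Z \<in> ?C" "\<Inter> (f ` B) = f Z" using surj by blast
    have "Z \<subseteq> L" if "L \<in> B" for L
      using le[OF Z(1) mem, of L] that B Z(2) by auto
    then have "Z \<subseteq> \<Inter> B" by auto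
    then have "f Z \<subseteq> f (\<Inter> B)" using le[OF Z(1) BC] by simp
    moreover have "f (\<Inter> B) \<subseteq> f L" if "L \<in> B" for L
      using le[OF BC mem, of L] that B by auto
    ultimately have "f (\<Inter> B) = \<Inter> (f ` B)" using Z by blast
    then show "vec.dim (\<Inter> B) = vec.dim (\<Inter> (f ` B))" using dim[OF BC] by simp
  qed
qed

section \<open>Reduction modulo a linear form\<close>

definition pivot :: "'k::field ^ 'n::finite \<Rightarrow> 'n" where
  "pivot a = (SOME i. a $ i \<noteq> 0)"

lemma pivot: "a \<noteq> 0 \<Longrightarrow> a $ pivot a \<noteq> 0"
  unfolding pivot_def by (rule someI_ex) (auto simp: vec_eq_iff)

definition reduce_form :: "'k::field ^ 'n::finite \<Rightarrow> 'k ^ 'n \<Rightarrow> 'k ^ 'n" where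
  "reduce_form a b = b - (b $ pivot a / a $ pivot a) *s a"

text \<open>
  Elimination of the pivot variable of \<open>a\<close>. This endomorphism has the ideal generated
    by the form of \<open>a\<close>
  as its kernel, so a congruence modulo that form becomes an equation between polynomials, and the
  quotient ring inherits the absence of zero divisors.
\<close>

definition reduce_mod :: "'k::field ^ 'n::finite \<Rightarrow> ('k, 'n) mpoly \<Rightarrow> ('k, 'n) mpoly" where
  "reduce_mod a = substitute (\<lambda>i. linear_form (reduce_form a (axis i 1)))"

lemma linear_form_diff: "linear_form (a - b) = linear_form a - linear_form b"
  using linear_form_add[of "a - b" b] by (simp add: algebra_simps)

lemma linear_form_sum: "linear_form (\<Sum>i\<in>I. f i) = (\<Sum>i\<in>I. linear_form (f i))"
  by (induction I rule: infinite_finite_induct) (auto simp: linear_form_add)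

lemma reduce_form_self: "a \<noteq> 0 \<Longrightarrow> reduce_form a a = 0"
  using pivot[of a] by (simp add: reduce_form_def)

lemma reduce_form_add: "reduce_form a (b + c) = reduce_form a b + reduce_form a c"
  by (simp add: reduce_form_def vec_eq_iff add_divide_distrib algebra_simps)

lemma reduce_form_scale: "reduce_form a (c *s b) = c *s reduce_form a b"
  by (simp add: reduce_form_def vec_eq_iff algebra_simps)

lemma reduce_form_0: "reduce_form a 0 = 0"
  by (simp add: reduce_form_def)

lemma reduce_form_sum: "reduce_form a (\<Sum>i\<in>I. f i) = (\<Sum>i\<in>I. reduce_form a (f i))"
  by (induction I rule: infinite_finite_induct) (auto simp: reduce_form_add reduce_form_0)

lemma vec_axis_sum: "(\<Sum>i\<in>UNIV. b $ i *s axis i 1) = (b :: 'k::field ^ 'n::finite)"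
  by (rule basis_expansion)

lemma reduce_mod_linear_form: "reduce_mod a (linear_form b) = linear_form (reduce_form a b)"
proof -
  have "reduce_mod a (linear_form b) =
      (\<Sum>i\<in>UNIV. const (b $ i) * linear_form (reduce_form a (axis i 1)))"
    unfolding reduce_mod_def linear_form_alt[of b] substitute_sum substitute_mult substitute_const substitute_var by simp
  also have "\<dots> = linear_form (reduce_form a (\<Sum>i\<in>UNIV. b $ i *s axis i 1))"
    by (simp only: reduce_form_sum reduce_form_scale linear_form_sum linear_form_scale)
  finally show ?thesis by (simp only: vec_axis_sum)
qed

lemma reduce_mod_add: "reduce_mod a (p + q) = reduce_mod a p + reduce_mod a q"
  and reduce_mod_diff: "reduce_mod a (p - q) = reduce_mod a p - reduce_mod a q"
  and reduce_mod_mult: "reduce_mod a (p * q) = reduce_mod a p * reduce_mod a q"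
  and reduce_mod_sum: "reduce_mod a (sum f I) = (\<Sum>i\<in>I. reduce_mod a (f i))"
  and reduce_mod_prod: "reduce_mod a (prod f I) = (\<Prod>i\<in>I. reduce_mod a (f i))"
  and reduce_mod_const [simp]: "reduce_mod a (const c) = const c"
  and reduce_mod_0 [simp]: "reduce_mod a 0 = 0"
  and reduce_mod_1 [simp]: "reduce_mod a 1 = 1"
  by (auto simp: reduce_mod_def substitute_add substitute_diff substitute_mult substitute_sum substitute_prod)

lemma reduce_mod_homogeneous: "p \<in> homogeneous_part d \<Longrightarrow> reduce_mod a p \<in> homogeneous_part d"
  unfolding reduce_mod_def by (rule substitute_homogeneous) auto

lemma dvd_diff_reduce_mod: "linear_form a dvd p - reduce_mod a p"
  unfolding reduce_mod_def
proof (rule substitute_congruent)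
  fix i
  have "var i - linear_form (reduce_form a (axis i 1)) =
      linear_form ((axis i 1 $ pivot a / a $ pivot a) *s a)"
    unfolding linear_form_axis[symmetric] linear_form_diff[symmetric] reduce_form_def by simp
  then show "linear_form a dvd var i - linear_form (reduce_form a (axis i 1))"
    by (simp add: linear_form_scale)
qed

lemma reduce_mod_self: "a \<noteq> 0 \<Longrightarrow> reduce_mod a (linear_form a) = 0"
  by (simp add: reduce_mod_linear_form reduce_form_self)

lemma reduce_mod_eq_0_iff:
  assumes "a \<noteq> 0"
  shows "reduce_mod a p = 0 \<longleftrightarrow> linear_form a dvd p"
proof
  assume "reduce_mod a p = 0"
  then show "linear_form a dvd p" using dvd_diff_reduce_mod[of a p] by simp
next
  assume "linear_form a dvd p"
  then show "reduce_mod a p = 0" using reduce_mod_self[OF assms]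
    by (auto simp: dvd_def reduce_mod_mult)
qed

lemma reduce_mod_idem: "a \<noteq> 0 \<Longrightarrow> reduce_mod a (reduce_mod a p) = reduce_mod a p"
  using reduce_mod_eq_0_iff[of a "p - reduce_mod a p"] dvd_diff_reduce_mod[of a p]
    by (simp add: reduce_mod_diff)

lemma linear_form_prime:
  assumes "a \<noteq> 0" "linear_form a dvd p * q"
  shows "linear_form a dvd p \<or> linear_form a dvd q"
  using assms(2) unfolding reduce_mod_eq_0_iff[OF assms(1), symmetric]
    by (simp add: reduce_mod_mult)

lemma linear_form_dvd_prod:
  assumes "a \<noteq> 0" "finite I" "linear_form a dvd (\<Prod>i\<in>I. f i)"
  shows "\<exists>i\<in>I. linear_form a dvd f i"
  using assms(3) unfolding reduce_mod_eq_0_iff[OF assms(1), symmetric] reduce_mod_prod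
  by (simp add: mpoly_prod_eq_0[OF assms(2)])

lemma linear_form_dvd_const:
  assumes "a \<noteq> 0" "linear_form a dvd const c"
  shows "c = 0"
  using assms(2) unfolding reduce_mod_eq_0_iff[OF assms(1), symmetric]
    by (metis reduce_mod_const lookup_single_eq lookup_zero)

lemma linear_form_dvd_linear_form:
  assumes "a \<noteq> 0" "linear_form a dvd linear_form b"
  obtains c where "b = c *s a"
proof -
  have "reduce_form a b = 0" using assms(2) unfolding reduce_mod_eq_0_iff[OF assms(1), symmetric]
    by (simp add: reduce_mod_linear_form)
  then show ?thesis using that[of "b $ pivot a / a $ pivot a"] by (simp add: reduce_form_def)
qed

text \<open>
  Linear forms are prime, so the factors can be cancelled one at a time; repeated factors are
  allowed.
\<close>

lemma prod_linear_forms_dvd_cancel: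
  assumes "finite I" "\<And>i. i \<in> I \<Longrightarrow> b i \<noteq> 0" "\<And>i. i \<in> I \<Longrightarrow> \<not> linear_form (b i) dvd q"
    and "(\<Prod>i\<in>I. linear_form (b i)) dvd q * g"
  shows "(\<Prod>i\<in>I. linear_form (b i)) dvd g"
  using assms
proof (induction I arbitrary: g rule: finite_induct)
  case (insert x F)
  let ?x = "linear_form (b x)" and ?P = "\<Prod>i\<in>F. linear_form (b i)"
  have x: "b x \<noteq> 0" "\<not> ?x dvd q" using insert.prems by auto
  have d: "?x * ?P dvd q * g" using insert.prems(3) unfolding prod.insert[OF insert.hyps(1,2)] .
  then have "?x dvd q * g" by (rule dvd_mult_left)
  then have "?x dvd g" using linear_form_prime[OF x(1)] x(2) by blast
  then obtain g' where g: "g = ?x * g'" by (rule dvdE)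
  from d obtain r where "q * g = ?x * ?P * r" by (rule dvdE)
  then have "?x * (q * g') = ?x * (?P * r)" unfolding g by (simp only: ac_simps)
  then have "q * g' = ?P * r" using mpoly_mult_left_cancel[of ?x "q * g'" "?P * r"] x(1) by simp
  then have "?P dvd q * g'" by simp
  then have "?P dvd g'" by (intro insert.IH[of g']) (use insert.prems in blast)+
  then show ?case unfolding g prod.insert[OF insert.hyps(1,2)] by (rule mult_dvd_mono[OF dvd_refl])
qed simp

lemma prod_linear_forms_dvd:
  assumes "finite I" "\<And>i. i \<in> I \<Longrightarrow> b i \<noteq> 0" "\<And>i. i \<in> I \<Longrightarrow> linear_form (b i) dvd p"
    and "\<And>i j. i \<in> I \<Longrightarrow> j \<in> I \<Longrightarrow> i \<noteq> j \<Longrightarrow> \<not> linear_form (b i) dvd linear_form (b j)"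
  shows "(\<Prod>i\<in>I. linear_form (b i)) dvd p"
  using assms
proof (induction I rule: finite_induct)
  case (insert x F)
  let ?P = "\<Prod>i\<in>F. linear_form (b i)"
  have "?P dvd p" using insert by auto
  then obtain g where g: "p = ?P * g" by (rule dvdE)
  have "linear_form (b x) dvd ?P * g" using insert.prems(2)[of x] g by simp
  moreover have "\<not> linear_form (b x) dvd ?P"
    using linear_form_dvd_prod[of "b x" F] insert by (metis insertI1 insertI2)
  ultimately have "linear_form (b x) dvd g" using linear_form_prime insert.prems(1) by blast
  then have "linear_form (b x) * ?P dvd g * ?P" by (rule mult_dvd_mono) simp
  then show ?case unfolding g prod.insert[OF insert.hyps(1,2)] by (simp only: mult.commute)
qed simp

lemma normal_proportional:
  assumes "hyperplane L" "hyperplane H" "normal L = c *s normal H"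
  shows "L = H"
proof -
  have "H \<subseteq> L" using assms by (auto simp: dot_normal_iff[symmetric] dot_scale_left)
  then show ?thesis using hyperplane_subset_eq[OF assms(2,1)] by simp
qed

lemma normal_dvd:
  assumes "hyperplane L" "hyperplane H" "linear_form (normal H) dvd linear_form (normal L)"
  shows "L = H"
  using linear_form_dvd_linear_form[OF normal_neq_0[OF assms(2)] assms(3)] normal_proportional[OF assms(1,2)] by metis

text \<open>
  The form of a hyperplane through \<open>L \<inter> H\<close> vanishes on the common zeros of the forms of \<open>L\<close> and \<open>H\<close>.
\<close>

lemma normal_pencil:
  assumes "hyperplane L" "hyperplane M" "hyperplane H" "L \<inter> H \<subseteq> M"
  obtains c e where "normal M = c *s normal L + e *s normal H"
proof -
  have "normal M \<in> vec.span {normal L, normal H}"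
  proof (rule double_annihilator)
    fix v assume "\<And>g. g \<in> {normal L, normal H} \<Longrightarrow> dot g v = 0"
    then have "dot (normal L) v = 0" "dot (normal H) v = 0" by simp_all
    then show "dot (normal M) v = 0" using assms by (auto simp: dot_normal_iff)
  qed
  then obtain c where "normal M - c *s normal L \<in> vec.span {normal H}"
    using vec.span_breakdown_eq[of "normal M" "normal L" "{normal H}"] by auto
  then obtain e where "normal M - c *s normal L = e *s normal H"
    by (auto simp: vec.span_singleton)
  then have "normal M = c *s normal L + e *s normal H" by (simp add: algebra_simps)
  then show ?thesis by (rule that)
qed

section \<open>Terao's polynomial\<close>

text \<open>
  Since the choice operator sees only the set of candidates, localizations at flats inside \<open>H\<close> make
  the same choices as \<open>\<A>\<close>.
\<close>

definition chosen_lift :: "('k::field ^ 'n::finite) set set \<Rightarrow> ('k ^ 'n) set \<Rightarrow> ('k ^ 'n) set \<Rightarrow> ('k ^ 'n) set" where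
  "chosen_lift \<A> H Y = (SOME L. L \<in> \<A> - {H} \<and> L \<inter> H = Y)"

definition chosen_lifts :: "('k::field ^ 'n::finite) set set \<Rightarrow> ('k ^ 'n) set \<Rightarrow> ('k ^ 'n) set set" where
  "chosen_lifts \<A> H = chosen_lift \<A> H ` restriction \<A> H"

text \<open>
  Modulo the form of \<open>H\<close> this is, up to a constant factor, the quotient of the defining polynomials of the
  deletion and of the restriction.
\<close>

definition terao_poly :: "('k::field ^ 'n::finite) set set \<Rightarrow> ('k ^ 'n) set \<Rightarrow> ('k, 'n) mpoly" where
  "terao_poly \<A> H = (\<Prod>L\<in>\<A> - {H} - chosen_lifts \<A> H. linear_form (normal L))"

lemma chosen_lift:
  assumes "Y \<in> restriction \<A> H"
  shows "chosen_lift \<A> H Y \<in> \<A> - {H}" "chosen_lift \<A> H Y \<inter> H = Y"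
proof -
  have "\<exists>L. L \<in> \<A> - {H} \<and> L \<inter> H = Y" using assms by (auto simp: restriction_def)
  then have "chosen_lift \<A> H Y \<in> \<A> - {H} \<and> chosen_lift \<A> H Y \<inter> H = Y" unfolding chosen_lift_def
    by (rule someI_ex)
  then show "chosen_lift \<A> H Y \<in> \<A> - {H}" "chosen_lift \<A> H Y \<inter> H = Y" by auto
qed

lemma chosen_lifts_subset: "chosen_lifts \<A> H \<subseteq> \<A> - {H}"
  unfolding chosen_lifts_def using chosen_lift(1)[of _ \<A> H] by blast

lemma inj_on_chosen_lift: "inj_on (chosen_lift \<A> H) (restriction \<A> H)"
  by (rule inj_onI) (metis chosen_lift(2))

lemma card_chosen_lifts: "card (chosen_lifts \<A> H) = card (restriction \<A> H)"
  unfolding chosen_lifts_def by (rule card_image[OF inj_on_chosen_lift])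

lemma terao_poly_homogeneous:
  assumes "finite \<A>"
  shows "terao_poly \<A> H \<in> homogeneous_part (card (\<A> - {H}) - card (restriction \<A> H))"
proof -
  have "card (\<A> - {H} - chosen_lifts \<A> H) = card (\<A> - {H}) - card (restriction \<A> H)"
    using chosen_lifts_subset[of \<A> H] assms
      by (simp add: card_Diff_subset finite_subset card_chosen_lifts[symmetric])
  then show ?thesis unfolding terao_poly_def
    using homogeneous_prod[of "\<A> - {H} - chosen_lifts \<A> H" "\<lambda>L. linear_form (normal L)"] by simp
qed

lemma log_derivations_iff:
  "\<theta> \<in> log_derivations \<A> \<longleftrightarrow> (\<forall>H\<in>\<A>. linear_form (normal H) dvd der_apply \<theta> (linear_form (normal H)))"
  by (simp add: log_derivations_def defining_form_normal)

lemma reduce_mod_terao_poly_neq_0: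
  assumes "arrangement \<A>" "H \<in> \<A>"
  shows "reduce_mod (normal H) (terao_poly \<A> H) \<noteq> 0"
proof -
  have H: "hyperplane H" using assms by (rule arrangement_hyperplane)
  have "reduce_mod (normal H) (linear_form (normal L)) \<noteq> 0" if "L \<in> \<A> - {H}" for L
    using that normal_dvd[of L H] H arrangement_hyperplane[OF assms(1)] reduce_mod_eq_0_iff[OF normal_neq_0[OF H]] by blast
  then show ?thesis
    unfolding terao_poly_def reduce_mod_prod using arrangement_finite[OF assms(1)]
      by (subst mpoly_prod_eq_0) auto
qed

text \<open>
  Over one element of the restriction: write \<open>\<theta>(\<beta>) = \<beta> p\<close> for the form \<open>\<beta>\<close> of \<open>L\<close>. The form of every
  other \<open>M\<close> is \<open>c \<beta> + e \<alpha>\<close> with \<open>e \<noteq> 0\<close>, and \<open>\<theta>(c \<beta> + e \<alpha>)\<close> is congruent to \<open>e (\<theta>(\<alpha>) - \<alpha> p)\<close> modulo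
  that form. So each of these pairwise coprime forms divides \<open>\<theta>(\<alpha>) - \<alpha> p\<close>, and hence their
  product does, while \<open>\<alpha> p\<close> vanishes modulo \<open>\<alpha>\<close>.
\<close>

lemma terao_poly_class_dvd:
  assumes L: "hyperplane L" "L \<noteq> H" and H: "hyperplane H"
    and C: "finite C" "\<And>M. M \<in> C \<Longrightarrow> hyperplane M \<and> M \<noteq> H \<and> M \<noteq> L \<and> M \<inter> H = L \<inter> H"
    and \<theta>: "\<theta> \<in> log_derivations (insert L C)"
  shows "reduce_mod (normal H) (\<Prod>M\<in>C. linear_form (normal M)) dvd
      reduce_mod (normal H) (der_apply \<theta> (linear_form (normal H)))"
proof -
  let ?f = "\<lambda>L. linear_form (normal L)" and ?d = "\<lambda>L. der_apply \<theta> (linear_form (normal L))"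
  have "?f L dvd ?d L" using \<theta> by (simp add: log_derivations_iff)
  then obtain p where p: "?d L = ?f L * p" by (rule dvdE)
  have "(\<Prod>M\<in>C. ?f M) dvd ?d H - ?f H * p"
  proof (rule prod_linear_forms_dvd[OF C(1)])
    show "normal M \<noteq> 0" if "M \<in> C" for M using normal_neq_0 C(2)[OF that] by blast
    show "\<not> ?f M dvd ?f M'" if "M \<in> C" "M' \<in> C" "M \<noteq> M'" for M M'
      using normal_dvd[of M' M] C(2)[OF that(1)] C(2)[OF that(2)] that(3) by auto
    fix M assume M: "M \<in> C"
    obtain c e where ce: "normal M = c *s normal L + e *s normal H"
      by (rule normal_pencil[of L M H]) (use C(2)[OF M] L H in auto)
    have "e \<noteq> 0" using ce normal_proportional[of M L c] L C(2)[OF M] by auto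
    have dM: "?f M dvd ?d M" using \<theta> M by (simp add: log_derivations_iff)
    have "?d M = const c * (?f L * p) + const e * ?d H"
      unfolding ce der_apply_linear_form_add der_apply_linear_form_scale p ..
    moreover have "?f M = const c * ?f L + const e * ?f H"
      unfolding ce linear_form_add linear_form_scale ..
    ultimately have eq: "?d M - ?f M * p = const e * (?d H - ?f H * p)"
      by (simp only:) (simp add: algebra_simps)
    have "?f M dvd ?d M - ?f M * p" by (rule dvd_diff[OF dM]) simp
    then have "?f M dvd const e * (?d H - ?f H * p)" unfolding eq .
    then have "?f M dvd const (1 / e) * (const e * (?d H - ?f H * p))" by (rule dvd_mult)
    also have "const (1 / e) * (const e * (?d H - ?f H * p)) = ?d H - ?f H * p"
      using \<open>e \<noteq> 0\<close> by (simp only: mult.assoc[symmetric] const_mult[symmetric]) simp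
    finally show "?f M dvd ?d H - ?f H * p" .
  qed
  then obtain r where "?d H - ?f H * p = (\<Prod>M\<in>C. ?f M) * r" by (rule dvdE)
  then have "reduce_mod (normal H) (?d H - ?f H * p) = reduce_mod (normal H) ((\<Prod>M\<in>C. ?f M) * r)"
    by simp
  then have "reduce_mod (normal H) (?d H) =
      reduce_mod (normal H) (\<Prod>M\<in>C. ?f M) * reduce_mod (normal H) r"
    using reduce_mod_self[OF normal_neq_0[OF H]] by (simp add: reduce_mod_diff reduce_mod_mult)
  then show ?thesis by simp
qed

text \<open>
  Modulo the form of \<open>H\<close>, the contributions of different elements of the restriction are coprime.
\<close>

theorem terao_poly_dvd:
  assumes A: "arrangement \<A>" "H \<in> \<A>" and \<theta>: "\<theta> \<in> log_derivations (\<A> - {H})"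
  shows "reduce_mod (normal H) (terao_poly \<A> H) dvd
      reduce_mod (normal H) (der_apply \<theta> (linear_form (normal H)))"
proof -
  let ?f = "\<lambda>L. linear_form (normal L)" and ?k = "reduce_mod (normal H)"
  have fin: "finite \<A>" using A by (simp add: arrangement_finite)
  have hyp: "hyperplane L" if "L \<in> \<A>" for L using A(1) that by (rule arrangement_hyperplane)
  have H: "hyperplane H" using A(2) by (rule hyp)
  define C where "C Y = {L \<in> \<A> - {H}. L \<inter> H = Y} - {chosen_lift \<A> H Y}" for Y
  have finC: "finite (C Y)" for Y using fin by (simp add: C_def)
  have C: "L \<in> \<A>" "L \<noteq> H" "L \<inter> H = Y" "hyperplane L" if "L \<in> C Y" for L Y
    using that hyp by (auto simp: C_def)
  have un: "\<A> - {H} - chosen_lifts \<A> H = (\<Union>Y\<in>restriction \<A> H. C Y)"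
  proof -
    have r1: "L = chosen_lift \<A> H (L \<inter> H)" if "L \<in> chosen_lifts \<A> H" for L
      using that chosen_lift(2)[of _ \<A> H] by (auto simp: chosen_lifts_def)
    have r2: "L \<inter> H \<in> restriction \<A> H" if "L \<in> \<A> - {H}" for L
      using that by (auto simp: restriction_def)
    have r3: "L \<in> chosen_lifts \<A> H \<longleftrightarrow> L = chosen_lift \<A> H (L \<inter> H)" if "L \<in> \<A> - {H}" for L
    proof
      assume "L = chosen_lift \<A> H (L \<inter> H)"
      then show "L \<in> chosen_lifts \<A> H" unfolding chosen_lifts_def using r2[OF that]
        by (rule image_eqI)
    qed (rule r1)
    have "L \<in> \<A> - {H} - chosen_lifts \<A> H \<longleftrightarrow> (\<exists>Y\<in>restriction \<A> H. L \<in> C Y)" for L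
    proof (cases "L \<in> \<A> - {H}")
      case True
      then have "L \<in> C Y \<longleftrightarrow> Y = L \<inter> H \<and> L \<notin> chosen_lifts \<A> H" for Y
        unfolding r3[OF True] C_def by auto
      then show ?thesis using r2[OF True] True by simp
    qed (auto simp: C_def)
    then show ?thesis by blast
  qed
  have finR: "finite (restriction \<A> H)" using fin by (simp add: restriction_def)
  have "terao_poly \<A> H = (\<Prod>Y\<in>restriction \<A> H. \<Prod>L\<in>C Y. ?f L)"
    unfolding terao_poly_def un
  proof (rule prod.UNION_disjoint[OF finR])
    show "\<forall>Y\<in>restriction \<A> H. finite (C Y)" using finC by blast
    show "\<forall>Y\<in>restriction \<A> H. \<forall>Z\<in>restriction \<A> H. Y \<noteq> Z \<longrightarrow> C Y \<inter> C Z = {}"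
      unfolding C_def by blast
  qed
  then have k: "?k (terao_poly \<A> H) =
      (\<Prod>Y\<in>restriction \<A> H. \<Prod>L\<in>C Y. linear_form (reduce_form (normal H) (normal L)))"
    by (simp add: reduce_mod_prod reduce_mod_linear_form)
  have nz: "reduce_form (normal H) (normal L) \<noteq> 0" if "L \<in> \<A> - {H}" for L
  proof
    assume "reduce_form (normal H) (normal L) = 0"
    then have "?k (?f L) = 0" by (simp add: reduce_mod_linear_form)
    then show False using reduce_mod_eq_0_iff[OF normal_neq_0[OF H]] normal_dvd[of L H] hyp H that
      by auto
  qed
  have nd: "L \<inter> H = M \<inter> H"
    if L: "L \<in> \<A> - {H}" and M: "M \<in> \<A> - {H}"
      and dvd: "linear_form (reduce_form (normal H) (normal L)) dvd
          linear_form (reduce_form (normal H) (normal M))" for L M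
  proof -
    obtain c where c: "reduce_form (normal H) (normal M) = c *s reduce_form (normal H) (normal L)"
      using linear_form_dvd_linear_form[OF nz[OF L] dvd] .
    have pz: "dot (reduce_form (normal H) b) v = dot b v" if "v \<in> H" for b v
    proof -
      have "dot (normal H) v = 0" using that H by (simp add: dot_normal_iff)
      moreover have "dot (reduce_form (normal H) b) v +
          (b $ pivot (normal H) / normal H $ pivot (normal H)) * dot (normal H) v = dot b v"
        unfolding dot_scale_left[symmetric] dot_add_left[symmetric] reduce_form_def by simp
      ultimately show ?thesis by simp
    qed
    have "L \<inter> H \<subseteq> M \<inter> H"
    proof
      fix v assume v: "v \<in> L \<inter> H"
      then have "dot (normal L) v = 0" using L hyp by (simp add: dot_normal_iff)
      then have "dot (normal M) v = 0" using c pz[of v] v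
        by (metis IntD2 dot_scale_left mult_zero_right)
      then show "v \<in> M \<inter> H" using v M hyp by (simp add: dot_normal_iff)
    qed
    moreover have "vec.subspace (L \<inter> H)" "vec.subspace (M \<inter> H)"
      using L M hyp H by (auto intro!: vec.subspace_inter simp: hyperplane_subspace)
    moreover have "vec.dim (N \<inter> H) + 1 = vec.dim H" if "N \<in> \<A> - {H}" for N
    proof -
      have "hyperplane N" "\<not> H \<subseteq> N" using that hyp H hyperplane_subset_eq[of H N] by auto
      then show ?thesis using dim_Int_hyperplane[of H N] H
        by (simp add: Int_commute hyperplane_subspace)
    qed
    then have "vec.dim (M \<inter> H) + 1 = vec.dim (L \<inter> H) + 1" using L M by metis
    ultimately show ?thesis by (intro vec.subspace_dim_equal) simp_all
  qed
  define f where "f = ?k (der_apply \<theta> (?f H))"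
  have each: "(\<Prod>L\<in>C Y. linear_form (reduce_form (normal H) (normal L))) dvd f"
    if Y: "Y \<in> restriction \<A> H" for Y
  proof -
    note r = chosen_lift[OF Y]
    have sub: "insert (chosen_lift \<A> H Y) (C Y) \<subseteq> \<A> - {H}" using r C by blast
    have "?k (\<Prod>L\<in>C Y. ?f L) dvd ?k (der_apply \<theta> (?f H))"
    proof (rule terao_poly_class_dvd[OF _ _ H finC])
      show "hyperplane (chosen_lift \<A> H Y)" "chosen_lift \<A> H Y \<noteq> H" using r hyp by auto
      show "hyperplane M \<and> M \<noteq> H \<and> M \<noteq> chosen_lift \<A> H Y \<and> M \<inter> H = chosen_lift \<A> H Y \<inter> H"
        if "M \<in> C Y" for M
        using C[OF that] r that by (auto simp: C_def)
      show "\<theta> \<in> log_derivations (insert (chosen_lift \<A> H Y) (C Y))" using \<theta> sub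
        by (auto simp: log_derivations_iff)
    qed
    then show ?thesis by (simp add: f_def reduce_mod_prod reduce_mod_linear_form)
  qed
  have "(\<Prod>Y\<in>F. \<Prod>L\<in>C Y. linear_form (reduce_form (normal H) (normal L))) dvd f"
    if "finite F" "F \<subseteq> restriction \<A> H" for F
    using that
  proof (induction F rule: finite_induct)
    case (insert Z F)
    let ?P = "\<lambda>Y. \<Prod>L\<in>C Y. linear_form (reduce_form (normal H) (normal L))"
    have "(\<Prod>Y\<in>F. ?P Y) dvd f" using insert by auto
    then obtain g where g: "f = (\<Prod>Y\<in>F. ?P Y) * g" by (rule dvdE)
    have "?P Z dvd (\<Prod>Y\<in>F. ?P Y) * g" using each[of Z] insert.prems g by simp
    then have "?P Z dvd g"
    proof (rule prod_linear_forms_dvd_cancel[OF finC, rotated 2])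
      fix L assume L: "L \<in> C Z"
      then show nzL: "reduce_form (normal H) (normal L) \<noteq> 0" using C[of L Z] by (intro nz) auto
      show "\<not> linear_form (reduce_form (normal H) (normal L)) dvd (\<Prod>Y\<in>F. ?P Y)"
      proof
        assume "linear_form (reduce_form (normal H) (normal L)) dvd (\<Prod>Y\<in>F. ?P Y)"
        then obtain Y where Y: "Y \<in> F" "linear_form (reduce_form (normal H) (normal L)) dvd ?P Y"
          using linear_form_dvd_prod[OF nzL insert.hyps(1)] by blast
        then obtain M
          where M: "M \<in> C Y" "linear_form (reduce_form (normal H) (normal L)) dvd
              linear_form (reduce_form (normal H) (normal M))"
          using linear_form_dvd_prod[OF nzL finC] by blast
        have "L \<inter> H = M \<inter> H" using nd[OF _ _ M(2)] C[OF L] C[OF M(1)] by auto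
        then show False using C(3)[OF L] C(3)[OF M(1)] Y(1) insert.hyps(2) by auto
      qed
    qed
    then have "?P Z * (\<Prod>Y\<in>F. ?P Y) dvd g * (\<Prod>Y\<in>F. ?P Y)" by (intro mult_dvd_mono) auto
    then show ?case using insert.hyps g by (simp add: mult.commute)
  qed simp
  from this[OF finR order_refl] show ?thesis unfolding k f_def .
qed

section \<open>Bases of logarithmic derivations and the addition step\<close>

text \<open>
  A homogeneous basis as an indexed family with a record of the degrees. Independence forces its
  members to be nonzero, as \<open>homogeneous_der\<close> demands.
\<close>

definition log_basis :: "('k::field ^ 'n::finite) set set \<Rightarrow> ('n \<Rightarrow> ('k, 'n) derivation) \<Rightarrow> ('n \<Rightarrow> nat) \<Rightarrow> bool" where
  "log_basis \<A> \<theta> d \<longleftrightarrow>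
     (\<forall>i j. \<theta> i $ j \<in> homogeneous_part (d i)) \<and>
     (\<forall>f. (\<Sum>i\<in>UNIV. f i *s \<theta> i) = 0 \<longrightarrow> (\<forall>i. f i = 0)) \<and>
     log_derivations \<A> = range (\<lambda>f. \<Sum>i\<in>UNIV. f i *s \<theta> i)"

interpretation der: module "(*s) :: ('k::field, 'n::finite) mpoly \<Rightarrow> ('k, 'n) derivation \<Rightarrow> _"
  by (rule module_derivation)

lemma sum_delta_scale:
  fixes \<theta> :: "'i::finite \<Rightarrow> ('k::field, 'n::finite) derivation"
  shows "(\<Sum>i\<in>UNIV. (if i = k then c else 0) *s \<theta> i) = c *s \<theta> k"
proof -
  have "(\<Sum>i\<in>UNIV. (if i = k then c else 0) *s \<theta> i) = (\<Sum>i\<in>UNIV. if i = k then c *s \<theta> k else 0)"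
    by (intro sum.cong) auto
  also have "\<dots> = c *s \<theta> k" by (subst sum.delta) simp_all
  finally show ?thesis .
qed

lemma log_basis_mem:
  assumes "log_basis \<A> \<theta> d"
  shows "\<theta> i \<in> log_derivations \<A>"
proof -
  have "\<theta> i = (\<Sum>j\<in>UNIV. (if j = i then 1 else 0) *s \<theta> j)" by (subst sum_delta_scale) simp
  then have "\<theta> i \<in> range (\<lambda>f. \<Sum>i\<in>UNIV. f i *s \<theta> i)"
    by (rule range_eqI[where x = "\<lambda>j. if j = i then 1 else 0"])
  then show ?thesis using assms by (simp add: log_basis_def)
qed

lemma log_basis_free:
  fixes \<A> :: "('k::field ^ 'n::finite) set set"
  assumes "log_basis \<A> \<theta> d"
  shows "free_arrangement \<A>"
  unfolding free_arrangement_def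
proof (intro exI conjI allI)
  have ind: "f i = 0" if "(\<Sum>i\<in>UNIV. f i *s \<theta> i) = 0" for f i
    using assms that by (auto simp: log_basis_def)
  show "homogeneous_der (d i) (\<theta> i)" for i
  proof -
    have "\<theta> i \<noteq> 0"
    proof
      assume "\<theta> i = 0"
      then have "(\<Sum>j\<in>UNIV. (if j = i then 1 else 0) *s \<theta> j) = 0" by (subst sum_delta_scale) simp
      from ind[OF this, of i] show False by simp
    qed
    then show ?thesis using assms by (simp add: homogeneous_der_iff log_basis_def)
  qed
  show inj: "inj \<theta>"
  proof (rule injI, rule ccontr)
    fix i j assume ij: "\<theta> i = \<theta> j" "i \<noteq> j"
    have "(\<Sum>l\<in>UNIV. ((if l = i then 1 else 0) - (if l = j then 1 else 0)) *s \<theta> l) = 0"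
      unfolding der.scale_left_diff_distrib sum_subtractf sum_delta_scale using ij by simp
    from ind[OF this, of i] ij(2) show False by simp
  qed
  show "\<not> der.dependent (range \<theta>)"
  proof
    assume "der.dependent (range \<theta>)"
    then obtain f where f: "\<exists>v\<in>range \<theta>. f v \<noteq> 0" "(\<Sum>x\<in>range \<theta>. f x *s x) = 0"
      by (subst (asm) der.dependent_finite) auto
    have "(\<Sum>i\<in>UNIV. f (\<theta> i) *s \<theta> i) = 0" using f(2) by (simp add: sum.reindex[OF inj])
    from ind[OF this] f(1) show False by blast
  qed
  show "der.span (range \<theta>) = log_derivations \<A>"
  proof -
    have "der.span (range \<theta>) = range (\<lambda>u. \<Sum>v\<in>range \<theta>. u v *s v)" by (rule der.span_finite) simp
    also have "\<dots> = range (\<lambda>f. \<Sum>i\<in>UNIV. f i *s \<theta> i)"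
    proof (intro equalityI subsetI)
      fix x assume "x \<in> range (\<lambda>u. \<Sum>v\<in>range \<theta>. u v *s v)"
      then obtain u where "x = (\<Sum>i\<in>UNIV. u (\<theta> i) *s \<theta> i)" by (auto simp: sum.reindex[OF inj])
      then show "x \<in> range (\<lambda>f. \<Sum>i\<in>UNIV. f i *s \<theta> i)"
        by (intro image_eqI[of _ _ "\<lambda>i. u (\<theta> i)"]) auto
    next
      fix x assume "x \<in> range (\<lambda>f. \<Sum>i\<in>UNIV. f i *s \<theta> i)"
      then obtain f where "x = (\<Sum>i\<in>UNIV. f i *s \<theta> i)" by auto
      then have "x = (\<Sum>v\<in>range \<theta>. f (inv \<theta> v) *s v)"
        by (simp add: sum.reindex[OF inj] inv_f_f[OF inj])
      then show "x \<in> range (\<lambda>u. \<Sum>v\<in>range \<theta>. u v *s v)"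
        by (intro image_eqI[of _ _ "\<lambda>v. f (inv \<theta> v)"]) auto
    qed
    finally show ?thesis using assms by (simp add: log_basis_def)
  qed
qed

lemma log_derivations_scale: "\<theta> \<in> log_derivations \<A> \<Longrightarrow> f *s \<theta> \<in> log_derivations \<A>"
  by (auto simp: log_derivations_iff der_apply_scale)

lemma log_derivations_add: "\<theta> \<in> log_derivations \<A> \<Longrightarrow> \<eta> \<in> log_derivations \<A> \<Longrightarrow>
    \<theta> + \<eta> \<in> log_derivations \<A>"
  by (auto simp: log_derivations_iff der_apply_add)

lemma log_derivations_diff: "\<theta> \<in> log_derivations \<A> \<Longrightarrow> \<eta> \<in> log_derivations \<A> \<Longrightarrow>
    \<theta> - \<eta> \<in> log_derivations \<A>"
  by (auto simp: log_derivations_iff der_apply_diff)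

lemma log_derivations_sum: "(\<And>i. i \<in> I \<Longrightarrow> \<theta> i \<in> log_derivations \<A>) \<Longrightarrow> (\<Sum>i\<in>I. \<theta> i) \<in> log_derivations \<A>"
  by (induction I rule: infinite_finite_induct) (auto simp: log_derivations_add, auto simp: log_derivations_iff)

lemma log_derivations_delete:
  assumes "hyperplane H" "H \<in> \<A>"
  shows "\<theta> \<in> log_derivations \<A> \<longleftrightarrow>
    \<theta> \<in> log_derivations (\<A> - {H}) \<and> reduce_mod (normal H) (der_apply \<theta> (linear_form (normal H))) = 0"
  using assms(2) unfolding reduce_mod_eq_0_iff[OF normal_neq_0[OF assms(1)]] log_derivations_iff
    by auto

text \<open>
  Some logarithmic derivation of the deletion takes the value of Terao's polynomial modulo the form
  of \<open>H\<close>: the surjectivity that makes the addition of \<open>H\<close> preserve freeness.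
\<close>

definition attains_terao_poly :: "('k::field ^ 'n::finite) set set \<Rightarrow> ('k ^ 'n) set \<Rightarrow> bool" where
  "attains_terao_poly \<A> H \<longleftrightarrow> (\<exists>\<eta>\<in>log_derivations (\<A> - {H}).
     reduce_mod (normal H) (der_apply \<eta> (linear_form (normal H))) = reduce_mod (normal H) (terao_poly \<A> H))"

text \<open>
  The conclusion of Terao's factorisation theorem, kept as an induction hypothesis.
\<close>

definition exponents :: "('k::field ^ 'n::finite) set set \<Rightarrow> ('n \<Rightarrow> nat) \<Rightarrow> bool" where
  "exponents \<A> d \<longleftrightarrow> characteristic_poly UNIV \<A> = (\<Prod>i\<in>UNIV. [:- int (d i), 1:])"

abbreviation terao_degree :: "('k::field ^ 'n::finite) set set \<Rightarrow> ('k ^ 'n) set \<Rightarrow> nat" where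
  "terao_degree \<A> H \<equiv> card (\<A> - {H}) - card (restriction \<A> H)"

lemma homogeneous_0_const:
  assumes "p \<in> homogeneous_part 0"
  shows "p = const (Poly_Mapping.lookup p 0)"
proof (rule poly_mapping_eqI)
  fix m :: "'a \<Rightarrow>\<^sub>0 nat"
  have "m = 0" if "monomial_degree m = 0" using that
    by (intro poly_mapping_eqI) (simp add: monomial_degree_def)
  then show "Poly_Mapping.lookup p m = Poly_Mapping.lookup (const (Poly_Mapping.lookup p 0)) m"
    using assms
      by (cases "Poly_Mapping.lookup p m =
          0") (auto simp: homogeneous_part_iff lookup_single when_def in_keys_iff)
qed

lemma card_restriction_le: "finite \<A> \<Longrightarrow> card (restriction \<A> H) \<le> card (\<A> - {H})"
  unfolding restriction_def by (intro card_image_le) simp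

lemma restriction_hyperplanes:
  assumes "arrangement \<A>" "H \<in> \<A>" "Y \<in> restriction \<A> H"
  shows "vec.subspace Y \<and> Y \<subseteq> H \<and> vec.dim Y + 1 = vec.dim H"
proof -
  obtain L where L: "L \<in> \<A> - {H}" "Y = L \<inter> H" using assms(3) by (auto simp: restriction_def)
  have hyp: "hyperplane L" "hyperplane H" using L assms arrangement_hyperplane by auto
  then have "\<not> H \<subseteq> L" using hyperplane_subset_eq[of H L] L by auto
  then have "vec.dim (H \<inter> L) + 1 = vec.dim H"
    using dim_Int_hyperplane[of H L] hyp by (simp add: hyperplane_subspace)
  then show ?thesis using L hyp by (auto simp: Int_commute hyperplane_subspace vec.subspace_inter)
qed

text \<open>
  By deletion-restriction \<open>\<chi>(\<A>\<^sup>H)\<close> divides \<open>\<chi>(\<A> - {H})\<close> together with \<open>\<chi>(\<A>)\<close>. The quotient is monic of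
  degree one, and its constant term is read off from the second highest coefficients, which count
  hyperplanes.
\<close>

lemma characteristic_poly_quotient:
  fixes \<A> :: "('k::field ^ 'n::finite) set set"
  assumes A: "arrangement \<A>" and H: "H \<in> \<A>" and d: "exponents (\<A> - {H}) d"
    and dvd: "characteristic_poly H (restriction \<A> H) dvd characteristic_poly UNIV \<A>"
  shows "characteristic_poly UNIV (\<A> - {H}) =
      characteristic_poly H (restriction \<A> H) * [:- int (terao_degree \<A> H), 1:]"
proof -
  let ?p = "characteristic_poly UNIV (\<A> - {H})" and ?q = "characteristic_poly H (restriction \<A> H)"
  have fin: "finite (\<A> - {H})" "finite (restriction \<A> H)"
    using arrangement_finite[OF A] by (auto simp: restriction_def)
  have subA: "vec.subspace L" if "L \<in> \<A> - {H}" for L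
    using that arrangement_hyperplane[OF A] hyperplane_subspace by blast
  note R = restriction_hyperplanes[OF A H]
  have hH: "vec.subspace H" "vec.dim H + 1 = CARD('n)"
    using arrangement_hyperplane[OF A H] by (auto simp: hyperplane_def)
  have q: "degree ?q = vec.dim H" "lead_coeff ?q = 1" "coeff ?q (vec.dim H) = 1"
    using coeff_characteristic_poly_top[OF hH(1) fin(2)] R by auto
  have dU: "vec.dim (UNIV :: ('k ^ 'n) set) = CARD('n)" by (rule vec_dim_card)
  have p: "degree ?p = CARD('n)" "lead_coeff ?p = 1"
    using coeff_characteristic_poly_top[OF vec.subspace_UNIV fin(1)] subA dU by auto
  have "?q dvd characteristic_poly UNIV \<A> + ?q" using dvd by simp
  also have "characteristic_poly UNIV \<A> + ?q = ?p" using deletion_restriction[OF A H] by simp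
  finally obtain r where r: "?p = ?q * r" by (rule dvdE)
  have nz: "?q \<noteq> 0" "r \<noteq> 0" using q(2) p(2) r by auto
  have "degree r = 1" using degree_mult_eq[OF nz] p q hH by (simp add: r[symmetric])
  moreover have "lead_coeff r = 1" using lead_coeff_mult[of ?q r] p q by (simp add: r[symmetric])
  ultimately obtain e where e: "r = [:- e, 1:]"
    using degree1_coeffs[of r] by (metis coeff_pCons_0 coeff_pCons_Suc One_nat_def minus_minus)
  have "e = int (terao_degree \<A> H)"
  proof -
    have c: "coeff ?p (CARD('n) - 1) = - int (card (\<A> - {H}))"
      using coeff_characteristic_poly_second[OF vec.subspace_UNIV fin(1)] subA dU
        arrangement_hyperplane[OF A] by (auto simp: hyperplane_def)
    have "CARD('n) - 1 = vec.dim H" using hH by simp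
    then have c2: "coeff ?p (CARD('n) - 1) =
        - e * coeff ?q (vec.dim H) + (case vec.dim H of 0 \<Rightarrow> 0 | Suc m \<Rightarrow> coeff ?q m)"
      unfolding r e by (simp add: mult.commute[of ?q] coeff_pCons split: nat.split)
    show ?thesis
    proof (cases "vec.dim H")
      \<comment> \<open>In a one-dimensional space the restriction has no second coefficient, but \<open>H\<close> is the only hyperplane.\<close>
      case 0
      then have "Y \<notin> restriction \<A> H" for Y using R[of Y] unfolding 0 by linarith
      then have "restriction \<A> H = {}" by blast
      then have A0: "\<A> - {H} = {}" by (auto simp: restriction_def)
      have "coeff ?q 0 = 1" using q(3) unfolding 0 .
      then show ?thesis using c c2 unfolding 0 A0 by simp
    next
      case (Suc m)
      have "coeff ?q (vec.dim H - 1) = - int (card (restriction \<A> H))"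
        using coeff_characteristic_poly_second[OF hH(1) fin(2) R] Suc by simp
      then show ?thesis using c c2 Suc q(3) card_restriction_le[OF arrangement_finite[OF A], of H]
        by simp
    qed
  qed
  then show ?thesis using r e by simp
qed

lemma exponents_restriction:
  fixes \<A> :: "('k::field ^ 'n::finite) set set"
  assumes A: "arrangement \<A>" and H: "H \<in> \<A>" and d: "exponents (\<A> - {H}) d"
    and dvd: "characteristic_poly H (restriction \<A> H) dvd characteristic_poly UNIV \<A>"
    and k: "d k = terao_degree \<A> H"
  shows "characteristic_poly H (restriction \<A> H) = (\<Prod>i\<in>UNIV - {k}. [:- int (d i), 1:])"
proof -
  have "characteristic_poly H (restriction \<A> H) * [:- int (d k), 1:] =
      (\<Prod>i\<in>UNIV. [:- int (d i), 1:])"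
    using characteristic_poly_quotient[OF A H d dvd] d k by (simp add: exponents_def)
  also have "\<dots> = (\<Prod>i\<in>UNIV - {k}. [:- int (d i), 1:]) * [:- int (d k), 1:]"
    by (subst prod.remove[of UNIV k]) (simp_all only: finite UNIV_I mult.commute)
  finally show ?thesis by (subst (asm) mult_right_cancel) auto
qed

lemma terao_degree_exponent:
  assumes A: "arrangement \<A>" and H: "H \<in> \<A>" and d: "exponents (\<A> - {H}) d"
    and dvd: "characteristic_poly H (restriction \<A> H) dvd characteristic_poly UNIV \<A>"
  obtains k where "d k = terao_degree \<A> H"
proof -
  let ?e = "terao_degree \<A> H"
  have "poly (characteristic_poly UNIV (\<A> - {H})) (int ?e) = 0"
    unfolding characteristic_poly_quotient[OF A H d dvd] by simp
  then have "poly (\<Prod>i\<in>UNIV. [:- int (d i), 1:]) (int ?e) = 0"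
    using d by (simp add: exponents_def)
  then have "\<exists>i. int ?e = int (d i)" by (auto simp: poly_prod)
  then show ?thesis using that by (metis of_nat_eq_iff)
qed

text \<open>
  Quotients by Terao's polynomial, replaced by their homogeneous components of the correct
  degree. They are fixed by the reduction because Terao's polynomial is not a zero divisor.
\<close>

lemma terao_quotients:
  assumes A: "arrangement \<A>" and H: "H \<in> \<A>" and b: "log_basis (\<A> - {H}) \<theta> d"
  shows "\<exists>g. \<forall>i.
    reduce_mod (normal H) (der_apply (\<theta> i) (linear_form (normal H))) = reduce_mod (normal H) (terao_poly \<A> H) * g i \<and>
    reduce_mod (normal H) (g i) = g i \<and>
    (d i < terao_degree \<A> H \<longrightarrow> g i = 0) \<and>
    (terao_degree \<A> H \<le> d i \<longrightarrow> g i \<in> homogeneous_part (d i - terao_degree \<A> H))"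
proof -
  let ?a = "normal H" and ?e = "terao_degree \<A> H"
  let ?v = "\<lambda>i. reduce_mod ?a (der_apply (\<theta> i) (linear_form ?a))" and ?B = "reduce_mod ?a (terao_poly \<A> H)"
  have a: "?a \<noteq> 0" using normal_neq_0 arrangement_hyperplane[OF A H] by blast
  have hB: "?B \<in> homogeneous_part ?e"
    using reduce_mod_homogeneous terao_poly_homogeneous arrangement_finite[OF A] by blast
  have hv: "?v i \<in> homogeneous_part (d i)" for i
  proof (rule reduce_mod_homogeneous)
    have "const c * \<theta> i $ j \<in> homogeneous_part (d i)" for c j
      using homogeneous_mult[of "const c" 0 "\<theta> i $ j" "d i"] b
        by (simp add: monomial_degree_def log_basis_def)
    then show "der_apply (\<theta> i) (linear_form ?a) \<in> homogeneous_part (d i)"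
      unfolding der_apply_linear_form by (intro homogeneous_sum) simp
  qed
  have "\<exists>p. ?v i = ?B * p" for i
    using terao_poly_dvd[OF A H log_basis_mem[OF b]] by (auto elim: dvdE)
  then obtain p where p: "\<And>i. ?v i = ?B * p i" by metis
  define g where "g i = (if ?e \<le> d i then homogeneous_component (d i - ?e) (p i) else 0)" for i
  have g: "?v i = ?B * g i" for i
  proof -
    have "?v i = homogeneous_component (d i) (?B * p i)"
      using homogeneous_component_homogeneous[OF hv[of i]] p[of i] by simp
    also have "\<dots> = ?B * g i" by (simp add: homogeneous_component_mult_homogeneous[OF hB] g_def)
    finally show ?thesis .
  qed
  have gk: "reduce_mod ?a (g i) = g i" for i
  proof -
    have "?B * reduce_mod ?a (g i) = reduce_mod ?a (?v i)"
      unfolding g reduce_mod_mult reduce_mod_idem[OF a] ..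
    also have "\<dots> = ?v i" by (rule reduce_mod_idem[OF a])
    also have "\<dots> = ?B * g i" by (rule g)
    finally show ?thesis using mpoly_mult_left_cancel[OF reduce_mod_terao_poly_neq_0[OF A H]]
      by blast
  qed
  show ?thesis by (intro exI[of _ g] allI conjI g gk) (auto simp: g_def)
qed

text \<open>
  A combination of the \<open>g\<^sub>i\<close> equals \<open>1\<close>, so some \<open>g\<^sub>k\<close> is a nonzero constant. Subtracting suitable multiples of
  \<open>\<theta>\<^sub>k\<close> from the other basis elements makes them logarithmic along \<open>H\<close>, and \<open>\<theta>\<^sub>k\<close> itself is
  multiplied by the form of \<open>H\<close>, which raises the exponent \<open>d\<^sub>k\<close> by one.
\<close>

theorem addition_step:
  fixes \<A> :: "('k::field ^ 'n::finite) set set"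
  assumes A: "arrangement \<A>" and H: "H \<in> \<A>"
    and b: "log_basis (\<A> - {H}) \<theta> d" and d: "exponents (\<A> - {H}) d"
    and dvd: "characteristic_poly H (restriction \<A> H) dvd characteristic_poly UNIV \<A>"
    and good: "attains_terao_poly \<A> H"
  shows "\<exists>\<theta>' d'. log_basis \<A> \<theta>' d' \<and> exponents \<A> d'"
proof -
  let ?a = "normal H" and ?e = "terao_degree \<A> H"
  let ?al = "linear_form ?a"
  let ?v = "\<lambda>\<theta>. reduce_mod ?a (der_apply \<theta> ?al)" and ?B = "reduce_mod ?a (terao_poly \<A> H)"
  have hH: "hyperplane H" using arrangement_hyperplane[OF A H] .
  have a: "?a \<noteq> 0" using normal_neq_0[OF hH] .
  have B0: "?B \<noteq> 0" by (rule reduce_mod_terao_poly_neq_0[OF A H])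
  obtain g where g: "\<And>i. ?v (\<theta> i) = ?B * g i" and gk: "\<And>i. reduce_mod ?a (g i) = g i"
    and g0: "\<And>i. d i < ?e \<Longrightarrow> g i = 0" and gh: "\<And>i. ?e \<le> d i \<Longrightarrow> g i \<in> homogeneous_part (d i - ?e)"
    using terao_quotients[OF A H b] by metis
  have vsum: "?v (\<Sum>i\<in>UNIV. f i *s \<theta> i) = ?B * (\<Sum>i\<in>UNIV. reduce_mod ?a (f i) * g i)" for f
    unfolding der_apply_sum der_apply_scale reduce_mod_sum reduce_mod_mult g sum_distrib_left
      by (intro sum.cong) (simp_all add: ac_simps)
  obtain k where k: "d k = ?e" "g k \<noteq> 0"
  proof -
    obtain \<eta> where \<eta>: "\<eta> \<in> log_derivations (\<A> - {H})" "?v \<eta> = ?B" using good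
      by (auto simp: attains_terao_poly_def)
    then obtain f where f: "\<eta> = (\<Sum>i\<in>UNIV. f i *s \<theta> i)" using b by (auto simp: log_basis_def)
    have "?B * (\<Sum>i\<in>UNIV. reduce_mod ?a (f i) * g i) = ?B * 1" using \<eta>(2) vsum[of f] f by simp
    then have "(\<Sum>i\<in>UNIV. reduce_mod ?a (f i) * g i) = 1" using mpoly_mult_left_cancel[OF B0]
      by blast
    then have "homogeneous_component 0 (\<Sum>i\<in>UNIV. g i * reduce_mod ?a (f i)) =
        homogeneous_component 0 1" by (simp add: mult.commute)
    also have "\<dots> \<noteq> (0 :: ('k, 'n) mpoly)"
      using homogeneous_component_single[of 0 "0 :: 'n \<Rightarrow>\<^sub>0 nat" "1::'k"]
        by (simp add: monomial_degree_def)
    finally have ne: "(\<Sum>i\<in>UNIV. homogeneous_component 0 (g i * reduce_mod ?a (f i))) \<noteq> 0"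
      unfolding homogeneous_component_sum .
    have "\<exists>i. homogeneous_component 0 (g i * reduce_mod ?a (f i)) \<noteq> 0"
    proof (rule ccontr)
      assume "\<nexists>i. homogeneous_component 0 (g i * reduce_mod ?a (f i)) \<noteq> 0"
      then have "(\<Sum>i\<in>UNIV. homogeneous_component 0 (g i * reduce_mod ?a (f i))) = 0"
        by (intro sum.neutral) blast
      then show False using ne by blast
    qed
    then obtain i where i: "homogeneous_component 0 (g i * reduce_mod ?a (f i)) \<noteq> 0" by auto
    then have gi: "g i \<noteq> 0" by (rule contrapos_nn) simp
    have le: "?e \<le> d i" using g0[of i] gi by (meson not_le)
    have "d i - ?e \<le> 0" using i homogeneous_component_mult_homogeneous[OF gh[OF le], of 0]
      by (auto split: if_splits)
    then show ?thesis using that[of i] le gi by simp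
  qed
  have "g k \<in> homogeneous_part 0" using gh[of k] k by simp
  then obtain c where c: "g k = const c" using homogeneous_0_const by blast
  have "c \<noteq> 0" using k c by auto
  \<comment> \<open>Setting \<open>h k = 0\<close> lets one formula cover the scaled element and the corrected ones.\<close>
  define h where "h i = (if i = k then 0 else const (1 / c) * g i)" for i
  define m where "m i = (if i = k then ?al else 1)" for i
  define \<theta>' where "\<theta>' i = m i *s \<theta> i - h i *s \<theta> k" for i
  define d' where "d' = d(k := Suc (d k))"
  have comb: "(\<Sum>i\<in>UNIV. f i *s \<theta>' i) = (\<Sum>i\<in>UNIV. (f i * m i - (if i =
      k then \<Sum>j\<in>UNIV. f j * h j else 0)) *s \<theta> i)" for f
  proof -
    have "(\<Sum>i\<in>UNIV. f i *s \<theta>' i) = (\<Sum>i\<in>UNIV. (f i * m i) *s \<theta> i) - (\<Sum>j\<in>UNIV. f j * h j) *s \<theta> k"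
      unfolding \<theta>'_def der.scale_right_diff_distrib sum_subtractf der.scale_scale der.scale_sum_left ..
    also have "(\<Sum>j\<in>UNIV. f j * h j) *s \<theta> k = (\<Sum>i\<in>UNIV. (if i =
        k then \<Sum>j\<in>UNIV. f j * h j else 0) *s \<theta> i)"
      by (rule sum_delta_scale[symmetric])
    finally show ?thesis unfolding der.scale_left_diff_distrib sum_subtractf .
  qed
  have mem: "\<theta>' i \<in> log_derivations \<A>" for i
    unfolding log_derivations_delete[OF hH H]
  proof
    show "\<theta>' i \<in> log_derivations (\<A> - {H})"
      unfolding \<theta>'_def by (intro log_derivations_diff log_derivations_scale log_basis_mem[OF b])
    have "?v (\<theta>' i) = reduce_mod ?a (m i) * (?B * g i) - reduce_mod ?a (h i) * (?B * g k)"
      unfolding \<theta>'_def der_apply_diff der_apply_scale reduce_mod_diff reduce_mod_mult g ..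
    also have "\<dots> = 0"
    proof (cases "i = k")
      case True
      then show ?thesis using reduce_mod_self[OF a] by (simp add: m_def h_def)
    next
      case False
      have "const (1 / c) * g i * (?B * const c) = (const (1 / c) * const c) * (?B * g i)"
        by (simp only: ac_simps)
      also have "\<dots> = ?B * g i" using \<open>c \<noteq> 0\<close> by (simp flip: const_mult)
      finally show ?thesis using False by (simp add: m_def h_def reduce_mod_mult gk c)
    qed
    finally show "?v (\<theta>' i) = 0" .
  qed
  have "log_basis \<A> \<theta>' d'"
    unfolding log_basis_def
  proof (intro conjI allI impI)
    fix i j
    have \<theta>h: "\<theta> i $ j \<in> homogeneous_part (d i)" for i j using b by (simp add: log_basis_def)
    show "\<theta>' i $ j \<in> homogeneous_part (d' i)"
    proof (cases "i = k")
      case True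
      then show ?thesis
        using homogeneous_mult[OF homogeneous_linear_form[of ?a] \<theta>h[of k j]]
          by (simp add: \<theta>'_def m_def h_def d'_def)
    next
      case False
      have "h i * \<theta> k $ j \<in> homogeneous_part (d i)"
      proof (cases "?e \<le> d i")
        case True
        have "h i \<in> homogeneous_part (d i - ?e)"
          using homogeneous_mult[of "const (1 / c)" 0, OF _ gh[OF True]] False
            by (simp add: h_def monomial_degree_def)
        from homogeneous_mult[OF this \<theta>h[of k j]] show ?thesis using True k by simp
      next
        case False
        then show ?thesis using g0[of i] by (simp add: h_def)
      qed
      then show ?thesis using False \<theta>h[of i j] by (simp add: \<theta>'_def m_def d'_def homogeneous_diff)
    qed
  next
    have ind: "F i = 0" if "(\<Sum>i\<in>UNIV. F i *s \<theta> i) = 0" for F i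
      using b that by (simp add: log_basis_def)
    fix f i assume asm: "(\<Sum>i\<in>UNIV. f i *s \<theta>' i) = 0"
    have z: "f i * m i - (if i = k then \<Sum>j\<in>UNIV. f j * h j else 0) = 0" for i
      using ind[OF asm[unfolded comb], of i] .
    have f0: "f i = 0" if "i \<noteq> k" for i using z[of i] that by (simp add: m_def)
    then have "(\<Sum>j\<in>UNIV. f j * h j) = 0" by (intro sum.neutral) (auto simp: h_def)
    then have "f k * ?al = 0" using z[of k] by (simp add: m_def)
    then have "f k = 0" using a by simp
    then show "f i = 0" using f0 by (cases "i = k") auto
  next
    show "log_derivations \<A> = range (\<lambda>f. \<Sum>i\<in>UNIV. f i *s \<theta>' i)"
    proof (intro equalityI subsetI)
      fix \<eta> assume "\<eta> \<in> range (\<lambda>f. \<Sum>i\<in>UNIV. f i *s \<theta>' i)"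
      then show "\<eta> \<in> log_derivations \<A>"
        by (auto intro!: log_derivations_sum log_derivations_scale mem)
    next
      fix \<eta> assume \<eta>: "\<eta> \<in> log_derivations \<A>"
      then have "\<eta> \<in> log_derivations (\<A> - {H})" and v0: "?v \<eta> = 0"
        unfolding log_derivations_delete[OF hH H] by blast+
      then obtain F where F: "\<eta> = (\<Sum>i\<in>UNIV. F i *s \<theta> i)" using b by (auto simp: log_basis_def)
      define s where "s = (\<Sum>j\<in>UNIV. F j * h j)"
      have "?B * (\<Sum>i\<in>UNIV. reduce_mod ?a (F i) * g i) = ?B * 0" using v0 vsum[of F] F by simp
      then have z: "(\<Sum>i\<in>UNIV. reduce_mod ?a (F i) * g i) = 0" using mpoly_mult_left_cancel[OF B0]
        by blast
      have ch: "const c * reduce_mod ?a (h i) = (if i = k then 0 else g i)" for i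
        using \<open>c \<noteq> 0\<close> gk[of i]
          by (simp add: h_def reduce_mod_mult mult.assoc[symmetric] flip: const_mult)
      have "const c * reduce_mod ?a (F k + s) =
          reduce_mod ?a (F k) * g k + (\<Sum>j\<in>UNIV. reduce_mod ?a (F j) * (const c * reduce_mod ?a (h j)))"
        unfolding s_def reduce_mod_add reduce_mod_sum reduce_mod_mult distrib_left sum_distrib_left c by (simp add: ac_simps)
      also have "\<dots> = (\<Sum>i\<in>UNIV. reduce_mod ?a (F i) * g i)"
        unfolding ch by (subst (1 2) sum.remove[of UNIV k]) (auto intro!: sum.cong)
      finally have "const c * reduce_mod ?a (F k + s) = 0" using z by simp
      then have "reduce_mod ?a (F k + s) = 0" using c k by auto
      then obtain F' where F': "F k + s = ?al * F'" unfolding reduce_mod_eq_0_iff[OF a]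
        by (rule dvdE)
      define f where "f = F(k := F')"
      have fs: "(\<Sum>j\<in>UNIV. f j * h j) = s" unfolding s_def
        by (intro sum.cong) (auto simp: f_def h_def)
      have "f i * m i - (if i = k then \<Sum>j\<in>UNIV. f j * h j else 0) = F i" for i
        unfolding fs using F' by (auto simp: f_def m_def algebra_simps)
      then have "\<eta> = (\<Sum>i\<in>UNIV. f i *s \<theta>' i)" unfolding comb F by presburger
      then show "\<eta> \<in> range (\<lambda>f. \<Sum>i\<in>UNIV. f i *s \<theta>' i)" by (rule range_eqI[where x = f])
    qed
  qed
  moreover have "exponents \<A> d'"
  proof -
    let ?q = "\<Prod>i\<in>UNIV - {k}. [:- int (d i), 1:]"
    have "characteristic_poly UNIV \<A> = ?q * [:- int ?e, 1:] - ?q"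
      unfolding deletion_restriction[OF A H] characteristic_poly_quotient[OF A H d dvd]
        exponents_restriction[OF A H d dvd k(1)] ..
    also have "\<dots> = ?q * ([:- int ?e, 1:] - 1)" by (simp only: right_diff_distrib mult_1_right)
    also have "[:- int ?e, 1:] - 1 = [:- int (d' k), 1:]" using k by (simp add: d'_def one_pCons)
    also have "?q = (\<Prod>i\<in>UNIV - {k}. [:- int (d' i), 1:])" by (intro prod.cong) (auto simp: d'_def)
    also have "(\<Prod>i\<in>UNIV - {k}. [:- int (d' i), 1:]) * [:- int (d' k), 1:] =
        (\<Prod>i\<in>UNIV. [:- int (d' i), 1:])"
      using prod.remove[of UNIV k "\<lambda>i. [:- int (d' i), 1:]"]
        by (simp only: finite UNIV_I mult.commute simp_thms True_implies_equals)
    finally show ?thesis by (simp add: exponents_def)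
  qed
  ultimately show ?thesis by blast
qed

section \<open>Attaining Terao's polynomial\<close>

lemma card_zero_exponents:
  fixes d :: "'i \<Rightarrow> nat"
  assumes "finite I" "monom 1 c dvd (\<Prod>i\<in>I. [:- int (d i), 1:])"
  shows "c \<le> card {i \<in> I. d i = 0}"
proof (rule ccontr)
  let ?Z = "{i \<in> I. d i = 0}" and ?R = "\<Prod>i\<in>I - {i \<in> I. d i = 0}. [:- int (d i), 1:]"
  assume "\<not> c \<le> card ?Z"
  then have lt: "card ?Z < c" by simp
  have "(\<Prod>i\<in>I. [:- int (d i), 1:]) = ?R * (\<Prod>i\<in>?Z. [:- int (d i), 1:])"
    using assms(1) by (intro prod.subset_diff) auto
  also have "(\<Prod>i\<in>?Z. [:- int (d i), 1:]) = (\<Prod>i\<in>?Z. monom 1 1)"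
    by (intro prod.cong) (auto simp: monom_altdef)
  also have "\<dots> = monom (1::int) (card ?Z)" by (simp add: monom_power)
  finally have "monom 1 c dvd monom 1 (card ?Z) * ?R" using assms(2) by (simp only: mult.commute)
  moreover have "monom (1::int) c = monom 1 (card ?Z) * monom 1 (c - card ?Z)" using lt
    by (simp add: mult_monom)
  ultimately have "monom 1 (c - card ?Z) dvd ?R" by simp
  then obtain q where "?R = monom 1 (c - card ?Z) * q" by (rule dvdE)
  then have "poly ?R 0 = 0" using lt by (simp add: poly_monom power_0_left)
  then show False using assms(1) by (auto simp: poly_prod)
qed

lemma card_le_dim:
  fixes v :: "'i \<Rightarrow> 'k::field ^ 'n::finite"
  assumes "finite Z" "v ` Z \<subseteq> T"
    and ind: "\<And>c i. (\<Sum>i\<in>Z. c i *s v i) = 0 \<Longrightarrow> i \<in> Z \<Longrightarrow> c i = 0"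
  shows "card Z \<le> vec.dim T"
proof -
  have inj: "inj_on v Z"
  proof (rule inj_onI, rule ccontr)
    fix i j assume ij: "i \<in> Z" "j \<in> Z" "v i = v j" "i \<noteq> j"
    let ?c = "\<lambda>l. (if l = i then 1 else 0) - (if l = j then 1 else 0 :: 'k)"
    have *: "(\<Sum>l\<in>Z. (if l = i then 1 else 0 :: 'k) *s v l) = v i" if "i \<in> Z" for i
    proof -
      have "(\<Sum>l\<in>Z. (if l = i then 1 else 0 :: 'k) *s v l) = (\<Sum>l\<in>Z. if l = i then v i else 0)"
        by (intro sum.cong) auto
      also have "\<dots> = v i" using that assms(1) by (subst sum.delta) auto
      finally show ?thesis .
    qed
    have "(\<Sum>l\<in>Z. ?c l *s v l) = 0"
      unfolding vec.scale_left_diff_distrib sum_subtractf *[OF ij(1)] *[OF ij(2)] using ij by simp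
    from ind[OF this ij(1)] ij(4) show False by simp
  qed
  have "vec.independent (v ` Z)"
  proof
    assume "vec.dependent (v ` Z)"
    then obtain u where u: "\<exists>x\<in>v ` Z. u x \<noteq> 0" "(\<Sum>x\<in>v ` Z. u x *s x) = 0"
      using assms(1) by (subst (asm) vec.dependent_finite) auto
    have "(\<Sum>i\<in>Z. u (v i) *s v i) = 0" using u(2) by (simp add: sum.reindex[OF inj])
    from ind[OF this] u(1) show False by blast
  qed
  then have "card (v ` Z) \<le> vec.dim T" by (rule vec.independent_card_le_dim[OF assms(2)])
  then show ?thesis by (simp add: card_image[OF inj])
qed

lemma const_sum: "const (\<Sum>i\<in>I. f i) = (\<Sum>i\<in>I. const (f i))"
  by (induction I rule: infinite_finite_induct) (auto simp: single_add)

text \<open>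
  A constant logarithmic derivation is a vector that every defining form annihilates, that is, a vector
  of the intersection of all hyperplanes.
\<close>

lemma card_constant_derivations:
  fixes \<theta> :: "'n::finite \<Rightarrow> ('k::field, 'n) derivation"
  assumes A: "arrangement \<A>" and mem: "\<And>i. i \<in> Z \<Longrightarrow> \<theta> i \<in> log_derivations \<A>"
    and hom: "\<And>i j. i \<in> Z \<Longrightarrow> \<theta> i $ j \<in> homogeneous_part 0"
    and ind: "\<And>f i. (\<Sum>i\<in>UNIV. f i *s \<theta> i) = 0 \<Longrightarrow> f i = 0"
  shows "card Z \<le> vec.dim (\<Inter> \<A>)"
proof -
  define v where "v i = (\<chi> j. Poly_Mapping.lookup (\<theta> i $ j) 0)" for i
  have v: "\<theta> i $ j = const (v i $ j)" if "i \<in> Z" for i j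
    using homogeneous_0_const[OF hom[OF that]] by (simp add: v_def)
  show ?thesis
  proof (rule card_le_dim)
    show "finite Z" by simp
    show "v ` Z \<subseteq> \<Inter> \<A>"
    proof safe
      fix i L assume i: "i \<in> Z" and L: "L \<in> \<A>"
      have hL: "hyperplane L" using A L by (rule arrangement_hyperplane)
      have "der_apply (\<theta> i) (linear_form (normal L)) = const (dot (normal L) (v i))"
        unfolding der_apply_linear_form v[OF i]
          by (simp only: const_mult[symmetric] dot_def) (simp add: const_sum)
      then have "linear_form (normal L) dvd const (dot (normal L) (v i))"
        using mem[OF i] L unfolding log_derivations_iff by metis
      then have "dot (normal L) (v i) = 0" using linear_form_dvd_const[OF normal_neq_0[OF hL]]
        by blast
      then show "v i \<in> L" using hL by (simp add: dot_normal_iff)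
    qed
    fix c i assume c: "(\<Sum>i\<in>Z. c i *s v i) = 0" and i: "i \<in> Z"
    let ?f = "\<lambda>i. if i \<in> Z then const (c i) else (0 :: ('k, 'n) mpoly)"
    have "(\<Sum>i\<in>UNIV. ?f i *s \<theta> i) = 0"
    proof (subst vec_eq_iff, rule allI)
      fix j
      have "(\<Sum>i\<in>UNIV. ?f i *s \<theta> i) $ j = (\<Sum>i\<in>UNIV. if i \<in> Z then const (c i) * \<theta> i $ j else 0)"
        by (simp add: if_distrib[of "\<lambda>x. x * _"] cong: if_cong)
      also have "\<dots> = (\<Sum>i\<in>Z. const (c i) * \<theta> i $ j)" by (subst sum.inter_restrict[symmetric]) auto
      also have "\<dots> = (\<Sum>i\<in>Z. const (c i * v i $ j))" by (intro sum.cong) (simp_all add: v const_mult)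
      also have "\<dots> = const ((\<Sum>i\<in>Z. c i *s v i) $ j)" by (simp add: const_sum)
      finally show "(\<Sum>i\<in>UNIV. ?f i *s \<theta> i) $ j = 0 $ j" using c by simp
    qed
    from ind[OF this, of i] i have "const (c i) = (0 :: ('k, 'n) mpoly)" by simp
    then show "c i = 0" by (metis lookup_single_eq lookup_zero)
  qed
qed

lemma chosen_lifts_localization:
  assumes "X \<subseteq> H"
  shows "chosen_lifts (localization \<A> X) H = chosen_lifts \<A> H \<inter> localization \<A> X"
proof -
  let ?B = "localization \<A> X"
  have R: "Y \<in> restriction ?B H \<longleftrightarrow> Y \<in> restriction \<A> H \<and> X \<subseteq> Y" for Y
    using assms by (auto simp: restriction_def localization_def)
  have eq: "chosen_lift ?B H Y = chosen_lift \<A> H Y" if "X \<subseteq> Y" for Y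
  proof -
    have "(L \<in> ?B - {H} \<and> L \<inter> H = Y) = (L \<in> \<A> - {H} \<and> L \<inter> H = Y)" for L
      using that by (auto simp: localization_def)
    then show ?thesis unfolding chosen_lift_def by (simp only:)
  qed
  have loc: "X \<subseteq> Y \<longleftrightarrow> chosen_lift \<A> H Y \<in> ?B" if "Y \<in> restriction \<A> H" for Y
    using chosen_lift[OF that] assms by (auto simp: localization_def)
  show ?thesis
  proof (intro equalityI subsetI)
    fix L assume "L \<in> chosen_lifts ?B H"
    then obtain Y where Y: "Y \<in> restriction ?B H" "L = chosen_lift ?B H Y"
      by (auto simp: chosen_lifts_def)
    then show "L \<in> chosen_lifts \<A> H \<inter> ?B" using R[of Y] eq[of Y] loc[of Y]
      by (auto simp: chosen_lifts_def)
  next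
    fix L assume L: "L \<in> chosen_lifts \<A> H \<inter> ?B"
    then obtain Y where Y: "Y \<in> restriction \<A> H" "L = chosen_lift \<A> H Y"
      by (auto simp: chosen_lifts_def)
    then have "X \<subseteq> Y" using loc[OF Y(1)] L by simp
    then have "Y \<in> restriction ?B H" "L = chosen_lift ?B H Y" using R Y eq by auto
    then show "L \<in> chosen_lifts ?B H" unfolding chosen_lifts_def by (intro image_eqI)
  qed
qed

text \<open>
  Terao's polynomials of \<open>\<A>\<close> and of a localization differ
    by known products of linear forms, because both are
  built from the same choices.
\<close>

lemma terao_poly_localization:
  assumes "X \<subseteq> H" "finite \<A>" "H \<in> \<A>"
  shows "terao_poly (localization \<A> X) H * (\<Prod>L\<in>\<A> - localization \<A> X. linear_form (normal L)) =
    terao_poly \<A> H * (\<Prod>L\<in>chosen_lifts \<A> H - localization \<A> X. linear_form (normal L))"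
proof -
  let ?B = "localization \<A> X" and ?f = "\<lambda>L. linear_form (normal L)"
  have R: "chosen_lifts \<A> H \<subseteq> \<A> - {H}" by (rule chosen_lifts_subset)
  have B: "?B \<subseteq> \<A>" "H \<in> ?B" using assms by (auto simp: localization_def)
  have fin: "finite ?B" "finite (chosen_lifts \<A> H)" using B(1) R assms(2)
    by (auto intro: finite_subset)
  have "(\<Prod>L\<in>?B - {H} - chosen_lifts ?B H. ?f L) * (\<Prod>L\<in>\<A> - ?B. ?f L) =
      (\<Prod>L\<in>(?B - {H} - chosen_lifts ?B H) \<union> (\<A> - ?B). ?f L)"
    by (rule prod.union_disjoint[symmetric]) (use assms(2) fin in auto)
  also have "(?B - {H} - chosen_lifts ?B H) \<union> (\<A> - ?B) =
      (\<A> - {H} - chosen_lifts \<A> H) \<union> (chosen_lifts \<A> H - ?B)"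
    unfolding chosen_lifts_localization[OF assms(1)] using R B by blast
  also have "(\<Prod>L\<in>(\<A> - {H} - chosen_lifts \<A> H) \<union> (chosen_lifts \<A> H - ?B). ?f L) =
      (\<Prod>L\<in>\<A> - {H} - chosen_lifts \<A> H. ?f L) * (\<Prod>L\<in>chosen_lifts \<A> H - ?B. ?f L)"
    by (rule prod.union_disjoint) (use assms(2) fin in auto)
  finally show ?thesis unfolding terao_poly_def .
qed

text \<open>
  If some power of \<open>x\<close> lies in each of the ideals generated
    by \<open>S\<close> and one \<open>p L\<close>, then a power of \<open>x\<close> lies in the
  ideal generated by \<open>S\<close> and the product of all \<open>p L\<close>: multiply the powers.
\<close>

lemma power_minus_product_in_span:
  fixes x :: "('k::field, 'n::finite) mpoly"
  assumes "finite D" "\<And>L. L \<in> D \<Longrightarrow> \<exists>N. x ^ N \<in> ideal.span (insert (p L) S)"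
  shows "\<exists>N u. x ^ N - u * (\<Prod>L\<in>D. p L) \<in> ideal.span S"
  using assms
proof (induction D rule: finite_induct)
  case empty
  have "x ^ 0 - 1 * (\<Prod>L\<in>{}. p L) = 0" by simp
  then show ?case using ideal.span_zero by metis
next
  case (insert L D)
  then obtain N u where N: "x ^ N - u * (\<Prod>L\<in>D. p L) \<in> ideal.span S" by blast
  obtain M where "x ^ M \<in> ideal.span (insert (p L) S)" using insert.prems by blast
  then obtain k where k: "x ^ M - k * p L \<in> ideal.span S" using ideal.span_breakdown_eq by blast
  let ?P = "\<Prod>L\<in>D. p L"
  have "x ^ M * (x ^ N - u * ?P) + (u * ?P) * (x ^ M - k * p L) \<in> ideal.span S"
    by (intro ideal.span_add ideal.span_scale N k)
  also have "x ^ M * (x ^ N - u * ?P) + (u * ?P) * (x ^ M - k * p L) =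
      x ^ (M + N) - (u * k) * (\<Prod>L\<in>insert L D. p L)"
    unfolding prod.insert[OF insert.hyps] power_add by (simp add: algebra_simps)
  finally show ?case by blast
qed

lemma linear_form_in_span:
  assumes "a \<in> vec.span V"
  shows "linear_form a \<in> ideal.span (linear_form ` V)"
proof -
  have "vec.span V \<subseteq> {a. linear_form a \<in> ideal.span (linear_form ` V)}"
  proof (rule vec.span_minimal)
    show "vec.subspace {a. linear_form a \<in> ideal.span (linear_form ` V)}"
      unfolding vec.subspace_def
      by (auto simp: linear_form_add linear_form_scale linear_form_eq_0[THEN iffD2, OF refl] ideal.span_zero
          intro: ideal.span_add ideal.span_scale)
  qed (auto intro: ideal.span_base)
  then show ?thesis using assms by auto
qed

text \<open>
  Downward induction on \<open>C\<close> replaces an argument with prime ideals. If \<open>C\<close> cuts out the centre, then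
  its forms and those of \<open>W\<close> span all linear forms. Otherwise the product of the remaining forms lies in
  the ideal, while the induction hypothesis applies after adding any one of these forms to \<open>C\<close>.
\<close>

lemma power_in_span:
  assumes A: "arrangement \<A>"
    and W: "\<And>v. v \<in> \<Inter> \<A> \<Longrightarrow> (\<And>w. w \<in> W \<Longrightarrow> dot w v = 0) \<Longrightarrow> v = 0" "linear_form ` W \<subseteq> S"
    and prod: "\<And>C. H \<in> C \<Longrightarrow> C \<subseteq> \<A> \<Longrightarrow> \<Inter> C \<noteq> \<Inter> \<A> \<Longrightarrow> (\<Prod>L\<in>\<A> - C. linear_form (normal L)) \<in> ideal.span S"
    and C: "H \<in> C" "C \<subseteq> \<A>"
  shows "\<exists>N. linear_form b ^ N \<in> ideal.span (S \<union> (\<lambda>L. linear_form (normal L)) ` C)"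
  using C
proof (induction "card (\<A> - C)" arbitrary: C rule: less_induct)
  case less
  let ?f = "\<lambda>L. linear_form (normal L)"
  have fin: "finite \<A>" using A by (rule arrangement_finite)
  show ?case
  proof (cases "\<Inter> C = \<Inter> \<A>")
    case True
    have "b \<in> vec.span (normal ` C \<union> W)"
    proof (rule double_annihilator)
      fix v assume v: "\<And>g. g \<in> normal ` C \<union> W \<Longrightarrow> dot g v = 0"
      have "v \<in> L" if "L \<in> C" for L
        using v[of "normal L"] that less.prems(2) arrangement_hyperplane[OF A] dot_normal_iff[of L v] by blast
      then have "v \<in> \<Inter> \<A>" using True by blast
      then have "v = 0" by (rule W(1)) (use v in blast)
      then show "dot b v = 0" by simp
    qed
    then have "linear_form b \<in> ideal.span (linear_form ` (normal ` C \<union> W))"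
      by (rule linear_form_in_span)
    moreover have "linear_form ` (normal ` C \<union> W) \<subseteq> S \<union> ?f ` C" using W(2) by auto
    ultimately have "linear_form b \<in> ideal.span (S \<union> ?f ` C)" using ideal.span_mono by blast
    then show ?thesis by (intro exI[of _ 1]) simp
  next
    case False
    have "\<exists>N. linear_form b ^ N \<in> ideal.span (insert (?f L) (S \<union> ?f ` C))" if L: "L \<in> \<A> - C" for L
    proof -
      have "\<A> - insert L C \<subset> \<A> - C" using L by auto
      then have "card (\<A> - insert L C) < card (\<A> - C)" using fin by (intro psubset_card_mono) auto
      moreover have "H \<in> insert L C" "insert L C \<subseteq> \<A>" using L less.prems by auto
      ultimately have "\<exists>N. linear_form b ^ N \<in> ideal.span (S \<union> ?f ` insert L C)" by (rule less.hyps)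
      then show ?thesis by simp
    qed
    then obtain N u where N: "linear_form b ^ N - u * (\<Prod>L\<in>\<A> - C. ?f L) \<in> ideal.span (S \<union> ?f ` C)"
      using power_minus_product_in_span[of "\<A> - C" "linear_form b" ?f "S \<union> ?f ` C"] fin by blast
    have "(\<Prod>L\<in>\<A> - C. ?f L) \<in> ideal.span (S \<union> ?f ` C)"
      using prod[OF less.prems False] ideal.span_mono[of S "S \<union> ?f ` C"] by blast
    then have "linear_form b ^ N - u * (\<Prod>L\<in>\<A> - C. ?f L) + u * (\<Prod>L\<in>\<A> - C. ?f L) \<in>
        ideal.span (S \<union> ?f ` C)"
      by (intro ideal.span_add N ideal.span_scale)
    then show ?thesis by (intro exI[of _ N]) simp
  qed
qed

lemma power_in_span_mono:
  fixes x :: "('k::field, 'n::finite) mpoly"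
  assumes "x ^ N \<in> ideal.span S" "N \<le> M"
  shows "x ^ M \<in> ideal.span S"
proof -
  have "x ^ M = x ^ (M - N) * x ^ N" using assms(2) by (simp flip: power_add)
  then show ?thesis using ideal.span_scale[OF assms(1)] by metis
qed

text \<open>
  The count of generators: the ideal that consists of all \<open>p\<close> such that \<open>p\<close> times Terao's
  polynomial is attained modulo the form of \<open>H\<close>, enlarged
    by forms that cut the centre down to zero, contains a
  power of every variable. If Terao's polynomial itself were not attained, that ideal would have fewer
  generators than there are variables.
\<close>

theorem attains_terao_poly_step:
  fixes \<A> :: "('k::field ^ 'n::finite) set set"
  assumes A: "arrangement \<A>" and H: "H \<in> \<A>"
    and b: "log_basis (\<A> - {H}) \<theta> d" and d: "exponents (\<A> - {H}) d"
    and dvd: "characteristic_poly H (restriction \<A> H) dvd characteristic_poly UNIV \<A>"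
    and loc: "\<And>C. H \<in> C \<Longrightarrow> C \<subseteq> \<A> \<Longrightarrow> \<Inter> C \<noteq> \<Inter> \<A> \<Longrightarrow> attains_terao_poly (localization \<A> (\<Inter> C)) H"
  shows "attains_terao_poly \<A> H"
proof (rule ccontr)
  assume bad: "\<not> attains_terao_poly \<A> H"
  let ?a = "normal H" and ?e = "terao_degree \<A> H" and ?T = "\<Inter> \<A>"
  let ?al = "linear_form ?a" and ?f = "\<lambda>L. linear_form (normal L)"
  let ?v = "\<lambda>\<theta>. reduce_mod ?a (der_apply \<theta> ?al)" and ?B = "reduce_mod ?a (terao_poly \<A> H)"
  have fin: "finite \<A>" using A by (rule arrangement_finite)
  have hyp: "hyperplane L" if "L \<in> \<A>" for L using A that by (rule arrangement_hyperplane)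
  have hH: "hyperplane H" using hyp[OF H] .
  have a: "?a \<noteq> 0" using normal_neq_0[OF hH] .
  have B0: "?B \<noteq> 0" by (rule reduce_mod_terao_poly_neq_0[OF A H])
  obtain g where g: "\<And>i. ?v (\<theta> i) = ?B * g i" and gk: "\<And>i. reduce_mod ?a (g i) = g i"
    and g0: "\<And>i. d i < ?e \<Longrightarrow> g i = 0" and gh: "\<And>i. ?e \<le> d i \<Longrightarrow> g i \<in> homogeneous_part (d i - ?e)"
    using terao_quotients[OF A H b] by metis
  have gz: "g i = 0" if "d i \<le> ?e" for i
  proof (cases "d i = ?e")
    case True
    then have "g i \<in> homogeneous_part 0" using gh[of i] by simp
    then obtain c where c: "g i = const c" using homogeneous_0_const by blast
    have "c = 0"
    proof (rule ccontr)
      assume "c \<noteq> 0"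
      have "?v (const (1 / c) *s \<theta> i) = const (1 / c) * (?B * const c)"
        unfolding der_apply_scale reduce_mod_mult g c by simp
      also have "\<dots> = (const (1 / c) * const c) * ?B" by (simp only: ac_simps)
      also have "\<dots> = ?B" using \<open>c \<noteq> 0\<close> by (simp flip: const_mult)
      finally have "attains_terao_poly \<A> H"
        unfolding attains_terao_poly_def using log_derivations_scale[OF log_basis_mem[OF b]]
          by blast
      then show False using bad by blast
    qed
    then show ?thesis using c by simp
  next
    case False
    then show ?thesis using that g0[of i] by simp
  qed
  obtain k where k: "d k = ?e" by (rule terao_degree_exponent[OF A H d dvd])
  define q where "q = characteristic_poly H (restriction \<A> H)"
  have q: "q = (\<Prod>i\<in>UNIV - {k}. [:- int (d i), 1:])"
    unfolding q_def by (rule exponents_restriction[OF A H d dvd k])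
  let ?c = "vec.dim ?T"
  have "monom 1 ?c dvd q"
    unfolding q_def
  proof (rule monom_dvd_characteristic_poly)
    fix X assume "X \<in> flats H (restriction \<A> H)"
    then obtain D where "D \<subseteq> \<A> - {H}" "X = \<Inter> (insert H D)" by (rule flats_restriction)
    then show "?c \<le> vec.dim X" using H by (intro vec.dim_subset) auto
  qed
  then have zeros: "?c \<le> card {i \<in> UNIV - {k}. d i = 0}"
    unfolding q by (intro card_zero_exponents) auto
  have in_A: "\<theta> i \<in> log_derivations \<A>" if "d i \<le> ?e" for i
    unfolding log_derivations_delete[OF hH H] using log_basis_mem[OF b] g[of i] gz[OF that] by simp
  \<comment> \<open>These are \<open>k\<close>, the zero exponents of the restriction, and one exponent equal to \<open>1\<close>.\<close>
  have low: "?c + 2 \<le> card {i. d i \<le> ?e}"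
  proof (cases "?e = 0")
    case True
    have "card (insert k {i \<in> UNIV - {k}. d i = 0}) \<le> ?c"
    proof (rule card_constant_derivations[OF A])
      show "\<theta> i \<in> log_derivations \<A>" if "i \<in> insert k {i \<in> UNIV - {k}. d i = 0}" for i
        using that k True by (intro in_A) auto
      show "\<theta> i $ j \<in> homogeneous_part 0" if "i \<in> insert k {i \<in> UNIV - {k}. d i = 0}" for i j
      proof -
        have "d i = 0" using that k True by auto
        then show ?thesis using b unfolding log_basis_def by metis
      qed
      show "f i = 0" if "(\<Sum>i\<in>UNIV. f i *s \<theta> i) = 0" for f i
        using b that by (simp add: log_basis_def)
    qed
    then show ?thesis using zeros by simp
  next
    case False
    then have "card (\<A> - {H}) \<noteq> 0" by simp
    then have ne: "\<A> - {H} \<noteq> {}" by (metis card.empty)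
    have "poly q 1 = 0"
      unfolding q_def restriction_def
    proof (rule characteristic_poly_root_1[OF _ ne])
      fix L assume "L \<in> \<A> - {H}"
      then show "\<not> H \<subseteq> L \<inter> H" using hyperplane_subset_eq[OF hH hyp[of L]] by auto
    qed (use fin in simp)
    then have "\<exists>i\<in>UNIV - {k}. d i = 1" unfolding q by (auto simp: poly_prod)
    then obtain l where l: "l \<noteq> k" "d l = 1" by auto
    have "insert k (insert l {i \<in> UNIV - {k}. d i = 0}) \<subseteq> {i. d i \<le> ?e}" using k l False by auto
    then have "card (insert k (insert l {i \<in> UNIV - {k}. d i = 0})) \<le> card {i. d i \<le> ?e}"
      by (intro card_mono) auto
    then show ?thesis using zeros l by simp
  qed
  obtain W where W: "finite W" "card W \<le> ?c" "\<And>v. v \<in> ?T \<Longrightarrow> (\<And>w. w \<in> W \<Longrightarrow> dot w v = 0) \<Longrightarrow> v = 0"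
  proof (rule complementary_forms[of ?T])
    show "vec.subspace ?T" using hyp by (intro vec.subspace_Inter) (auto simp: hyperplane_subspace)
  qed blast
  \<comment> \<open>Only these indices contribute a nonzero quotient \<open>g i\<close>.\<close>
  define P where "P = {i. ?e < d i}"
  define G where "G = insert ?al (g ` P \<union> linear_form ` W)"
  have finG: "finite G" using W(1) by (simp add: G_def)
  have alG: "?al \<in> ideal.span G" by (rule ideal.span_base) (simp add: G_def)
  have J: "p \<in> ideal.span G"
    if p: "\<eta> \<in> log_derivations (\<A> - {H})" "?v \<eta> = ?B * reduce_mod ?a p" for p \<eta>
  proof -
    obtain f where f: "\<eta> = (\<Sum>i\<in>UNIV. f i *s \<theta> i)" using b p(1) by (auto simp: log_basis_def)
    have "?v \<eta> = ?B * (\<Sum>i\<in>UNIV. reduce_mod ?a (f i) * g i)"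
      unfolding f der_apply_sum der_apply_scale reduce_mod_sum reduce_mod_mult g sum_distrib_left
        by (intro sum.cong) (simp_all add: ac_simps)
    then have "reduce_mod ?a p = (\<Sum>i\<in>UNIV. reduce_mod ?a (f i) * g i)"
      using p(2) mpoly_mult_left_cancel[OF B0] by metis
    also have "\<dots> \<in> ideal.span G"
    proof (rule ideal.span_sum)
      fix i
      show "reduce_mod ?a (f i) * g i \<in> ideal.span G"
      proof (cases "i \<in> P")
        case True
        then show ?thesis by (intro ideal.span_scale ideal.span_base) (simp add: G_def)
      next
        case False
        then show ?thesis using gz[of i] by (simp add: P_def ideal.span_zero)
      qed
    qed
    finally have "reduce_mod ?a p \<in> ideal.span G" .
    moreover obtain r where "p - reduce_mod ?a p = ?al * r" using dvd_diff_reduce_mod by (rule dvdE)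
    then have "p - reduce_mod ?a p \<in> ideal.span G" using ideal.span_scale[OF alG, of r]
      by (simp add: mult.commute)
    ultimately have "p - reduce_mod ?a p + reduce_mod ?a p \<in> ideal.span G"
      by (rule ideal.span_add[rotated])
    then show ?thesis by simp
  qed
  \<comment> \<open>Multiplication by the missing forms turns a derivation of the localization into one of the deletion.\<close>
  have prod: "(\<Prod>L\<in>\<A> - C. ?f L) \<in> ideal.span G" if C: "H \<in> C" "C \<subseteq> \<A>" "\<Inter> C \<noteq> ?T" for C
  proof -
    let ?X = "\<Inter> C"
    let ?L = "localization \<A> ?X"
    let ?Q = "\<Prod>L\<in>\<A> - ?L. ?f L"
    have XH: "?X \<subseteq> H" using C by auto
    have CL: "C \<subseteq> ?L" using C by (auto simp: localization_def)
    obtain \<eta> where \<eta>: "\<eta> \<in> log_derivations (?L - {H})" "?v \<eta> = reduce_mod ?a (terao_poly ?L H)"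
      using loc[OF C] by (auto simp: attains_terao_poly_def)
    have "?Q *s \<eta> \<in> log_derivations (\<A> - {H})"
      unfolding log_derivations_iff der_apply_scale
    proof
      fix L assume L: "L \<in> \<A> - {H}"
      show "?f L dvd ?Q * der_apply \<eta> (?f L)"
      proof (cases "L \<in> ?L")
        case True
        then show ?thesis using \<eta>(1) L unfolding log_derivations_iff by (intro dvd_mult) blast
      next
        case False
        then have "?f L dvd ?Q" using L fin by (intro dvd_prodI) auto
        then show ?thesis by (rule dvd_mult2)
      qed
    qed
    moreover have "?v (?Q *s \<eta>) = ?B * reduce_mod ?a (\<Prod>L\<in>chosen_lifts \<A> H - ?L. ?f L)"
      unfolding der_apply_scale reduce_mod_mult \<eta>(2)
      unfolding reduce_mod_mult[symmetric] terao_poly_localization[OF XH fin H, symmetric]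
        by (simp only: mult.commute)
    ultimately have *: "(\<Prod>L\<in>chosen_lifts \<A> H - ?L. ?f L) \<in> ideal.span G" by (rule J)
    have "chosen_lifts \<A> H - ?L \<subseteq> \<A> - C" using chosen_lifts_subset[of \<A> H] CL by blast
    then have "(\<Prod>L\<in>\<A> - C. ?f L) =
        (\<Prod>L\<in>\<A> - C - (chosen_lifts \<A> H - ?L). ?f L) * (\<Prod>L\<in>chosen_lifts \<A> H - ?L. ?f L)"
      using fin by (intro prod.subset_diff) auto
    then show ?thesis using ideal.span_scale[OF *] by simp
  qed
  have "\<exists>N. linear_form b ^ N \<in> ideal.span G" for b
  proof -
    have "\<exists>N. linear_form b ^ N \<in> ideal.span (G \<union> ?f ` {H})"
      by (rule power_in_span[OF A W(3) _ prod]) (use H in \<open>auto simp: G_def\<close>)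
    moreover have "G \<union> ?f ` {H} = G" by (auto simp: G_def)
    ultimately show ?thesis by simp
  qed
  then have "\<exists>N. var i ^ N \<in> ideal.span G" for i unfolding linear_form_axis[symmetric] .
  then obtain N where N: "\<And>i. var i ^ N i \<in> ideal.span G" by metis
  define M where "M = Max (range N)"
  have M: "var i ^ M \<in> ideal.span G" for i
    by (rule power_in_span_mono[OF N]) (simp add: M_def)
  have "\<exists>s>0. x \<in> homogeneous_part s" if x: "x \<in> G" for x
  proof -
    consider "x \<in> range linear_form" | i where "?e < d i" "x = g i" using x
      by (auto simp: G_def P_def)
    then show ?thesis
    proof cases
      case 1
      then show ?thesis by (intro exI[of _ "Suc 0"]) auto
    next
      case 2
      then show ?thesis using gh[of i] by (intro exI[of _ "d i - ?e"]) auto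
    qed
  qed
  then obtain s where s: "\<And>x. x \<in> G \<Longrightarrow> s x > 0 \<and> x \<in> homogeneous_part (s x)" by metis
  have "CARD('n) \<le> card G"
    by (rule card_generators_ge[OF finG _ _ M, where s = s]) (use s in auto)
  also have "card G \<le> Suc (card P + ?c)"
  proof -
    have "card (g ` P \<union> linear_form ` W) \<le> card (g ` P) + card (linear_form ` W)"
      by (rule card_Un_le)
    also have "\<dots> \<le> card P + card W" using W(1) by (intro add_mono card_image_le) auto
    finally show ?thesis unfolding G_def using W(2) card_insert_le_m1
      by (intro order_trans[OF card_insert_le_m1]) auto
  qed
  also have "card P = CARD('n) - card {i. d i \<le> ?e}"
  proof -
    have "P = UNIV - {i. d i \<le> ?e}" by (auto simp: P_def)
    then show ?thesis by (simp add: card_Diff_subset)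
  qed
  finally have "CARD('n) \<le> Suc (CARD('n) - card {i. d i \<le> ?e} + ?c)" .
  moreover have "card {i. d i \<le> ?e} \<le> CARD('n)" by (intro card_mono) auto
  ultimately show False using low by linarith
qed

section \<open>Freeness\<close>

lemma divisional_along_dvd:
  assumes "divisional_along \<A> H" "H \<in> \<A>"
  shows "characteristic_poly H (restriction \<A> H) dvd characteristic_poly UNIV \<A>"
proof -
  have eq: "\<Inter> (insert H (\<A> - {H})) = \<Inter> \<A>" using assms(2) by auto
  have "\<Inter> \<A> \<in> flats H (restriction \<A> H)" using flats_restrictionI[of "\<A> - {H}" \<A> H] eq by simp
  moreover have "localization \<A> (\<Inter> \<A>) = \<A>" by (auto simp: localization_def)
  ultimately show ?thesis using assms(1) by (metis divisional_along_def)
qed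

lemma log_basis_empty:
  "\<exists>\<theta> d. log_basis ({} :: ('k::field ^ 'n::finite) set set) \<theta> d \<and>
      exponents ({} :: ('k ^ 'n) set set) d"
proof (intro exI conjI)
  let ?\<theta> = "\<lambda>i. axis i 1 :: ('k, 'n) derivation"
  have comb: "(\<Sum>i\<in>UNIV. f i *s ?\<theta> i) = (\<chi> i. f i)" for f
    using basis_expansion[of "\<chi> i. f i"] by simp
  show "log_basis ({} :: ('k ^ 'n) set set) ?\<theta> (\<lambda>i. 0)"
    unfolding log_basis_def comb
  proof (intro conjI allI impI)
    show "axis i 1 $ j \<in> homogeneous_part 0" for i j :: 'n
      by (simp add: axis_def homogeneous_part_iff monomial_degree_def)
    show "f i = 0" if "(\<chi> i. f i) = 0" for f :: "'n \<Rightarrow> ('k, 'n) mpoly" and i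
      using that by (simp add: vec_eq_iff)
    have "\<theta> \<in> range (\<lambda>f. \<chi> i. f i)" for \<theta> :: "('k, 'n) derivation"
      by (rule range_eqI[of _ _ "\<lambda>i. \<theta> $ i"]) simp
    then show "log_derivations {} = range (\<lambda>f :: 'n \<Rightarrow> ('k, 'n) mpoly. \<chi> i. f i)"
      by (auto simp: log_derivations_def)
  qed
  have "characteristic_poly UNIV ({} :: ('k ^ 'n) set set) = monom 1 (CARD('n))"
    using characteristic_poly_UNIV[of "{}" "\<lambda>x. x :: ('k ^ 'n) set"] by (simp add: card_cart_basis)
  then show "exponents ({} :: ('k ^ 'n) set set) (\<lambda>i. 0)" by (simp add: exponents_def monom_altdef)
qed

text \<open>
  Simultaneous induction on the number of hyperplanes: the deletion is smaller and arises by an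
  addition of its own, and so are the proper localizations, at which Terao's polynomial has to be attained.
\<close>

lemma log_basis_and_attains_terao_poly:
  assumes "addable (\<A> - {H})" "H \<in> \<A>" "hyperplane H" "divisional_along \<A> H"
  shows "(\<exists>\<theta> d. log_basis (\<A> - {H}) \<theta> d \<and> exponents (\<A> - {H}) d) \<and> attains_terao_poly \<A> H"
  using assms
proof (induction "card \<A>" arbitrary: \<A> H rule: less_induct)
  case less
  have A: "arrangement \<A>"
    using addable_arrangement[OF less.prems(1)] less.prems(2,3) by (auto simp: arrangement_iff)
  then have fin: "finite \<A>" by (rule arrangement_finite)
  have "\<exists>\<theta> d. log_basis (\<A> - {H}) \<theta> d \<and> exponents (\<A> - {H}) d"
    using less.prems(1)
  proof (cases rule: addable.cases)
    case empty
    then show ?thesis unfolding empty by (intro log_basis_empty)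
  next
    case (insert \<B> K)
    have BK: "\<B> = \<A> - {H} - {K}" "K \<in> \<A> - {H}" using insert by auto
    have "card (\<A> - {H}) < card \<A>" using less.prems(2) fin by (intro psubset_card_mono) auto
    moreover have "addable (\<A> - {H} - {K})" using insert BK by simp
    moreover have "divisional_along (\<A> - {H}) K" using insert by simp
    ultimately have IH: "\<exists>\<theta> d. log_basis (\<A> - {H} - {K}) \<theta> d \<and>
        exponents (\<A> - {H} - {K}) d" "attains_terao_poly (\<A> - {H}) K"
      using less.hyps[of "\<A> - {H}" K] BK(2) insert by blast+
    then obtain \<theta> d where "log_basis (\<A> - {H} - {K}) \<theta> d" "exponents (\<A> - {H} - {K}) d" by blast
    then show ?thesis
      using addition_step[OF addable_arrangement[OF less.prems(1)] BK(2)] IH(2) divisional_along_dvd[OF \<open>divisional_along (\<A> - {H}) K\<close> BK(2)]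
      by blast
  qed
  moreover from this obtain \<theta> d where b: "log_basis (\<A> - {H}) \<theta> d" "exponents (\<A> - {H}) d" by blast
  have "attains_terao_poly \<A> H"
  proof (rule attains_terao_poly_step[OF A less.prems(2) b divisional_along_dvd[OF less.prems(4,2)]])
    fix C assume C: "H \<in> C" "C \<subseteq> \<A>" "\<Inter> C \<noteq> \<Inter> \<A>"
    let ?L = "localization \<A> (\<Inter> C)"
    have "?L \<noteq> \<A>"
    proof
      assume "?L = \<A>"
      then have "\<Inter> C \<subseteq> \<Inter> \<A>" by (auto simp: localization_def)
      then show False using C by auto
    qed
    then have "?L \<subset> \<A>" using localization_subset by blast
    then have "card ?L < card \<A>" using fin by (intro psubset_card_mono)
    moreover have "?L - {H} = localization (\<A> - {H}) (\<Inter> C)" by (auto simp: localization_def)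
    then have "addable (?L - {H})" using addable_localization[OF less.prems(1)] by simp
    moreover have "H \<in> ?L" using C by (auto simp: localization_def)
    moreover have "divisional_along ?L H" using C
      by (intro divisional_along_localization less.prems(4)) auto
    ultimately show "attains_terao_poly ?L H" using less.hyps less.prems(3) by blast
  qed
  ultimately show ?case by blast
qed

theorem addable_free:
  assumes "addable \<A>"
  shows "free_arrangement \<A>"
  using assms
proof (cases rule: addable.cases)
  case empty
  then show ?thesis using log_basis_empty log_basis_free by blast
next
  case (insert \<B> H)
  have eq: "\<A> - {H} = \<B>" and H: "H \<in> \<A>" using insert by auto
  have div: "divisional_along \<A> H" using insert by simp
  have *: "(\<exists>\<theta> d. log_basis (\<A> - {H}) \<theta> d \<and> exponents (\<A> - {H}) d) \<and> attains_terao_poly \<A> H"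
    by (rule log_basis_and_attains_terao_poly) (use insert eq H div in auto)
  then obtain \<theta> d where "log_basis (\<A> - {H}) \<theta> d" "exponents (\<A> - {H}) d" by blast
  then show ?thesis
    using addition_step[OF addable_arrangement[OF assms] H] * divisional_along_dvd[OF div H] log_basis_free by blast
qed

theorem theorem1p8:
  fixes \<A> :: "('k::field ^ 'n::finite) set set"
  assumes "arrangement \<A>" and "\<A> \<in> additionally_free"
  shows "free_arrangement \<A> \<and>
    (\<forall>\<C> :: ('k ^ 'n) set set.
       arrangement \<C> \<and> poset_isomorphic (flats UNIV \<C>) (flats UNIV \<A>) \<longrightarrow>
       free_arrangement \<C>)"
  using additionally_free_addable[OF assms(2)] addable_poset_isomorphic addable_free by blast

end
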